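(* Let $M$ be a formal generic submanifold through $0\in\mathbb C^N$ and assume that $M$ is finitely nondegenerate and of finite type at $0$. Then any formal finite holomorphic mapping $H\colon(\mathbb C^N,0)\to(\mathbb C^N,0)$ sending $M$ into another formal generic submanifold $\widetilde M$ (through $0$) of the same dimension is a local formal biholomorphism (i.e. $H$ is a formally invertible mapping).
   Context: For a formal power series $f$, $\bar f$ denotes the series obtained by conjugating all coefficients. A formal generic submanifold $M$ of codimension $d$ (dimension $2N-d$, CR dimension $n:=N-d$) through $0$ in $\mathbb C^N$ is given by $\rho=(\rho_1,\dots,\rho_d)\in\mathbb C[[Z,\zeta]]^d$, $Z,\zeta\in\mathbb C^N$, with $\rho(0)=0$, $\rho(Z,\zeta)=\bar\rho(\zeta,Z)$ and $\partial_Z\rho_1(0)\wedge\dots\wedge\partial_Z\rho_d(0)\ne0$. A formal (holomorphic) mapping $H\colon(\mathbb C^N,0)\to(\mathbb C^N,0)$ is an $N$-tuple of elements of $\mathbb C[[Z]]$ without constant term; it is finite if the ideal generated by its components has finite codimension in $\mathbb C[[Z]]$. If $\widetilde M$ is another formal generic submanifold of codimension $d$ with defining series $\tilde\rho$, then $H$ sends $M$ into $\widetilde M$ if $\tilde\rho(H(Z),\bar H(\zeta))=c(Z,\zeta)\rho(Z,\zeta)$ for some $d\times d$ matrix $c$ of formal power series. A formal $(1,0)$ (resp. $(0,1)$) vector field $X=\sum_j a_j(Z,\zeta)\partial_{Z_j}$ (resp. $X=\sum_j b_j(Z,\zeta)\partial_{\zeta_j}$), with formal power series coefficients, is tangent to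 $M$ if all $X\rho_i$ lie in the ideal generated by $\rho_1,\dots,\rho_d$. $M$ is of finite type at $0$ if the complex Lie algebra $\mathfrak g_M$ generated by all such fields satisfies $\mathfrak g_M(0)=\mathbb CT_0M:=\{X\in\mathbb C^{2N}: d\rho_i(0)X=0,\ i=1,\dots,d\}$. $M$ is finitely nondegenerate at $0$ if $$\operatorname{span}_{\mathbb C}\Big\{L^\alpha\Big(\frac{\partial\rho_j}{\partial Z}\Big)(0)\colon j=1,\dots,d,\ \alpha\in\mathbb Z_{\ge0}^n\Big\}=\mathbb C^N,$$ where $\partial\rho_j/\partial Z$ is the vector of $Z$-derivatives of $\rho_j(Z,\zeta)$, $L_1,\dots,L_n$ is a basis of the formal $(0,1)$ vector fields tangent to $M$ (i.e. $n$ such fields linearly independent at $0$), and $L^\alpha:=L_1^{\alpha_1}\cdots L_n^{\alpha_n}$. *)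

theory Defs
  imports "HOL-Analysis.Analysis"
begin

section \<open>Formal power series in finitely many variables\<close>

text \<open>
  A series in variables indexed by the finite type \<open>'v\<close> is its coefficient function; the
  multi-index \<open>m :: nat ^ 'v\<close> stands for the monomial with exponent \<open>m $ i\<close> in the variable \<open>i\<close>.
\<close>

typedef (overloaded) ('v::finite, 'a) mfps = "UNIV :: (nat ^ 'v \<Rightarrow> 'a) set"
  morphisms mcoeff Abs_mfps ..

setup_lifting type_definition_mfps

lemma mfps_eqI: "(\<And>m. mcoeff f m = mcoeff g m) \<Longrightarrow> f = g"
  by transfer auto

lemma finite_multi_index_le:
  fixes k :: "nat ^ 'v::finite"
  shows "finite {m. \<forall>i. m $ i \<le> k $ i}"
proof -
  have "{m :: nat ^ 'v. \<forall>i. m $ i \<le> k $ i} \<subseteq> vec_lambda ` (PiE UNIV (\<lambda>i. {..k $ i}))"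
  proof
    fix m :: "nat ^ 'v"
    assume "m \<in> {m. \<forall>i. m $ i \<le> k $ i}"
    then have "vec_nth m \<in> PiE UNIV (\<lambda>i. {..k $ i})" by auto
    then show "m \<in> vec_lambda ` (PiE UNIV (\<lambda>i. {..k $ i}))"
      by (metis image_eqI vec_lambda_eta)
  qed
  then show ?thesis
    by (rule finite_subset) (intro finite_imageI finite_PiE, auto)
qed

lemma finite_multi_index_splits:
  fixes k :: "nat ^ 'v::finite"
  shows "finite {(a, b). a + b = k}"
proof (rule finite_subset)
  show "{(a, b). a + b = k} \<subseteq> {m. \<forall>i. m $ i \<le> k $ i} \<times> {m. \<forall>i. m $ i \<le> k $ i}"
    by auto
  show "finite ({m. \<forall>i. m $ i \<le> k $ i} \<times> {m. \<forall>i. m $ i \<le> k $ i})"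
    by (intro finite_cartesian_product finite_multi_index_le)
qed

instantiation mfps :: (finite, comm_ring_1) comm_ring_1
begin

lift_definition zero_mfps :: "('a, 'b) mfps" is "\<lambda>m. 0" .
lift_definition one_mfps :: "('a, 'b) mfps" is "\<lambda>m. if m = 0 then 1 else 0" .
lift_definition plus_mfps :: "('a, 'b) mfps \<Rightarrow> ('a, 'b) mfps \<Rightarrow> ('a, 'b) mfps"
  is "\<lambda>f g m. f m + g m" .
lift_definition minus_mfps :: "('a, 'b) mfps \<Rightarrow> ('a, 'b) mfps \<Rightarrow> ('a, 'b) mfps"
  is "\<lambda>f g m. f m - g m" .
lift_definition uminus_mfps :: "('a, 'b) mfps \<Rightarrow> ('a, 'b) mfps"
  is "\<lambda>f m. - f m" .
lift_definition times_mfps :: "('a, 'b) mfps \<Rightarrow> ('a, 'b) mfps \<Rightarrow> ('a, 'b) mfps"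
  is "\<lambda>f g m. \<Sum>(a, b) | a + b = m. f a * g b" .

instance
proof
  fix f g h :: "('a, 'b) mfps"
  show "f + g + h = f + (g + h)" "f + g = g + f" "0 + f = f" "- f + f = 0" "f - g = f + - g"
    by (transfer, simp add: fun_eq_iff algebra_simps)+
  show "(0 :: ('a, 'b) mfps) \<noteq> 1"
    by transfer (auto simp: fun_eq_iff)
  show "f * g = g * f"
  proof (rule mfps_eqI)
    fix m :: "nat ^ 'a"
    show "mcoeff (f * g) m = mcoeff (g * f) m"
      unfolding times_mfps.rep_eq
      by (rule sum.reindex_bij_witness[of _ prod.swap prod.swap]) (auto simp: algebra_simps)
  qed
  show "(f + g) * h = f * h + g * h"
    by transfer (simp add: fun_eq_iff algebra_simps sum.distrib case_prod_unfold)
  show "1 * f = f"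
  proof (rule mfps_eqI)
    fix m :: "nat ^ 'a"
    have "mcoeff (1 * f) m = (\<Sum>(a, b) | a + b = m. (if a = 0 then 1 else 0) * mcoeff f b)"
      by (simp add: times_mfps.rep_eq one_mfps.rep_eq)
    also have "\<dots> = (\<Sum>(a, b)\<in>{(0 :: nat ^ 'a, m)}. (if a = 0 then 1 else 0) * mcoeff f b)"
      by (rule sum.mono_neutral_right) (auto intro: finite_multi_index_splits split: if_splits)
    finally show "mcoeff (1 * f) m = mcoeff f m" by simp
  qed
  show "f * g * h = f * (g * h)"
  proof (rule mfps_eqI)
    fix m :: "nat ^ 'a"
    let ?L = "SIGMA p : {(a, b). a + b = m}. {(a, b). a + b = fst p}"
    let ?R = "SIGMA p : {(a, b). a + b = m}. {(a, b). a + b = snd p}"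
    have "mcoeff (f * g * h) m =
        (\<Sum>p | fst p + snd p = m. \<Sum>q | fst q + snd q = fst p.
           mcoeff f (fst q) * mcoeff g (snd q) * mcoeff h (snd p))"
      by (simp add: times_mfps.rep_eq sum_distrib_right case_prod_unfold)
    also have "\<dots> = (\<Sum>(p, q)\<in>?L. mcoeff f (fst q) * mcoeff g (snd q) * mcoeff h (snd p))"
      using finite_multi_index_splits
      by (subst sum.Sigma) (auto simp: case_prod_unfold)
    also have "\<dots> = (\<Sum>(p, q)\<in>?R. mcoeff f (fst p) * (mcoeff g (fst q) * mcoeff h (snd q)))"
      by (rule sum.reindex_bij_witness
            [of _ "\<lambda>((a, b), (c, d)). ((a + c, d), (a, c))" "\<lambda>((a, b), (c, d)). ((c, d + b), (d, b))"])
         (auto simp: algebra_simps)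
    also have "\<dots> = (\<Sum>p | fst p + snd p = m. \<Sum>q | fst q + snd q = snd p.
           mcoeff f (fst p) * (mcoeff g (fst q) * mcoeff h (snd q)))"
      using finite_multi_index_splits
      by (subst sum.Sigma) (auto simp: case_prod_unfold)
    also have "\<dots> = mcoeff (f * (g * h)) m"
      by (simp add: times_mfps.rep_eq sum_distrib_left case_prod_unfold)
    finally show "mcoeff (f * g * h) m = mcoeff (f * (g * h)) m" .
  qed
qed

end

lift_definition mfps_scale :: "'a::comm_ring_1 \<Rightarrow> ('v::finite, 'a) mfps \<Rightarrow> ('v, 'a) mfps"
  is "\<lambda>c f m. c * f m" .

lift_definition mfps_var :: "'v::finite \<Rightarrow> ('v, 'a::comm_ring_1) mfps"
  is "\<lambda>i m. if m = axis i 1 then 1 else 0" .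

lift_definition mfps_cnj :: "('v::finite, complex) mfps \<Rightarrow> ('v, complex) mfps"
  is "\<lambda>f m. cnj (f m)" .

lift_definition mfps_deriv ::
  "'v::finite \<Rightarrow> ('v, 'a::comm_ring_1) mfps \<Rightarrow> ('v, 'a) mfps"
  is "\<lambda>i f m. of_nat (Suc (m $ i)) * f (m + axis i 1)" .

definition mfps_const_coeff :: "('v::finite, 'a) mfps \<Rightarrow> 'a" where
  "mfps_const_coeff f = mcoeff f 0"

definition mdeg :: "nat ^ 'v::finite \<Rightarrow> nat" where
  "mdeg m = (\<Sum>i\<in>UNIV. m $ i)"

text \<open>
  \<open>mfps_compose f G\<close> is \<open>f\<close> with \<open>G i\<close> substituted for the variable \<open>i\<close>. This is only meaningful
  if no \<open>G i\<close> has a constant term: then the powers \<open>G\<^sup>a\<close> with \<open>mdeg a > mdeg m\<close> do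
  not contribute to the coefficient of the monomial \<open>m\<close>, so the finite sum below is the full one.
\<close>

definition mfps_compose ::
  "('v::finite, 'a::comm_ring_1) mfps \<Rightarrow> ('v \<Rightarrow> ('w::finite, 'a) mfps) \<Rightarrow> ('w, 'a) mfps" where
  "mfps_compose f G =
     Abs_mfps (\<lambda>m. \<Sum>a | mdeg a \<le> mdeg m. mcoeff f a * mcoeff (\<Prod>i\<in>UNIV. G i ^ (a $ i)) m)"

text \<open>\<open>mfps_ideal.span S\<close> is the ideal generated by \<open>S\<close>; \<open>mfps_vs.span S\<close> is the linear span of
  \<open>S\<close> over the coefficient field.\<close>

global_interpretation mfps_ideal:
  module "(*) :: ('v::finite, 'a::comm_ring_1) mfps \<Rightarrow> ('v, 'a) mfps \<Rightarrow> ('v, 'a) mfps"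
  by unfold_locales (simp_all add: algebra_simps)

global_interpretation mfps_vs:
  vector_space "mfps_scale :: 'a::field \<Rightarrow> ('v::finite, 'a) mfps \<Rightarrow> ('v, 'a) mfps"
  by unfold_locales (transfer; simp add: fun_eq_iff algebra_simps)+

section \<open>Formal generic submanifolds\<close>

text \<open>
  Series in \<open>(Z, \<zeta>)\<close> with \<open>Z, \<zeta> \<in> \<complex>\<^sup>N\<close>, \<open>N = CARD('n)\<close>, have variables indexed by \<open>'n + 'n\<close>:
  \<open>Inl j\<close> is \<open>Z\<^sub>j\<close> and \<open>Inr j\<close> is \<open>\<zeta>\<^sub>j\<close>. A submanifold of codimension \<open>d\<close> is represented by its
  defining series \<open>\<rho> 0, \<dots>, \<rho> (d - 1)\<close>; the values \<open>\<rho> i\<close> for \<open>i \<ge> d\<close> are irrelevant.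
\<close>

type_synonym 'n defining = "nat \<Rightarrow> ('n + 'n, complex) mfps"

definition swap_vars :: "'n::finite + 'n \<Rightarrow> ('n + 'n, complex) mfps" where
  "swap_vars k = mfps_var (case k of Inl j \<Rightarrow> Inr j | Inr j \<Rightarrow> Inl j)"

definition lin_indep_family :: "nat \<Rightarrow> (nat \<Rightarrow> complex ^ 'k::finite) \<Rightarrow> bool" where
  "lin_indep_family d v \<longleftrightarrow> inj_on v {..<d} \<and> vec.independent (v ` {..<d})"

definition Z_gradient :: "('n::finite + 'n, complex) mfps \<Rightarrow> ('n + 'n, complex) mfps ^ 'n" where
  "Z_gradient f = (\<chi> j. mfps_deriv (Inl j) f)"

definition vec_at_0 :: "('v::finite, complex) mfps ^ 'k::finite \<Rightarrow> complex ^ 'k" where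
  "vec_at_0 F = (\<chi> k. mfps_const_coeff (F $ k))"

text \<open>The condition that the wedge product of the \<open>Z\<close>-differentials at \<open>0\<close> does not vanish is
  expressed as linear independence of the family of \<open>Z\<close>-gradients at \<open>0\<close>.\<close>

definition formal_generic :: "nat \<Rightarrow> 'n::finite defining \<Rightarrow> bool" where
  "formal_generic d \<rho> \<longleftrightarrow>
     (\<forall>i<d. mfps_const_coeff (\<rho> i) = 0) \<and>
     (\<forall>i<d. \<rho> i = mfps_compose (mfps_cnj (\<rho> i)) swap_vars) \<and>
     lin_indep_family d (\<lambda>i. vec_at_0 (Z_gradient (\<rho> i)))"

section \<open>Formal vector fields\<close>

text \<open>A formal vector field is the vector of its coefficients with respect to
  \<open>\<partial>/\<partial>Z\<^sub>j\<close> (index \<open>Inl j\<close>) and \<open>\<partial>/\<partial>\<zeta>\<^sub>j\<close> (index \<open>Inr j\<close>).\<close>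

type_synonym 'n vfield = "('n + 'n, complex) mfps ^ ('n + 'n)"

definition vf_apply ::
  "'n::finite vfield \<Rightarrow> ('n + 'n, complex) mfps \<Rightarrow> ('n + 'n, complex) mfps" where
  "vf_apply X f = (\<Sum>k\<in>UNIV. X $ k * mfps_deriv k f)"

definition vf_bracket :: "'n::finite vfield \<Rightarrow> 'n vfield \<Rightarrow> 'n vfield" where
  "vf_bracket X Y = (\<chi> k. vf_apply X (Y $ k) - vf_apply Y (X $ k))"

definition vf_scale :: "complex \<Rightarrow> 'n::finite vfield \<Rightarrow> 'n vfield" where
  "vf_scale c X = (\<chi> k. mfps_scale c (X $ k))"

definition vf_10 :: "'n::finite vfield \<Rightarrow> bool" where
  "vf_10 X \<longleftrightarrow> (\<forall>j. X $ Inr j = 0)"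

definition vf_01 :: "'n::finite vfield \<Rightarrow> bool" where
  "vf_01 X \<longleftrightarrow> (\<forall>j. X $ Inl j = 0)"

definition vf_tangent :: "nat \<Rightarrow> 'n::finite defining \<Rightarrow> 'n vfield \<Rightarrow> bool" where
  "vf_tangent d \<rho> X \<longleftrightarrow> (\<forall>i<d. vf_apply X (\<rho> i) \<in> mfps_ideal.span (\<rho> ` {..<d}))"

inductive_set lie_alg :: "nat \<Rightarrow> 'n::finite defining \<Rightarrow> 'n vfield set"
  for d :: nat and \<rho> :: "'n defining" where
  gen_10: "vf_10 X \<Longrightarrow> vf_tangent d \<rho> X \<Longrightarrow> X \<in> lie_alg d \<rho>"
| gen_01: "vf_01 X \<Longrightarrow> vf_tangent d \<rho> X \<Longrightarrow> X \<in> lie_alg d \<rho>"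
| add: "X \<in> lie_alg d \<rho> \<Longrightarrow> Y \<in> lie_alg d \<rho> \<Longrightarrow> X + Y \<in> lie_alg d \<rho>"
| scale: "X \<in> lie_alg d \<rho> \<Longrightarrow> vf_scale c X \<in> lie_alg d \<rho>"
| bracket: "X \<in> lie_alg d \<rho> \<Longrightarrow> Y \<in> lie_alg d \<rho> \<Longrightarrow> vf_bracket X Y \<in> lie_alg d \<rho>"

definition complex_tangent_space :: "nat \<Rightarrow> 'n::finite defining \<Rightarrow> (complex ^ ('n + 'n)) set" where
  "complex_tangent_space d \<rho> =
     {v. \<forall>i<d. (\<Sum>k\<in>UNIV. mfps_const_coeff (mfps_deriv k (\<rho> i)) * v $ k) = 0}"

definition finite_type :: "nat \<Rightarrow> 'n::finite defining \<Rightarrow> bool" where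
  "finite_type d \<rho> \<longleftrightarrow> vec_at_0 ` lie_alg d \<rho> = complex_tangent_space d \<rho>"

definition CR_basis :: "nat \<Rightarrow> 'n::finite defining \<Rightarrow> (nat \<Rightarrow> 'n vfield) \<Rightarrow> bool" where
  "CR_basis d \<rho> L \<longleftrightarrow>
     (\<forall>i < CARD('n) - d. vf_01 (L i) \<and> vf_tangent d \<rho> (L i)) \<and>
     lin_indep_family (CARD('n) - d) (\<lambda>i. vec_at_0 (L i))"

text \<open>\<open>vf_power L \<alpha> m = L\<^sub>0\<^bsup>\<alpha> 0\<^esup> \<dots> L\<^bsub>m-1\<^esub>\<^bsup>\<alpha> (m-1)\<^esup>\<close>, the rightmost operator being applied first.\<close>

primrec vf_power :: "(nat \<Rightarrow> 'n::finite vfield) \<Rightarrow> (nat \<Rightarrow> nat) \<Rightarrow> nat \<Rightarrow>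
    ('n + 'n, complex) mfps \<Rightarrow> ('n + 'n, complex) mfps" where
  "vf_power L \<alpha> 0 f = f"
| "vf_power L \<alpha> (Suc m) f = vf_power L \<alpha> m ((vf_apply (L m) ^^ \<alpha> m) f)"

text \<open>For generic \<open>\<rho>\<close> a basis \<open>L\<close> exists and whether the span below is everything does not depend
  on its choice, so the existential quantifier over \<open>L\<close> is immaterial.\<close>

definition finitely_nondegenerate :: "nat \<Rightarrow> 'n::finite defining \<Rightarrow> bool" where
  "finitely_nondegenerate d \<rho> \<longleftrightarrow>
     (\<exists>L. CR_basis d \<rho> L \<and>
        vec.span {vec_at_0 (\<chi> l. vf_power L \<alpha> (CARD('n) - d) (Z_gradient (\<rho> j) $ l)) | j \<alpha>. j < d}
          = UNIV)"

section \<open>Formal mappings\<close>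

type_synonym 'n fmap = "('n, complex) mfps ^ 'n"

definition formal_map :: "'n::finite fmap \<Rightarrow> bool" where
  "formal_map H \<longleftrightarrow> (\<forall>j. mfps_const_coeff (H $ j) = 0)"

text \<open>The quotient by the ideal of the components is spanned by finitely many classes.\<close>

definition finite_map :: "'n::finite fmap \<Rightarrow> bool" where
  "finite_map H \<longleftrightarrow>
     (\<exists>B. finite B \<and>
        (\<forall>f. \<exists>b\<in>mfps_vs.span B. f - b \<in> mfps_ideal.span (range (\<lambda>j. H $ j))))"

text \<open>The substitution \<open>(Z, \<zeta>) \<mapsto> (H(Z), H\<^sup>*(\<zeta>))\<close>, where \<open>H\<^sup>*\<close> has the conjugated coefficients.\<close>

definition complexified :: "'n::finite fmap \<Rightarrow> 'n + 'n \<Rightarrow> ('n + 'n, complex) mfps" where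
  "complexified H k = (case k of
       Inl j \<Rightarrow> mfps_compose (H $ j) (\<lambda>i. mfps_var (Inl i))
     | Inr j \<Rightarrow> mfps_compose (mfps_cnj (H $ j)) (\<lambda>i. mfps_var (Inr i)))"

definition sends_into :: "nat \<Rightarrow> 'n::finite fmap \<Rightarrow> 'n defining \<Rightarrow> 'n defining \<Rightarrow> bool" where
  "sends_into d H \<rho> \<rho>' \<longleftrightarrow>
     (\<exists>c :: nat \<Rightarrow> nat \<Rightarrow> ('n + 'n, complex) mfps.
        \<forall>i<d. mfps_compose (\<rho>' i) (complexified H) = (\<Sum>j<d. c i j * \<rho> j))"

definition map_compose :: "'n::finite fmap \<Rightarrow> 'n fmap \<Rightarrow> 'n fmap" where
  "map_compose G H = (\<chi> j. mfps_compose (G $ j) (\<lambda>i. H $ i))"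

definition formally_invertible :: "'n::finite fmap \<Rightarrow> bool" where
  "formally_invertible H \<longleftrightarrow>
     (\<exists>G. formal_map G \<and>
        map_compose G H = (\<chi> j. mfps_var j) \<and> map_compose H G = (\<chi> j. mfps_var j))"

end

theory Submission
  imports Defs "HOL-Computational_Algebra.Primes"
begin

text \<open>
  Write \<open>\<rho>' \<circ> (H, H\<^sup>*) = c \<rho>\<close>.  The theorem splits into two statements: \<open>c(0)\<close> is invertible
  (\<open>finite_map_transversal\<close>), and if \<open>c(0)\<close> is invertible, finite nondegeneracy makes \<open>H'(0)\<close>
  injective (\<open>jacobian_injective_if_transversal\<close>).  The formal inverse function theorem
  concludes.

  The second statement is a differentiation.  In a direction \<open>v\<close> with \<open>H'(0) v = 0\<close>, the derivative of
  \<open>c \<rho>\<close> is a combination of the components of \<open>H'(Z) v\<close>.  These vanish at the origin and are constants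
  of all \<open>(0,1)\<close> fields, so solving for the derivatives of the \<open>\<rho>\<^sub>j\<close> modulo \<open>\<rho>\<close> and applying powers
  of a basis of tangent \<open>(0,1)\<close> fields gives zero at the origin: \<open>v\<close> is annihilated by the vectors
  that span \<open>\<complex>\<^sup>N\<close> by finite nondegeneracy.

  Transversality rests on the Jacobian determinant \<open>J = det H'\<close>.  It is not zero because \<open>H\<close> is
  finite, hence every variable is algebraic over the series in \<open>H\<close>
  (\<open>finite_map_jacobian_nonzero\<close>).  Differentiating \<open>\<rho>' \<circ> (H, H\<^sup>*) = c \<rho>\<close> shows that on
  the complexified submanifold \<open>det c\<close> divides both \<open>J(Z)\<close> and its conjugate \<open>J\<^sup>*(\<zeta>)\<close>
  (\<open>det_divides_jacobian\<close>).  Now \<open>J(Z)\<close> is a constant of the tangent \<open>(0,1)\<close> fields, and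
  \<open>J\<^sup>*(\<zeta>)\<close> is a constant of the tangent \<open>(1,0)\<close> fields.  In the factorial ring of functions on the
  submanifold, an irreducible factor \<open>p\<close> of a nonzero constant of a derivation \<open>D\<close> in
  characteristic zero satisfies \<open>p | D p\<close>.  If \<open>det c\<close> were not a unit, an irreducible factor of it
  would thus generate an ideal that is invariant under all the \<open>(1,0)\<close> and \<open>(0,1)\<close> fields, and
  under the Lie algebra that they generate.  By finite type this Lie algebra spans the tangent space
  at the origin, so an element of minimal order in the ideal could be differentiated to one of
  smaller order (\<open>finite_type_invariant_ideal\<close>), a contradiction.

  Instead of irreducible factors, the proof works with prime ideals of height one
  (\<open>height_one_prime_invariant\<close>).  Their properties follow from two facts about power series rings,
  both proved by comparing leading monomials: they are Noetherian and completely integrally closed.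
  The ring of functions on the submanifold is realised inside the ring of all power series as the
  image of a retraction, which substitutes for some variables the solution of the equations
  \<open>\<rho>\<^sub>i = 0\<close> (\<open>adapted_retraction\<close>).
\<close>


section \<open>Order of vanishing and monomials\<close>

text \<open>Membership in the \<open>k\<close>-th power of the maximal ideal; all limits below are taken with respect
  to this filtration.\<close>

definition ord_ge :: "nat \<Rightarrow> ('v::finite, 'a::comm_ring_1) mfps \<Rightarrow> bool" where
  "ord_ge k f \<longleftrightarrow> (\<forall>m. mdeg m < k \<longrightarrow> mcoeff f m = 0)"

definition mmonom :: "nat ^ 'v::finite \<Rightarrow> ('v, 'a::comm_ring_1) mfps" where
  "mmonom a = Abs_mfps (\<lambda>m. if m = a then 1 else 0)"

lemma mcoeff_Abs [simp]: "mcoeff (Abs_mfps h) = h"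
  by (simp add: Abs_mfps_inverse)

lemma mcoeff_mmonom: "mcoeff (mmonom a) m = (if m = a then 1 else 0)"
  by (simp add: mmonom_def)

lemmas mcoeff_simps [simp] = zero_mfps.rep_eq plus_mfps.rep_eq minus_mfps.rep_eq
  uminus_mfps.rep_eq mfps_scale.rep_eq

lemma mcoeff_sum [simp]: "mcoeff (sum f A) m = (\<Sum>x\<in>A. mcoeff (f x) m)"
  by (induction A rule: infinite_finite_induct) auto

lemma mdeg_add [simp]: "mdeg (a + b) = mdeg a + mdeg b"
  by (simp add: mdeg_def sum.distrib)

lemma mdeg_0 [simp]: "mdeg 0 = 0"
  by (simp add: mdeg_def)

lemma mdeg_eq_0_iff [simp]: "mdeg m = 0 \<longleftrightarrow> m = 0"
  by (auto simp: mdeg_def vec_eq_iff)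

lemma mdeg_axis [simp]: "mdeg (axis i (k::nat)) = k"
  by (simp add: mdeg_def axis_def)

lemma nth_le_mdeg: "m $ i \<le> mdeg m"
  unfolding mdeg_def by (rule member_le_sum) auto

lemma finite_mdeg_le [simp, intro]: "finite {m :: nat ^ 'v::finite. mdeg m \<le> k}"
proof (rule finite_subset)
  show "{m :: nat ^ 'v. mdeg m \<le> k} \<subseteq> {m. \<forall>i. m $ i \<le> (\<chi> i. k) $ i}"
    using nth_le_mdeg order_trans by fastforce
qed (rule finite_multi_index_le)

lemma finite_mdeg_less [simp, intro]: "finite {m :: nat ^ 'v::finite. mdeg m < k}"
  by (rule finite_subset[OF _ finite_mdeg_le[of k]]) auto

lemma mdeg_eq_1: "mdeg m = 1 \<Longrightarrow> \<exists>i. m = axis i 1"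
proof -
  assume 1: "mdeg m = 1"
  then obtain i where i: "m $ i \<noteq> 0"
    by (metis mdeg_eq_0_iff vec_eq_iff zero_index zero_neq_one)
  have m: "m = (m - axis i 1) + axis i 1"
    using i by (auto simp: vec_eq_iff axis_def)
  then have "mdeg m = mdeg (m - axis i 1) + 1"
    by (metis mdeg_add mdeg_axis)
  with 1 have "m - axis i 1 = 0" by simp
  with m show ?thesis by (metis add_0)
qed

lemma ord_geD: "ord_ge k f \<Longrightarrow> mdeg m < k \<Longrightarrow> mcoeff f m = 0"
  by (simp add: ord_ge_def)

lemma ord_ge_0 [simp]: "ord_ge 0 f"
  by (simp add: ord_ge_def)

lemma ord_ge_zero [simp]: "ord_ge k 0"
  by (simp add: ord_ge_def)

lemma ord_ge_mono: "ord_ge k f \<Longrightarrow> j \<le> k \<Longrightarrow> ord_ge j f"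
  by (simp add: ord_ge_def)

lemma ord_ge_add: "ord_ge k f \<Longrightarrow> ord_ge k g \<Longrightarrow> ord_ge k (f + g)"
  and ord_ge_diff: "ord_ge k f \<Longrightarrow> ord_ge k g \<Longrightarrow> ord_ge k (f - g)"
  and ord_ge_uminus: "ord_ge k f \<Longrightarrow> ord_ge k (- f)"
  and ord_ge_scale: "ord_ge k f \<Longrightarrow> ord_ge k (mfps_scale c f)"
  by (auto simp: ord_ge_def)

lemma ord_ge_sum: "(\<And>x. x \<in> A \<Longrightarrow> ord_ge k (f x)) \<Longrightarrow> ord_ge k (sum f A)"
  by (simp add: ord_ge_def)

lemma ord_ge_all_imp_0: "(\<And>k. ord_ge k f) \<Longrightarrow> f = 0"
  by (rule mfps_eqI) (metis lessI ord_geD zero_mfps.rep_eq)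

lemma ord_ge_mult:
  assumes "ord_ge j f" "ord_ge k g"
  shows "ord_ge (j + k) (f * g)"
  unfolding ord_ge_def
proof (intro allI impI)
  fix m :: "nat ^ 'a"
  assume m: "mdeg m < j + k"
  have "mcoeff f a * mcoeff g b = 0" if "a + b = m" for a b
  proof -
    have "mdeg a < j \<or> mdeg b < k" using m that by auto
    then show ?thesis using assms by (auto simp: ord_ge_def)
  qed
  then show "mcoeff (f * g) m = 0"
    unfolding times_mfps.rep_eq by (intro sum.neutral) auto
qed

lemma ord_ge_mult_left: "ord_ge k g \<Longrightarrow> ord_ge k (f * g)"
  using ord_ge_mult[of 0 f k g] by simp

lemma ord_ge_1_iff: "ord_ge 1 f \<longleftrightarrow> mfps_const_coeff f = 0"
  by (auto simp: ord_ge_def mfps_const_coeff_def)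

lemma ord_ge_power: "ord_ge 1 f \<Longrightarrow> ord_ge n (f ^ n)"
  by (induction n) (use ord_ge_mult[of 1 f] in auto)

lemma ord_ge_prod_power:
  assumes "\<And>i. ord_ge 1 (G i)"
  shows "ord_ge (\<Sum>i\<in>A. a $ i) (\<Prod>i\<in>A. G i ^ (a $ i))"
proof (induction A rule: infinite_finite_induct)
  case (insert x F)
  then show ?case
    by (auto intro!: ord_ge_mult ord_ge_power assms)
qed auto

lemma ord_ge_multipower:
  assumes "\<And>i. ord_ge 1 (G i)"
  shows "ord_ge (mdeg a) (\<Prod>i\<in>UNIV. G i ^ (a $ i))"
  unfolding mdeg_def by (rule ord_ge_prod_power[OF assms])

lemma mmonom_0: "mmonom 0 = 1"
  by (rule mfps_eqI) (simp add: mcoeff_mmonom one_mfps.rep_eq)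

lemma mfps_var_eq_mmonom: "mfps_var i = mmonom (axis i 1)"
  by (rule mfps_eqI) (simp add: mcoeff_mmonom mfps_var.rep_eq)

lemma add_diff_le_vec: "a \<le> m \<Longrightarrow> a + (m - a) = (m :: nat ^ 'v::finite)"
  by (simp add: vec_eq_iff less_eq_vec_def)

lemma mcoeff_mmonom_mult:
  "mcoeff (mmonom a * f) m = (if a \<le> m then mcoeff f (m - a) else 0)"
proof -
  have "mcoeff (mmonom a * f) m
      = (\<Sum>(c, b) | c + b = m. if c = a then mcoeff f b else 0)"
    unfolding times_mfps.rep_eq by (intro sum.cong) (auto simp: mcoeff_mmonom)
  also have "\<dots> = (\<Sum>(c, b)\<in>(if a \<le> m then {(a, m - a)} else {}). if c = a then mcoeff f b else 0)"
  proof (rule sum.mono_neutral_right[OF finite_multi_index_splits])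
    show "(if a \<le> m then {(a, m - a)} else {}) \<subseteq> {(c, b). c + b = m}"
      by (auto simp: add_diff_le_vec)
    have "b = a + b - a" "a \<le> a + b" for b
      by (auto simp: vec_eq_iff less_eq_vec_def)
    then show "\<forall>p\<in>{(c, b). c + b = m} - (if a \<le> m then {(a, m - a)} else {}).
        (case p of (c, b) \<Rightarrow> if c = a then mcoeff f b else 0) = 0"
      by (auto split: if_splits)
  qed
  finally show ?thesis by simp
qed

lemma mmonom_add: "mmonom (a + b) = mmonom a * mmonom b"
proof (rule mfps_eqI)
  fix m
  have "m = a + b \<longleftrightarrow> a \<le> m \<and> m - a = b"
    by (auto simp: vec_eq_iff less_eq_vec_def) (metis le_add_diff_inverse)
  then show "mcoeff (mmonom (a + b)) m = mcoeff (mmonom a * mmonom b) m"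
    by (simp add: mcoeff_mmonom_mult mcoeff_mmonom)
qed

lemma mmonom_axis_power: "mmonom (axis i n) = mfps_var i ^ n"
proof (induction n)
  case 0
  have "axis i 0 = (0 :: nat ^ 'a)" by (simp add: vec_eq_iff axis_def)
  then show ?case by (simp only: mmonom_0 power_0)
next
  case (Suc n)
  have "axis i (Suc n) = axis i 1 + (axis i n :: nat ^ 'a)"
    by (auto simp: vec_eq_iff axis_def)
  then show ?case using Suc by (simp only: mmonom_add mfps_var_eq_mmonom power_Suc)
qed

lemma mmonom_sum: "finite A \<Longrightarrow> mmonom (sum f A) = (\<Prod>i\<in>A. mmonom (f i))"
  by (induction A rule: finite_induct) (auto simp: mmonom_0 mmonom_add)

lemma mmonom_eq_prod: "mmonom a = (\<Prod>i\<in>UNIV. mfps_var i ^ (a $ i))"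
proof -
  have "a = (\<Sum>i\<in>UNIV. axis i (a $ i))"
    by (simp add: vec_eq_iff axis_def)
  then have "mmonom a = mmonom (\<Sum>i\<in>UNIV. axis i (a $ i))" by simp
  then show ?thesis by (simp add: mmonom_sum mmonom_axis_power)
qed

lemma ord_ge_mmonom: "ord_ge (mdeg a) (mmonom a)"
  by (simp add: ord_ge_def mcoeff_mmonom)

lemma ord_ge_var: "ord_ge 1 (mfps_var i)"
  using ord_ge_mmonom[of "axis i 1"] by (simp add: mfps_var_eq_mmonom)

declare ord_ge_var [simp] ord_ge_var [simplified, simp]

lemma mfps_scale_mult_left: "mfps_scale c (f * g) = mfps_scale c f * g"
  by (rule mfps_eqI) (simp add: times_mfps.rep_eq sum_distrib_left case_prod_unfold mult.assoc)

lemma mfps_scale_mult_right: "mfps_scale c (f * g) = f * mfps_scale c g"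
  by (metis mfps_scale_mult_left mult.commute)

lemma mfps_scale_eq_mult: "mfps_scale c f = mfps_scale c 1 * f"
  by (metis mfps_scale_mult_left mult_1)

lemma mfps_scale_add_right: "mfps_scale c (f + g) = mfps_scale c f + mfps_scale c g"
  by (rule mfps_eqI) (simp add: algebra_simps)

lemma mfps_scale_0 [simp]: "mfps_scale 0 f = 0"
  and mfps_scale_1 [simp]: "mfps_scale 1 f = f"
  and mfps_scale_zero [simp]: "mfps_scale c 0 = 0"
  by (rule mfps_eqI, simp)+

lemma mfps_scale_of_nat: "of_nat n * f = mfps_scale (of_nat n) f"
proof -
  have "mfps_scale (of_nat n) f = of_nat n * f"
  proof (induction n)
    case (Suc n)
    have "mfps_scale (of_nat (Suc n)) f = f + mfps_scale (of_nat n) f"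
      by (rule mfps_eqI) (simp add: algebra_simps)
    with Suc show ?case by (simp add: algebra_simps)
  qed simp
  then show ?thesis by simp
qed

text \<open>A series agrees with a polynomial up to any given order.  This turns identities between
  operators that respect the filtration up to a shift \<open>s\<close> into identities between monomials.\<close>

lemma ord_ge_minus_truncation:
  "ord_ge k (f - (\<Sum>a | mdeg a < k. mfps_scale (mcoeff f a) (mmonom a)))"
  by (simp add: ord_ge_def mcoeff_mmonom if_distrib[of "(*) _"] cong: if_cong)

lemma vanishes_if_vanishes_on_monomials:
  fixes C :: "('v::finite, 'a::comm_ring_1) mfps \<Rightarrow> ('w::finite, 'a) mfps"
  assumes add: "\<And>f g. C (f + g) = C f + C g"
    and scale: "\<And>c f. C (mfps_scale c f) = mfps_scale c (C f)"
    and ord: "\<And>k f. ord_ge (k + s) f \<Longrightarrow> ord_ge k (C f)"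
    and monom: "\<And>a. C (mmonom a) = 0"
  shows "C f = 0"
proof (rule ord_ge_all_imp_0)
  fix k
  let ?t = "\<Sum>a | mdeg a < k + s. mfps_scale (mcoeff f a) (mmonom a)"
  have C0: "C 0 = 0" using add[of 0 0] by simp
  have "C (sum g A) = (\<Sum>a\<in>A. C (g a))" for g :: "nat ^ 'v \<Rightarrow> _" and A
    by (induction A rule: infinite_finite_induct) (auto simp: C0 add)
  then have "C ?t = 0"
    by (simp add: scale monom)
  then have "C f = C (f - ?t)"
    using add[of "f - ?t" ?t] by simp
  also have "ord_ge k \<dots>" by (intro ord ord_ge_minus_truncation)
  finally show "ord_ge k (C f)" .
qed

text \<open>Completeness with respect to the order filtration: the iterates of \<open>T\<close> on zero become stationary in
  every degree.  The family index \<open>'i\<close> allows simultaneous recursions.\<close>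

lemma contraction_fixed_point:
  fixes T :: "('i \<Rightarrow> ('v::finite, 'a::comm_ring_1) mfps) \<Rightarrow> 'i \<Rightarrow> ('v, 'a) mfps"
  assumes contr: "\<And>k g h. (\<And>i. ord_ge k (g i - h i)) \<Longrightarrow> (\<And>i. ord_ge (Suc k) (T g i - T h i))"
  shows "\<exists>g. T g = g"
proof -
  define a where "a = (\<lambda>n. (T ^^ n) (\<lambda>_. 0))"
  have step: "ord_ge n (a (Suc n) i - a n i)" for n i
  proof (induction n arbitrary: i)
    case (Suc n)
    then show ?case unfolding a_def by (auto intro: contr)
  qed simp
  have stable: "ord_ge n (a (n + j) i - a n i)" for n j i
  proof (induction j)
    case (Suc j)
    have "ord_ge n (a (Suc (n + j)) i - a (n + j) i)"
      using step ord_ge_mono le_add1 by blast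
    from ord_ge_add[OF this Suc] show ?case by simp
  qed simp
  define g where "g = (\<lambda>i. Abs_mfps (\<lambda>m. mcoeff (a (Suc (mdeg m)) i) m))"
  have g: "ord_ge n (g i - a n i)" for n i
    unfolding ord_ge_def
  proof (intro allI impI)
    fix m :: "nat ^ 'v"
    assume "mdeg m < n"
    then obtain j where "n = Suc (mdeg m) + j" by (metis less_iff_Suc_add add_Suc)
    with stable[of "Suc (mdeg m)" j i] show "mcoeff (g i - a n i) m = 0"
      by (auto simp: ord_ge_def g_def)
  qed
  have "T g i = g i" for i
  proof -
    have "ord_ge k (T g i - g i)" for k
    proof -
      have "ord_ge (Suc k) (T g i - a (Suc k) i)"
        unfolding a_def by simp (rule contr, use g[of k] in \<open>simp add: a_def\<close>)
      from ord_ge_diff[OF this g[of "Suc k" i]] show ?thesis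
        by (auto intro: ord_ge_mono)
    qed
    then show ?thesis using ord_ge_all_imp_0 by (metis eq_iff_diff_eq_0)
  qed
  then show ?thesis by (intro exI[of _ g]) auto
qed

lemma mfps_const_coeff_simps [simp]:
  "mfps_const_coeff 0 = 0" "mfps_const_coeff 1 = 1"
  "mfps_const_coeff (f + g) = mfps_const_coeff f + mfps_const_coeff g"
  "mfps_const_coeff (f - g) = mfps_const_coeff f - mfps_const_coeff g"
  "mfps_const_coeff (- f) = - mfps_const_coeff f"
  "mfps_const_coeff (mfps_scale c f) = c * mfps_const_coeff f"
  "mfps_const_coeff (mfps_var i) = 0"
  by (auto simp: mfps_const_coeff_def one_mfps.rep_eq mfps_var.rep_eq vec_eq_iff axis_def)

lemma mfps_const_coeff_sum [simp]:
  "mfps_const_coeff (sum f A) = (\<Sum>x\<in>A. mfps_const_coeff (f x))"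
  by (simp add: mfps_const_coeff_def)

lemma mfps_const_coeff_mult [simp]:
  fixes f g :: "('v::finite, 'a::comm_ring_1) mfps"
  shows "mfps_const_coeff (f * g) = mfps_const_coeff f * mfps_const_coeff g"
proof -
  have "{(a, b). a + b = (0 :: nat ^ 'v)} = {(0, 0)}"
    by (auto simp: vec_eq_iff)
  then show ?thesis by (simp add: mfps_const_coeff_def times_mfps.rep_eq)
qed

text \<open>The inverse of \<open>f = f\<^sub>0 + h\<close> solves the contraction \<open>g = f\<^sub>0\<^sup>-\<^sup>1 (1 - h g)\<close>.\<close>

lemma mfps_unit:
  fixes f :: "('v::finite, 'a::field) mfps"
  assumes "mfps_const_coeff f \<noteq> 0"
  shows "\<exists>g. f * g = 1"
proof -
  let ?c = "mfps_const_coeff f"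
  define h where "h = f - mfps_scale ?c 1"
  have h: "ord_ge 1 h" unfolding ord_ge_1_iff by (simp add: h_def)
  define T where "T = (\<lambda>(g :: unit \<Rightarrow> ('v, 'a) mfps) (_::unit). mfps_scale (inverse ?c) (1 - h * g ()))"
  have "\<exists>g. T g = g"
  proof (rule contraction_fixed_point)
    fix k and g g' :: "unit \<Rightarrow> ('v, 'a) mfps" and i
    assume "\<And>i. ord_ge k (g i - g' i)"
    then have "ord_ge (1 + k) (h * (g' () - g ()))"
      by (intro ord_ge_mult h) (metis minus_diff_eq ord_ge_uminus)
    moreover have "T g i - T g' i = mfps_scale (inverse ?c) (h * (g' () - g ()))"
      unfolding T_def by (rule mfps_eqI) (simp add: algebra_simps)
    ultimately show "ord_ge (Suc k) (T g i - T g' i)"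
      by (simp add: ord_ge_scale)
  qed
  then obtain g where "T g = g" ..
  then have g: "g () = mfps_scale (inverse ?c) (1 - h * g ())"
    unfolding T_def by metis
  then have "mfps_scale ?c (g ()) = 1 - h * g ()"
    using assms by (metis mfps_vs.scale_one mfps_vs.scale_scale right_inverse)
  then have "f * g () = 1"
    by (simp add: h_def algebra_simps flip: mfps_scale_mult_right)
  then show ?thesis by blast
qed

section \<open>Derivatives and substitution\<close>

lemma mfps_deriv_add [simp]: "mfps_deriv i (f + g) = mfps_deriv i f + mfps_deriv i g"
  and mfps_deriv_diff [simp]: "mfps_deriv i (f - g) = mfps_deriv i f - mfps_deriv i g"
  and mfps_deriv_scale [simp]: "mfps_deriv i (mfps_scale c f) = mfps_scale c (mfps_deriv i f)"
  and mfps_deriv_0 [simp]: "mfps_deriv i 0 = 0"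
  by (rule mfps_eqI, simp add: mfps_deriv.rep_eq algebra_simps)+

lemma mfps_deriv_sum [simp]: "mfps_deriv i (sum f A) = (\<Sum>x\<in>A. mfps_deriv i (f x))"
  by (induction A rule: infinite_finite_induct) auto

lemma mfps_deriv_commute: "mfps_deriv i (mfps_deriv j f) = mfps_deriv j (mfps_deriv i f)"
  by (rule mfps_eqI) (auto simp: mfps_deriv.rep_eq algebra_simps axis_def)

lemma ord_ge_deriv: "ord_ge (k + 1) f \<Longrightarrow> ord_ge k (mfps_deriv i f)"
  by (simp add: ord_ge_def mfps_deriv.rep_eq)

lemma mfps_deriv_mmonom:
  "mfps_deriv i (mmonom a) = mfps_scale (of_nat (a $ i)) (mmonom (a - axis i 1))"
proof (rule mfps_eqI)
  fix m :: "nat ^ 'a"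
  have "m + axis i 1 = a \<longleftrightarrow> a $ i \<noteq> 0 \<and> m = a - axis i 1"
    by (auto simp: vec_eq_iff axis_def split: if_splits) (metis add_diff_cancel_right' diff_zero One_nat_def)?
  then show "mcoeff (mfps_deriv i (mmonom a)) m
      = mcoeff (mfps_scale (of_nat (a $ i)) (mmonom (a - axis i 1))) m"
    by (auto simp: mfps_deriv.rep_eq mcoeff_mmonom)
qed

lemma mfps_deriv_1 [simp]: "mfps_deriv i 1 = 0"
  by (simp add: mfps_deriv_mmonom flip: mmonom_0)

lemma mfps_deriv_var: "mfps_deriv i (mfps_var j) = (if i = j then 1 else 0)"
proof (cases "i = j")
  case True
  have "axis j 1 - axis j 1 = (0 :: nat ^ 'a)" by (simp add: vec_eq_iff)
  with True show ?thesis by (simp add: mfps_deriv_mmonom mfps_var_eq_mmonom mmonom_0)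
qed (simp add: mfps_deriv_mmonom mfps_var_eq_mmonom axis_def)

lemma mfps_deriv_mult_mmonoms:
  "mfps_deriv i (mmonom a * mmonom b)
    = mfps_deriv i (mmonom a) * mmonom b + mmonom a * mfps_deriv i (mmonom b)"
proof -
  have 1: "mfps_deriv i (mmonom a) * mmonom b
      = mfps_scale (of_nat (a $ i)) (mmonom (a + b - axis i 1) :: ('a, 'b) mfps)" for a b
  proof (cases "a $ i = 0")
    case False
    then have "(a - axis i 1) + b = a + b - axis i 1"
      by (auto simp: vec_eq_iff axis_def)
    then show ?thesis
      by (simp only: mfps_deriv_mmonom flip: mfps_scale_mult_left mmonom_add)
  qed (auto intro: mfps_eqI simp: mfps_deriv_mmonom)
  have "mmonom a * mfps_deriv i (mmonom b)
      = mfps_scale (of_nat (b $ i)) (mmonom (a + b - axis i 1) :: ('a, 'b) mfps)"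
    using 1[of b a] by (simp add: ac_simps)
  moreover have "mfps_deriv i (mmonom a * mmonom b)
      = mfps_scale (of_nat (a $ i)) (mmonom (a + b - axis i 1))
        + mfps_scale (of_nat (b $ i)) (mmonom (a + b - axis i 1) :: ('a, 'b) mfps)"
    by (rule mfps_eqI) (simp add: mfps_deriv_mmonom algebra_simps flip: mmonom_add)
  ultimately show ?thesis by (simp add: 1)
qed

lemma mfps_deriv_mult:
  "mfps_deriv i (f * g) = mfps_deriv i f * g + f * mfps_deriv i g"
proof -
  define E where "E = (\<lambda>f g :: ('a, 'b) mfps.
    mfps_deriv i (f * g) - (mfps_deriv i f * g + f * mfps_deriv i g))"
  have ord: "ord_ge k (E f g)" if "ord_ge (k + 1) g" for k f g
    unfolding E_def using that
    by (intro ord_ge_diff ord_ge_add ord_ge_deriv ord_ge_mult_left)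
       (auto intro: ord_ge_mono simp: ord_ge_mult_left)
  have comm: "E f g = E g f" for f g by (simp add: E_def algebra_simps)
  have add: "E f (g + h) = E f g + E f h" for f g h by (simp add: E_def algebra_simps)
  have scale: "E f (mfps_scale c g) = mfps_scale c (E f g)" for c f g
    by (simp add: E_def mfps_vs.scale_right_diff_distrib mfps_scale_add_right
        mfps_vs.scale_right_distrib flip: mfps_scale_mult_right)
      (rule mfps_eqI, simp add: algebra_simps)
  have monom: "E (mmonom a) f = 0" for a f
    by (rule vanishes_if_vanishes_on_monomials[of _ 1, OF add scale ord])
       (auto simp: E_def mfps_deriv_mult_mmonoms)
  have monom': "E f (mmonom a) = 0" for a
    using monom comm by metis
  have "E f g = 0"
    by (rule vanishes_if_vanishes_on_monomials[of "E f" 1, OF add scale ord monom'])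
  then show ?thesis by (simp add: E_def)
qed

lemma mfps_scale_sum: "mfps_scale c (sum f A) = (\<Sum>x\<in>A. mfps_scale c (f x))"
  by (rule mfps_eqI) (simp add: sum_distrib_left)

lemma mcoeff_compose:
  "mcoeff (mfps_compose f G) m =
    (\<Sum>a | mdeg a \<le> mdeg m. mcoeff f a * mcoeff (\<Prod>i\<in>UNIV. G i ^ (a $ i)) m)"
  by (simp add: mfps_compose_def)

lemma mfps_compose_add: "mfps_compose (f + g) G = mfps_compose f G + mfps_compose g G"
  and mfps_compose_scale: "mfps_compose (mfps_scale c f) G = mfps_scale c (mfps_compose f G)"
  and mfps_compose_0 [simp]: "mfps_compose 0 G = 0"
  by (rule mfps_eqI, simp add: mcoeff_compose algebra_simps sum.distrib sum_distrib_left)+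

lemma mfps_compose_diff: "mfps_compose (f - g) G = mfps_compose f G - mfps_compose g G"
  by (rule mfps_eqI) (simp add: mcoeff_compose algebra_simps sum_subtractf)

lemma mfps_compose_sum: "mfps_compose (sum f A) G = (\<Sum>x\<in>A. mfps_compose (f x) G)"
  by (induction A rule: infinite_finite_induct) (auto simp: mfps_compose_add)

lemma ord_ge_compose_raw: "ord_ge k f \<Longrightarrow> ord_ge k (mfps_compose f G)"
  by (auto simp: ord_ge_def mcoeff_compose intro!: sum.neutral)

lemma mfps_compose_mmonom:
  assumes "\<And>i. ord_ge 1 (G i)"
  shows "mfps_compose (mmonom a) G = (\<Prod>i\<in>UNIV. G i ^ (a $ i))"
proof (rule mfps_eqI)
  fix m
  have "mcoeff (mfps_compose (mmonom a) G) m = (\<Sum>b | mdeg b \<le> mdeg m.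
      if b = a then mcoeff (\<Prod>i\<in>UNIV. G i ^ (a $ i)) m else 0)"
    unfolding mcoeff_compose by (intro sum.cong) (auto simp: mcoeff_mmonom)
  also have "\<dots> = (if mdeg a \<le> mdeg m then mcoeff (\<Prod>i\<in>UNIV. G i ^ (a $ i)) m else 0)"
    by simp
  also have "\<dots> = mcoeff (\<Prod>i\<in>UNIV. G i ^ (a $ i)) m"
    using ord_ge_multipower[OF assms, of a] by (simp add: ord_ge_def)
  finally show "mcoeff (mfps_compose (mmonom a) G) m = mcoeff (\<Prod>i\<in>UNIV. G i ^ (a $ i)) m" .
qed

lemma mfps_compose_1 [simp]:
  fixes G :: "'v::finite \<Rightarrow> ('w::finite, 'a::comm_ring_1) mfps"
  shows "mfps_compose 1 G = 1"
proof (rule mfps_eqI)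
  fix m :: "nat ^ 'w"
  have "mcoeff (mfps_compose 1 G) m = (\<Sum>b | mdeg b \<le> mdeg m.
      if b = 0 then mcoeff (\<Prod>i\<in>UNIV. G i ^ (b $ i)) m else 0)"
    unfolding mcoeff_compose by (intro sum.cong) (auto simp: one_mfps.rep_eq)
  then show "mcoeff (mfps_compose 1 G) m = mcoeff 1 m" by simp
qed

lemma mfps_compose_var:
  assumes "\<And>i. ord_ge 1 (G i)"
  shows "mfps_compose (mfps_var j) G = G j"
proof -
  have "(\<Prod>i\<in>UNIV. G i ^ (axis j 1 $ i)) = (\<Prod>i\<in>UNIV. if i = j then G i else 1)"
    by (intro prod.cong) (auto simp: axis_def)
  then show ?thesis
    by (simp add: mfps_var_eq_mmonom mfps_compose_mmonom[OF assms])
qed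

lemma mfps_compose_mult:
  fixes f g :: "('v::finite, 'a::comm_ring_1) mfps"
  assumes G: "\<And>i. ord_ge 1 (G i)"
  shows "mfps_compose (f * g) G = mfps_compose f G * mfps_compose g G"
proof -
  define E where "E = (\<lambda>f g :: ('v, 'a) mfps.
    mfps_compose (f * g) G - mfps_compose f G * mfps_compose g G)"
  have ord: "ord_ge k (E f g)" if "ord_ge (k + 0) g" for k f g
    unfolding E_def using that
    by (intro ord_ge_diff ord_ge_compose_raw ord_ge_mult_left) (auto simp: ord_ge_compose_raw)
  have comm: "E f g = E g f" for f g by (simp add: E_def algebra_simps)
  have add: "E f (g + h) = E f g + E f h" for f g h
    by (simp add: E_def algebra_simps mfps_compose_add)
  have scale: "E f (mfps_scale c g) = mfps_scale c (E f g)" for c f g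
    by (simp add: E_def mfps_compose_scale flip: mfps_scale_mult_right)
      (rule mfps_eqI, simp add: algebra_simps)
  have mm: "E (mmonom a) (mmonom b) = 0" for a b
    by (simp add: E_def mfps_compose_mmonom[OF G] power_add prod.distrib flip: mmonom_add)
  have monom: "E (mmonom a) f = 0" for a f
    by (rule vanishes_if_vanishes_on_monomials[of _ 0, OF add scale ord mm])
  have monom': "E f (mmonom a) = 0" for a
    using monom comm by metis
  have "E f g = 0"
    by (rule vanishes_if_vanishes_on_monomials[of "E f" 0, OF add scale ord monom'])
  then show ?thesis by (simp add: E_def)
qed

lemma mfps_compose_power:
  assumes "\<And>i. ord_ge 1 (G i)"
  shows "mfps_compose (f ^ n) G = mfps_compose f G ^ n"
  by (induction n) (auto simp: mfps_compose_mult[OF assms])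

lemma mfps_compose_prod:
  assumes "\<And>i. ord_ge 1 (G i)"
  shows "mfps_compose (prod f A) G = (\<Prod>x\<in>A. mfps_compose (f x) G)"
  by (induction A rule: infinite_finite_induct) (auto simp: mfps_compose_mult[OF assms])

lemma ord_ge_compose: "ord_ge 1 f \<Longrightarrow> ord_ge 1 (mfps_compose f G)"
  by (rule ord_ge_compose_raw)

lemma mfps_const_coeff_compose [simp]:
  "mfps_const_coeff (mfps_compose f G) = mfps_const_coeff f"
  by (simp add: mfps_const_coeff_def mcoeff_compose one_mfps.rep_eq)

lemma mfps_compose_assoc:
  fixes f :: "('u::finite, 'a::comm_ring_1) mfps"
  assumes G: "\<And>i. ord_ge 1 (G i)" and H: "\<And>i. ord_ge 1 (H i)"
  shows "mfps_compose (mfps_compose f G) H = mfps_compose f (\<lambda>i. mfps_compose (G i) H)"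
proof -
  have GH: "ord_ge 1 (mfps_compose (G i) H)" for i
    by (intro ord_ge_compose G)
  define C where "C = (\<lambda>f. mfps_compose (mfps_compose f G) H
    - mfps_compose f (\<lambda>i. mfps_compose (G i) H))"
  have "C f = 0"
  proof (rule vanishes_if_vanishes_on_monomials[where s = 0 and C = C])
    show "C (mmonom a) = 0" for a
      by (simp add: C_def mfps_compose_mmonom[OF G] mfps_compose_mmonom[OF GH]
          mfps_compose_prod[OF H] mfps_compose_power[OF H])
    show "ord_ge k (C f)" if "ord_ge (k + 0) f" for k f
      unfolding C_def using that by (intro ord_ge_diff ord_ge_compose_raw) auto
    show "C (mfps_scale c f) = mfps_scale c (C f)" for c f
      by (rule mfps_eqI) (simp add: C_def mfps_compose_scale algebra_simps)
  qed (simp add: C_def mfps_compose_add)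
  then show ?thesis by (simp add: C_def)
qed

lemma mfps_compose_var_right [simp]: "mfps_compose f mfps_var = f"
proof -
  define C where "C = (\<lambda>f :: ('a, 'b) mfps. mfps_compose f mfps_var - f)"
  have "C f = 0"
  proof (rule vanishes_if_vanishes_on_monomials[where s = 0 and C = C])
    show "C (mmonom a) = 0" for a
      by (subst C_def, subst mfps_compose_mmonom) (auto simp: mmonom_eq_prod)
    show "ord_ge k (C f)" if "ord_ge (k + 0) f" for k f
      unfolding C_def using that by (intro ord_ge_diff ord_ge_compose_raw) auto
    show "C (mfps_scale c f) = mfps_scale c (C f)" for c f
      by (rule mfps_eqI) (simp add: C_def mfps_compose_scale algebra_simps)
  qed (simp add: C_def mfps_compose_add)
  then show ?thesis by (simp add: C_def)
qed

text \<open>The chain rule.  Both sides obey the same product rule in \<open>f\<close>, so it is enough to compare them on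
  the variables.\<close>

lemma mfps_deriv_compose:
  fixes f :: "('v::finite, 'a::comm_ring_1) mfps"
  assumes G: "\<And>i. ord_ge 1 (G i)"
  shows "mfps_deriv k (mfps_compose f G)
    = (\<Sum>i\<in>UNIV. mfps_compose (mfps_deriv i f) G * mfps_deriv k (G i))"
proof -
  define R where "R = (\<lambda>f. \<Sum>i\<in>UNIV. mfps_compose (mfps_deriv i f) G * mfps_deriv k (G i))"
  have Rmult: "R (f * g) = R f * mfps_compose g G + mfps_compose f G * R g" for f g
    unfolding R_def sum_distrib_left sum_distrib_right sum.distrib[symmetric]
      mfps_deriv_mult mfps_compose_add mfps_compose_mult[OF G]
    by (intro sum.cong refl) (simp only: algebra_simps)
  have var: "R (mfps_var j) = mfps_deriv k (mfps_compose (mfps_var j) G)" for j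
  proof -
    have "R (mfps_var j) = (\<Sum>i\<in>UNIV. if i = j then mfps_deriv k (G i) else 0)"
      unfolding R_def by (intro sum.cong) (auto simp: mfps_deriv_var)
    then show ?thesis by (simp add: mfps_compose_var[OF G])
  qed
  have one: "R 1 = mfps_deriv k (mfps_compose 1 G)" by (simp add: R_def)
  have mult: "R (f * g) = mfps_deriv k (mfps_compose (f * g) G)"
    if "R f = mfps_deriv k (mfps_compose f G)" "R g = mfps_deriv k (mfps_compose g G)" for f g
    using that by (simp add: Rmult mfps_compose_mult[OF G] mfps_deriv_mult)
  have power: "R (mfps_var j ^ n) = mfps_deriv k (mfps_compose (mfps_var j ^ n) G)" for j n
  proof (induction n)
    case (Suc n)
    then show ?case using mult[OF var Suc] by simp
  qed (use one in simp)
  have prod: "R (\<Prod>j\<in>A. mfps_var j ^ b j)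
      = mfps_deriv k (mfps_compose (\<Prod>j\<in>A. mfps_var j ^ b j) G)" for A and b :: "'v \<Rightarrow> nat"
  proof (induction A rule: infinite_finite_induct)
    case (insert x F)
    then show ?case using mult[OF power insert.IH] by simp
  qed (use one in simp_all)
  define C where "C = (\<lambda>f. mfps_deriv k (mfps_compose f G) - R f)"
  have "C f = 0"
  proof (rule vanishes_if_vanishes_on_monomials[where s = 1 and C = C])
    show "C (mmonom a) = 0" for a
      by (simp add: C_def mmonom_eq_prod prod)
    show "ord_ge n (C f)" if "ord_ge (n + 1) f" for n f
      unfolding C_def R_def using that
      by (intro ord_ge_diff ord_ge_deriv ord_ge_compose_raw ord_ge_sum)
        (auto simp: mult.commute[of _ "mfps_deriv k _"]
          intro!: ord_ge_mult_left ord_ge_compose_raw ord_ge_deriv)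
    show "C (f + g) = C f + C g" for f g
      by (simp add: C_def R_def mfps_compose_add ring_distribs sum.distrib)
    have "R (mfps_scale c f) = mfps_scale c (R f)" for c f
      by (simp add: R_def mfps_compose_scale mfps_scale_sum flip: mfps_scale_mult_left)
    then show "C (mfps_scale c f) = mfps_scale c (C f)" for c f
      by (simp add: C_def mfps_compose_scale) (rule mfps_eqI, simp add: algebra_simps)
  qed
  then show ?thesis by (simp add: C_def R_def)
qed

section \<open>The formal inverse function theorem\<close>

definition jacobian_0 :: "('v::finite \<Rightarrow> ('w::finite, 'a::comm_ring_1) mfps) \<Rightarrow> 'a ^ 'w ^ 'v" where
  "jacobian_0 G = (\<chi> i j. mfps_const_coeff (mfps_deriv j (G i)))"

lemma mfps_const_coeff_deriv: "mfps_const_coeff (mfps_deriv j f) = mcoeff f (axis j 1)"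
  by (simp add: mfps_const_coeff_def mfps_deriv.rep_eq)

lemma ord_ge_2_iff:
  "ord_ge 2 f \<longleftrightarrow> mfps_const_coeff f = 0 \<and> (\<forall>j. mfps_const_coeff (mfps_deriv j f) = 0)"
proof
  assume "ord_ge 2 f"
  then show "mfps_const_coeff f = 0 \<and> (\<forall>j. mfps_const_coeff (mfps_deriv j f) = 0)"
    unfolding mfps_const_coeff_deriv by (auto simp: mfps_const_coeff_def ord_ge_def)
next
  assume a: "mfps_const_coeff f = 0 \<and> (\<forall>j. mfps_const_coeff (mfps_deriv j f) = 0)"
  show "ord_ge 2 f"
    unfolding ord_ge_def
  proof (intro allI impI)
    fix m :: "nat ^ 'a"
    assume "mdeg m < 2"
    then consider "mdeg m = 0" | "mdeg m = 1" by linarith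
    then show "mcoeff f m = 0"
    proof cases
      case 2
      then show ?thesis using a mdeg_eq_1 unfolding mfps_const_coeff_deriv by blast
    qed (use a in \<open>auto simp: mfps_const_coeff_def\<close>)
  qed
qed

text \<open>Substituting series tangent to the identity acts as the identity on the associated graded
  ring.\<close>

lemma ord_ge_tangent_identity:
  fixes G :: "'v::finite \<Rightarrow> ('v, 'a::comm_ring_1) mfps"
  assumes G: "\<And>i. ord_ge 2 (G i - mfps_var i)" and f: "ord_ge k f"
  shows "ord_ge (Suc k) (mfps_compose f G - f)"
proof -
  have G1: "ord_ge 1 (G i)" for i
    using ord_ge_add[OF ord_ge_mono[OF G[of i], of 1] ord_ge_var[of i]] by simp
  have step: "ord_ge (Suc (p + q)) (f * g - f' * g')"
    if "ord_ge (Suc p) (f - f')" "ord_ge (Suc q) (g - g')" "ord_ge p f'" "ord_ge q g"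
    for p q and f f' g g' :: "('v, 'a) mfps"
  proof -
    have "f * g - f' * g' = (f - f') * g + f' * (g - g')" by (simp add: algebra_simps)
    moreover have "ord_ge (Suc p + q) ((f - f') * g)" by (intro ord_ge_mult that)
    moreover have "ord_ge (p + Suc q) (f' * (g - g'))" by (intro ord_ge_mult that)
    ultimately show ?thesis by (simp add: ord_ge_add)
  qed
  have power: "ord_ge (Suc n) (G i ^ n - mfps_var i ^ n)" for i n
  proof (induction n)
    case (Suc n)
    have "ord_ge (Suc (1 + n)) (G i * G i ^ n - mfps_var i * mfps_var i ^ n)"
      by (rule step) (use G[of i] Suc in \<open>auto simp: numeral_2_eq_2 intro!: ord_ge_power G1
            simp del: One_nat_def\<close>)
    then show ?case by simp
  qed simp
  have prod: "ord_ge (Suc (\<Sum>i\<in>A. a $ i)) ((\<Prod>i\<in>A. G i ^ (a $ i)) - (\<Prod>i\<in>A. mfps_var i ^ (a $ i)))"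
    for a :: "nat ^ 'v" and A
  proof (induction A rule: infinite_finite_induct)
    case (insert x F)
    have "ord_ge (Suc ((a $ x) + (\<Sum>i\<in>F. a $ i)))
       (G x ^ (a $ x) * (\<Prod>i\<in>F. G i ^ (a $ i))
          - mfps_var x ^ (a $ x) * (\<Prod>i\<in>F. mfps_var i ^ (a $ i)))"
      by (rule step[OF power insert.IH]) (auto intro!: ord_ge_power ord_ge_prod_power G1
            simp del: One_nat_def)
    then show ?case using insert by simp
  qed auto
  have monom: "ord_ge (Suc (mdeg a)) (mfps_compose (mmonom a) G - mmonom a)" for a
    unfolding mfps_compose_mmonom[OF G1] unfolding mmonom_eq_prod mdeg_def by (rule prod)
  let ?t = "\<Sum>a | mdeg a < Suc k. mfps_scale (mcoeff f a) (mmonom a)"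
  have rest: "ord_ge (Suc k) (f - ?t)" by (rule ord_ge_minus_truncation)
  have poly: "ord_ge (Suc k) (mfps_compose ?t G - ?t)"
  proof -
    have "mfps_compose ?t G - ?t
        = (\<Sum>a | mdeg a < Suc k. mfps_scale (mcoeff f a) (mfps_compose (mmonom a) G - mmonom a))"
      by (rule mfps_eqI) (simp add: mfps_compose_sum mfps_compose_scale sum_subtractf algebra_simps)
    moreover have "ord_ge (Suc k) (mfps_scale (mcoeff f a) (mfps_compose (mmonom a) G - mmonom a))"
      if "mdeg a < Suc k" for a
    proof (cases "mdeg a = k")
      case True
      then show ?thesis using monom[of a] by (simp add: ord_ge_scale)
    next
      case False
      then have "mcoeff f a = 0" using f that by (simp add: ord_ge_def)
      then show ?thesis by simp
    qed
    ultimately show ?thesis by (auto intro: ord_ge_sum)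
  qed
  have split: "mfps_compose f G - f
      = (mfps_compose (f - ?t) G - (f - ?t)) + (mfps_compose ?t G - ?t)"
    by (simp add: mfps_compose_diff)
  show ?thesis
    unfolding split
    by (rule ord_ge_add[OF ord_ge_diff[OF ord_ge_compose_raw[OF rest] rest] poly])
qed

text \<open>Substitution of \<open>G\<close> tangent to the identity is surjective, as \<open>h \<mapsto> k - (h \<circ> G - h)\<close> is a
  contraction; a preimage of the variables is a left inverse of \<open>G\<close>, and a left inverse of that is
  \<open>G\<close> again.\<close>

lemma left_inverse_tangent_identity:
  fixes G :: "'v::finite \<Rightarrow> ('v, 'a::comm_ring_1) mfps"
  assumes G: "\<And>i. ord_ge 2 (G i - mfps_var i)"
  shows "\<exists>F. (\<forall>i. ord_ge 2 (F i - mfps_var i)) \<and> (\<forall>i. mfps_compose (F i) G = mfps_var i)"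
proof -
  define T where "T = (\<lambda>F (i::'v). mfps_var i - (mfps_compose (F i) G - F i))"
  have "\<exists>F. T F = F"
  proof (rule contraction_fixed_point)
    fix k and F F' :: "'v \<Rightarrow> ('v, 'a) mfps" and i
    assume "\<And>i. ord_ge k (F i - F' i)"
    then have "ord_ge k (F' i - F i)" by (metis minus_diff_eq ord_ge_uminus)
    from ord_ge_tangent_identity[OF G this] show "ord_ge (Suc k) (T F i - T F' i)"
      by (simp add: T_def mfps_compose_diff algebra_simps)
  qed
  then obtain F where "T F = F" ..
  then have "F i = mfps_var i - (mfps_compose (F i) G - F i)" for i
    unfolding T_def by metis
  then have F: "mfps_compose (F i) G = mfps_var i" for i
    by (metis add_diff_cancel_left' diff_add_cancel diff_diff_eq2 right_minus_eq)
  have "mfps_const_coeff (F i) = 0" for i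
    using arg_cong[OF F[of i], of mfps_const_coeff] by simp
  then have "ord_ge 1 (F i)" for i unfolding ord_ge_1_iff .
  from ord_ge_tangent_identity[OF G this] have "ord_ge 2 (F i - mfps_var i)" for i
    unfolding F by (metis Suc_1 minus_diff_eq ord_ge_uminus)
  with F show ?thesis by (intro exI[of _ F] conjI allI)
qed

lemma inverse_tangent_identity:
  fixes G :: "'v::finite \<Rightarrow> ('v, 'a::comm_ring_1) mfps"
  assumes G: "\<And>i. ord_ge 2 (G i - mfps_var i)"
  shows "\<exists>F. (\<forall>i. ord_ge 1 (F i)) \<and> (\<forall>i. mfps_compose (F i) G = mfps_var i)
    \<and> (\<forall>i. mfps_compose (G i) F = mfps_var i)"
proof -
  have ord1: "ord_ge 1 (K i)" if "\<And>i. ord_ge 2 (K i - mfps_var i)"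
    for K :: "'v \<Rightarrow> ('v, 'a) mfps" and i
    using ord_ge_add[OF ord_ge_mono[OF that[of i], of 1] ord_ge_var[of i]] by simp
  obtain F where F: "\<And>i. ord_ge 2 (F i - mfps_var i)" "\<And>i. mfps_compose (F i) G = mfps_var i"
    using left_inverse_tangent_identity[OF G] by (elim exE conjE) auto
  obtain E where E: "\<And>i. ord_ge 2 (E i - mfps_var i)" "\<And>i. mfps_compose (E i) F = mfps_var i"
    using left_inverse_tangent_identity[OF F(1)] by (elim exE conjE) auto
  have "mfps_compose (mfps_compose (E i) F) G = E i" for i
    by (subst mfps_compose_assoc) (auto simp: F(2) intro: ord1 G F(1) simp del: One_nat_def)
  then have "E i = G i" for i
    by (simp add: E(2) mfps_compose_var ord1 G del: One_nat_def)
  with E(2) have "mfps_compose (G i) F = mfps_var i" for i by simp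
  with F ord1[OF F(1)] show ?thesis by (intro exI[of _ F] conjI allI)
qed

text \<open>The general case is reduced to the tangent-to-the-identity case by a linear change of
  coordinates in the target.\<close>

theorem formal_inverse_function:
  fixes G :: "'v::finite \<Rightarrow> ('v, 'a::field) mfps"
  assumes G: "\<And>i. ord_ge 1 (G i)" and inv: "invertible (jacobian_0 G)"
  obtains F where "\<And>i. ord_ge 1 (F i)" "\<And>i. mfps_compose (F i) G = mfps_var i"
    "\<And>i. mfps_compose (G i) F = mfps_var i"
proof -
  define A where "A = jacobian_0 G"
  obtain B where B: "B ** A = mat 1" "A ** B = mat 1"
    using inv unfolding invertible_def A_def by (elim exE conjE)
  define lin where "lin = (\<lambda>(M :: 'a ^ 'v ^ 'v) i. \<Sum>j\<in>UNIV. mfps_scale (M $ i $ j) (mfps_var j :: ('v, 'a) mfps))"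
  have lin1: "ord_ge 1 (lin M i)" for M i
    unfolding lin_def by (intro ord_ge_sum ord_ge_scale ord_ge_var)
  have lin_compose: "mfps_compose (lin M i) K = (\<Sum>j\<in>UNIV. mfps_scale (M $ i $ j) (K j))"
    if "\<And>i. ord_ge 1 (K i)" for M i and K :: "'v \<Rightarrow> ('v, 'a) mfps"
    by (simp add: lin_def mfps_compose_sum mfps_compose_scale mfps_compose_var[OF that])
  have scale_sum: "(\<Sum>j\<in>UNIV. mfps_scale (M $ i $ j) (\<Sum>k\<in>UNIV. mfps_scale (L $ j $ k) (K k)))
      = (\<Sum>k\<in>UNIV. mfps_scale ((M ** L) $ i $ k) (K k))"
    for M L :: "'a ^ 'v ^ 'v" and K :: "'v \<Rightarrow> ('v, 'a) mfps" and i
  proof (rule mfps_eqI)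
    fix m
    show "mcoeff (\<Sum>j\<in>UNIV. mfps_scale (M $ i $ j) (\<Sum>k\<in>UNIV. mfps_scale (L $ j $ k) (K k))) m
      = mcoeff (\<Sum>k\<in>UNIV. mfps_scale ((M ** L) $ i $ k) (K k)) m"
      by (simp add: matrix_matrix_mult_def sum_distrib_left sum_distrib_right mult.assoc)
        (rule sum.swap)
  qed
  have scale_1: "(\<Sum>k\<in>UNIV. mfps_scale ((mat 1 :: 'a ^ 'v ^ 'v) $ i $ k) (K k)) = K i"
    for K :: "'v \<Rightarrow> ('v, 'a) mfps" and i
  proof -
    have "(\<Sum>k\<in>UNIV. mfps_scale ((mat 1 :: 'a ^ 'v ^ 'v) $ i $ k) (K k))
        = (\<Sum>k\<in>UNIV. if k = i then K k else 0)"
      by (intro sum.cong) (auto simp: mat_def)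
    then show ?thesis by simp
  qed
  define G' where "G' = (\<lambda>i. mfps_compose (lin B i) G)"
  have G'1: "ord_ge 1 (G' i)" for i
    unfolding G'_def by (intro ord_ge_compose lin1)
  have "jacobian_0 G' = B ** A"
    by (simp add: jacobian_0_def G'_def lin_compose[OF G] A_def matrix_matrix_mult_def vec_eq_iff)
  then have jG': "mfps_const_coeff (mfps_deriv j (G' i)) = (if i = j then 1 else 0)" for i j
    unfolding B by (simp add: jacobian_0_def vec_eq_iff mat_def)
  have "ord_ge 2 (G' i - mfps_var i)" for i
    unfolding ord_ge_2_iff using G'1[of i] unfolding ord_ge_1_iff
    by (simp add: jG' mfps_deriv_var)
  from inverse_tangent_identity[OF this] obtain F' where F': "\<And>i. ord_ge 1 (F' i)"
    "\<And>i. mfps_compose (F' i) G' = mfps_var i" "\<And>i. mfps_compose (G' i) F' = mfps_var i"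
    by (elim exE conjE) auto
  have GF': "mfps_compose (G i) F' = lin A i" for i
  proof -
    have "G i = mfps_compose (lin A i) G'"
      unfolding lin_compose[OF G'1] unfolding G'_def lin_compose[OF G] scale_sum B scale_1 ..
    also have "mfps_compose \<dots> F' = mfps_compose (lin A i) (\<lambda>j. mfps_compose (G' j) F')"
      by (rule mfps_compose_assoc[OF G'1 F'(1)])
    also have "\<dots> = lin A i" by (simp add: F'(3))
    finally show ?thesis .
  qed
  show thesis
  proof
    show F1: "ord_ge 1 (mfps_compose (F' i) (lin B))" for i
      by (intro ord_ge_compose F')
    show "mfps_compose (mfps_compose (F' i) (lin B)) G = mfps_var i" for i
      by (subst mfps_compose_assoc[OF lin1 G]) (use F'(2) in \<open>simp add: G'_def\<close>)
    show "mfps_compose (G i) (\<lambda>i. mfps_compose (F' i) (lin B)) = mfps_var i" for i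
    proof -
      have "mfps_compose (G i) (\<lambda>i. mfps_compose (F' i) (lin B)) = mfps_compose (lin A i) (lin B)"
        by (simp add: mfps_compose_assoc[OF F'(1) lin1, symmetric] GF')
      also have "\<dots> = mfps_var i"
        unfolding lin_compose[OF lin1] unfolding lin_def scale_sum B scale_1 ..
      finally show ?thesis .
    qed
  qed
qed

section \<open>Leading monomials\<close>

text \<open>Distinct primes attached to the variables turn multi-indices into natural numbers: the weight
  is injective and multiplicative, so comparing weights is a total order on monomials that is
  compatible with multiplication and in which every element has finitely many predecessors.\<close>

definition var_prime :: "'v::finite \<Rightarrow> nat" where
  "var_prime = (SOME p. inj p \<and> range p \<subseteq> {p. prime p})"

definition weight :: "nat ^ 'v::finite \<Rightarrow> nat" where
  "weight m = (\<Prod>i\<in>UNIV. var_prime i ^ (m $ i))"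

lemma var_prime: "inj (var_prime :: 'v::finite \<Rightarrow> nat)" "prime (var_prime (i :: 'v))"
proof -
  obtain B where B: "B \<subseteq> {p :: nat. prime p}" "finite B" "card B = CARD('v)"
    using infinite_arbitrarily_large[OF primes_infinite] by blast
  then obtain p :: "'v \<Rightarrow> nat" where "bij_betw p UNIV B"
    using finite_same_card_bij[of "UNIV :: 'v set" B] by auto
  then have "\<exists>p :: 'v \<Rightarrow> nat. inj p \<and> range p \<subseteq> {p. prime p}"
    using B by (intro exI[of _ p]) (auto simp: bij_betw_def)
  from someI_ex[OF this] show "inj (var_prime :: 'v \<Rightarrow> nat)" "prime (var_prime (i :: 'v))"
    unfolding var_prime_def by blast+
qed

lemma weight_add: "weight (a + b) = weight a * weight b"
  by (simp add: weight_def power_add prod.distrib)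

lemma weight_pos: "weight m > 0"
  unfolding weight_def by (intro prod_pos) (use var_prime(2) prime_gt_0_nat in auto)

lemma inj_weight: "inj (weight :: nat ^ 'v::finite \<Rightarrow> nat)"
proof (rule injI)
  fix a b :: "nat ^ 'v"
  assume eq: "weight a = weight b"
  have w: "weight m = (\<Prod>p\<in>range (var_prime :: 'v \<Rightarrow> nat). p ^ (m $ inv var_prime p))"
    for m :: "nat ^ 'v"
    unfolding weight_def by (subst prod.reindex[OF var_prime(1)])
      (simp add: inv_f_f[OF var_prime(1)])
  have "multiplicity (var_prime i) (weight m) = m $ i" for m :: "nat ^ 'v" and i
    unfolding w by (subst multiplicity_prod_prime_powers) (auto simp: var_prime)
  then show "a = b" using eq by (metis vec_eq_iff)
qed

definition lead_mon :: "('v::finite, 'a::comm_ring_1) mfps \<Rightarrow> nat ^ 'v" where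
  "lead_mon f = arg_min weight (\<lambda>m. mcoeff f m \<noteq> 0)"

lemma
  assumes "f \<noteq> 0"
  shows lead_coeff_nonzero: "mcoeff f (lead_mon f) \<noteq> 0"
    and lead_mon_le: "mcoeff f m \<noteq> 0 \<Longrightarrow> weight (lead_mon f) \<le> weight m"
proof -
  have "\<exists>m. mcoeff f m \<noteq> 0"
    using assms by (metis mfps_eqI zero_mfps.rep_eq)
  then show "mcoeff f (lead_mon f) \<noteq> 0"
    unfolding lead_mon_def using arg_min_natI[where P = "\<lambda>m. mcoeff f m \<noteq> 0"] by blast
  show "mcoeff f m \<noteq> 0 \<Longrightarrow> weight (lead_mon f) \<le> weight m"
    unfolding lead_mon_def by (rule arg_min_nat_le)
qed

lemma lead_monI:
  assumes "mcoeff f m \<noteq> 0" "\<And>k. mcoeff f k \<noteq> 0 \<Longrightarrow> weight m \<le> weight k"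
  shows "lead_mon f = m"
proof -
  have "f \<noteq> 0" using assms(1) by auto
  then have "weight (lead_mon f) = weight m"
    by (intro antisym lead_mon_le assms lead_coeff_nonzero)
  then show ?thesis using inj_weight by (rule injD[rotated])
qed

text \<open>The product of the leading terms cannot cancel: any other pair of monomials with the same product
  has a factor that precedes the corresponding leading monomial.\<close>

lemma mcoeff_mult_lead:
  fixes f g :: "('v::finite, 'a::idom) mfps"
  assumes "f \<noteq> 0" "g \<noteq> 0"
  shows "mcoeff (f * g) (lead_mon f + lead_mon g) = mcoeff f (lead_mon f) * mcoeff g (lead_mon g)"
    and "mcoeff (f * g) m \<noteq> 0 \<Longrightarrow> weight (lead_mon f + lead_mon g) \<le> weight m"
proof -
  let ?a = "lead_mon f" and ?b = "lead_mon g"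
  have zero: "mcoeff f c * mcoeff g d = 0"
    if "c + d = ?a + ?b" "(c, d) \<noteq> (?a, ?b)" for c d
  proof (rule ccontr)
    assume "mcoeff f c * mcoeff g d \<noteq> 0"
    then have le: "weight ?a \<le> weight c" "weight ?b \<le> weight d"
      using lead_mon_le assms by auto
    have eq: "weight c * weight d = weight ?a * weight ?b"
      using that(1) by (metis weight_add)
    have "weight c \<le> weight ?a"
    proof (rule ccontr)
      assume "\<not> weight c \<le> weight ?a"
      then have "weight ?a * weight ?b < weight c * weight ?b" using weight_pos by simp
      also have "\<dots> \<le> weight c * weight d" using le by simp
      finally show False using eq by simp
    qed
    with le have "weight c = weight ?a" by simp
    then have "c = ?a" using inj_weight by (rule injD[rotated])
    with that show False by simp
  qed
  have "mcoeff (f * g) (?a + ?b)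
      = (\<Sum>p | fst p + snd p = ?a + ?b. mcoeff f (fst p) * mcoeff g (snd p))"
    by (simp add: times_mfps.rep_eq case_prod_unfold)
  also have "\<dots> = (\<Sum>p\<in>{(?a, ?b)}. mcoeff f (fst p) * mcoeff g (snd p))"
  proof (rule sum.mono_neutral_right)
    show "finite {p. fst p + snd p = ?a + ?b}"
      using finite_multi_index_splits[of "?a + ?b"] by (simp add: case_prod_unfold)
    show "\<forall>p\<in>{p. fst p + snd p = ?a + ?b} - {(?a, ?b)}. mcoeff f (fst p) * mcoeff g (snd p) = 0"
      by (intro ballI zero) auto
  qed auto
  finally show "mcoeff (f * g) (?a + ?b) = mcoeff f ?a * mcoeff g ?b" by simp
  assume "mcoeff (f * g) m \<noteq> 0"
  then obtain c d where "c + d = m" "mcoeff f c * mcoeff g d \<noteq> 0"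
    unfolding times_mfps.rep_eq by (auto elim!: sum.not_neutral_contains_not_neutral)
  then show "weight (?a + ?b) \<le> weight m"
    using lead_mon_le assms by (auto simp: weight_add intro!: mult_mono)
qed

instance mfps :: (finite, idom) idom
proof
  fix f g :: "('a, 'b) mfps"
  assume "f \<noteq> 0" "g \<noteq> 0"
  then have "mcoeff (f * g) (lead_mon f + lead_mon g) \<noteq> 0"
    by (simp add: mcoeff_mult_lead lead_coeff_nonzero)
  then show "f * g \<noteq> 0" by auto
qed

lemma lead_mon_mult:
  fixes f g :: "('v::finite, 'a::idom) mfps"
  assumes "f \<noteq> 0" "g \<noteq> 0"
  shows "lead_mon (f * g) = lead_mon f + lead_mon g"
  using assms by (intro lead_monI mcoeff_mult_lead(2))
    (auto simp: mcoeff_mult_lead lead_coeff_nonzero)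

lemma lead_mon_1: "lead_mon (1 :: ('v::finite, 'a::idom) mfps) = 0"
  by (rule lead_monI) (auto simp: one_mfps.rep_eq split: if_splits)

lemma lead_mon_power_nth:
  fixes f :: "('v::finite, 'a::idom) mfps"
  assumes "f \<noteq> 0"
  shows "lead_mon (f ^ n) $ i = n * lead_mon f $ i"
  using assms by (induction n) (auto simp: lead_mon_1 lead_mon_mult)

section \<open>Power series rings are Noetherian\<close>

text \<open>Dickson's lemma, in the form that the relation of componentwise comparison has no infinite
  antichain: one passes to a subsequence that is monotone in one coordinate after the other.\<close>

lemma nat_seq_mono_subseq:
  fixes s :: "nat \<Rightarrow> nat"
  obtains r :: "nat \<Rightarrow> nat" where "strict_mono r" "mono (\<lambda>n. s (r n))"
proof -
  obtain r where r: "strict_mono r" "monoseq (\<lambda>n. s (r n))"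
    using seq_monosub by blast
  show thesis
  proof (cases "incseq (\<lambda>n. s (r n))")
    case False
    then have dec: "decseq (\<lambda>n. s (r n))" using r(2) monoseq_iff by blast
    let ?P = "\<lambda>v. \<exists>n. s (r n) = v"
    obtain n0 where n0: "s (r n0) = (LEAST v. ?P v)" using LeastI_ex[of ?P] by blast
    have const: "s (r (n + n0)) = s (r n0)" for n
    proof (rule antisym)
      show "s (r (n + n0)) \<le> s (r n0)" using dec by (auto simp: decseq_def)
      show "s (r n0) \<le> s (r (n + n0))" unfolding n0 by (rule Least_le) blast
    qed
    show thesis
      by (rule that[of "\<lambda>n. r (n + n0)"]) (use r(1) const in \<open>auto simp: strict_mono_def mono_def\<close>)
  qed (use r that in auto)
qed

lemma multi_index_seq_mono_subseq:
  fixes s :: "nat \<Rightarrow> nat ^ 'v::finite"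
  obtains r :: "nat \<Rightarrow> nat" where "strict_mono r" "mono (\<lambda>n. s (r n))"
proof -
  have "\<exists>r :: nat \<Rightarrow> nat. strict_mono r \<and> (\<forall>i\<in>A. mono (\<lambda>n. s (r n) $ i))" if "finite A" for A
    using that
  proof (induction A rule: finite_induct)
    case empty
    show ?case by (intro exI[of _ id]) (auto simp: strict_mono_def)
  next
    case (insert x F)
    then obtain r :: "nat \<Rightarrow> nat" where r: "strict_mono r" "\<And>i. i \<in> F \<Longrightarrow> mono (\<lambda>n. s (r n) $ i)" by blast
    obtain q :: "nat \<Rightarrow> nat" where q: "strict_mono q" "mono (\<lambda>n. s (r (q n)) $ x)"
      by (rule nat_seq_mono_subseq)
    have "mono (\<lambda>n. s (r (q n)) $ i)" if "i \<in> F" for i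
      using r(2)[OF that] q(1) by (auto simp: mono_def strict_mono_less_eq)
    with r(1) q show ?case
      by (intro exI[of _ "r \<circ> q"]) (auto simp: strict_mono_o comp_def strict_mono_def)
  qed
  from this[of UNIV] obtain r :: "nat \<Rightarrow> nat" where
    "strict_mono r" "\<And>i. mono (\<lambda>n. s (r n) $ i)" by auto
  then show thesis by (intro that[of r]) (auto simp: mono_def less_eq_vec_def)
qed

lemma Dickson:
  fixes A :: "(nat ^ 'v::finite) set"
  obtains F where "finite F" "F \<subseteq> A" "\<And>a. a \<in> A \<Longrightarrow> \<exists>b\<in>F. b \<le> a"
proof
  define F where "F = {a \<in> A. \<forall>b\<in>A. b \<le> a \<longrightarrow> b = a}"
  show "F \<subseteq> A" by (auto simp: F_def)
  show "finite F"
  proof (rule ccontr)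
    assume "infinite F"
    then obtain s :: "nat \<Rightarrow> nat ^ 'v" where s: "inj s" "range s \<subseteq> F"
      using infinite_countable_subset by blast
    obtain r :: "nat \<Rightarrow> nat" where r: "strict_mono r" "mono (\<lambda>n. s (r n))"
      by (rule multi_index_seq_mono_subseq)
    have "s (r 0) \<le> s (r 1)" using r(2) by (simp add: mono_def)
    moreover have "s (r 0) \<in> F" "s (r 1) \<in> F" using s by auto
    ultimately have "s (r 0) = s (r 1)" by (auto simp: F_def)
    then have "r 0 = r 1" using s(1) by (auto dest: injD)
    with r(1) show False by (simp add: strict_mono_eq)
  qed
  show "\<exists>b\<in>F. b \<le> a" if "a \<in> A" for a
    using that
  proof (induction "mdeg a" arbitrary: a rule: less_induct)
    case less
    show ?case
    proof (cases "a \<in> F")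
      case False
      then obtain b where b: "b \<in> A" "b \<le> a" "b \<noteq> a" using less.prems by (auto simp: F_def)
      have "a = b + (a - b)" using b add_diff_le_vec by metis
      moreover from this have "a - b \<noteq> 0" using b(3) by auto
      ultimately have "mdeg b < mdeg a"
        by (metis less_add_same_cancel1 mdeg_add mdeg_eq_0_iff neq0_conv)
      from less.hyps[OF this b(1)] show ?thesis using b(2) by (meson order_trans)
    qed auto
  qed
qed

text \<open>Division with respect to finitely many divisors.  Each step cancels a leading monomial, so
  the leading weights of the successive remainders increase strictly, and the monomials occurring
  in the quotients of one divisor are pairwise distinct; hence the process converges.\<close>

lemma division_in_ideal:
  fixes G :: "('v::finite, 'a::field) mfps set"
  assumes fin: "finite G" and "0 \<notin> G"
    and red: "\<And>h'. h' \<noteq> 0 \<Longrightarrow> h - h' \<in> mfps_ideal.span G \<Longrightarrow> \<exists>g\<in>G. lead_mon g \<le> lead_mon h'"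
  shows "h \<in> mfps_ideal.span G"
proof (rule ccontr)
  assume h: "h \<notin> mfps_ideal.span G"
  define R where "R = {h'. h - h' \<in> mfps_ideal.span G}"
  have R0: "h' \<noteq> 0" if "h' \<in> R" for h'
    using that h by (auto simp: R_def)
  define dv where "dv = (\<lambda>h' :: ('v, 'a) mfps. SOME g. g \<in> G \<and> lead_mon g \<le> lead_mon h')"
  have dv: "dv h' \<in> G" "lead_mon (dv h') \<le> lead_mon h'" if "h' \<in> R" for h'
  proof -
    have "\<exists>g. g \<in> G \<and> lead_mon g \<le> lead_mon h'"
      using red[OF R0[OF that]] that by (auto simp: R_def)
    from someI_ex[OF this] show "dv h' \<in> G" "lead_mon (dv h') \<le> lead_mon h'"
      unfolding dv_def by blast+
  qed
  \<comment> \<open>One step: \<open>nx h'\<close> cancels the leading term of \<open>h'\<close> by a multiple of the divisor \<open>dv h'\<close>.\<close>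
  define mu where "mu = (\<lambda>h'. lead_mon h' - lead_mon (dv h'))"
  define kap where "kap = (\<lambda>h'. mcoeff h' (lead_mon h') / mcoeff (dv h') (lead_mon (dv h')))"
  define tm where "tm = (\<lambda>h' :: ('v, 'a) mfps. mfps_scale (kap h') (mmonom (mu h')))"
  define nx where "nx = (\<lambda>h'. h' - tm h' * dv h')"
  have nxR: "nx h' \<in> R" if "h' \<in> R" for h'
  proof -
    have "h - nx h' = (h - h') + tm h' * dv h'" by (simp add: nx_def)
    also have "\<dots> \<in> mfps_ideal.span G"
      by (rule mfps_ideal.span_add[OF _ mfps_ideal.span_scale[OF mfps_ideal.span_base[OF dv(1)[OF that]]]])
        (use that in \<open>simp add: R_def\<close>)
    finally show ?thesis by (simp add: R_def)
  qed
  have mu: "mu h' + lead_mon (dv h') = lead_mon h'" if "h' \<in> R" for h'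
    unfolding mu_def using add_diff_le_vec[OF dv(2)[OF that]] by (metis add.commute)
  have dv0: "dv h' \<noteq> 0" if "h' \<in> R" for h'
    using dv(1)[OF that] assms by auto
  have tmc: "mcoeff (tm h' * dv h') m = (if mu h' \<le> m then kap h' * mcoeff (dv h') (m - mu h') else 0)"
    for h' m
    by (simp add: tm_def mcoeff_mmonom_mult flip: mfps_scale_mult_left)
  have nx_lt: "weight (lead_mon h') < weight (lead_mon (nx h'))" if h': "h' \<in> R" for h'
  proof -
    let ?m = "lead_mon (nx h')"
    have nz: "mcoeff (nx h') ?m \<noteq> 0"
      using lead_coeff_nonzero R0[OF nxR[OF h']] by blast
    have "weight (lead_mon h') \<le> weight ?m"
    proof (cases "mcoeff h' ?m = 0")
      case True
      then have "mu h' \<le> ?m" "mcoeff (dv h') (?m - mu h') \<noteq> 0"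
        using nz by (auto simp: nx_def tmc split: if_splits)
      then have "weight (lead_mon (dv h')) \<le> weight (?m - mu h')" "?m = mu h' + (?m - mu h')"
        using lead_mon_le dv0[OF h'] add_diff_le_vec by metis+
      then show ?thesis
        by (metis mu[OF h'] weight_add mult_le_mono2)
    qed (use lead_mon_le R0[OF h'] in blast)
    moreover have "?m \<noteq> lead_mon h'"
    proof
      assume eq: "?m = lead_mon h'"
      have "mu h' \<le> lead_mon h'" "lead_mon h' - mu h' = lead_mon (dv h')"
        using mu[OF h'] by (auto simp: vec_eq_iff less_eq_vec_def)
          (metis le_add1, metis add_diff_cancel_left')
      then have "mcoeff (nx h') ?m = 0"
        unfolding eq using lead_coeff_nonzero[OF dv0[OF h']]
        by (simp add: nx_def tmc kap_def)
      with nz show False ..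
    qed
    ultimately show ?thesis
      using inj_weight by (metis injD order_le_less)
  qed
  define hs where "hs = (\<lambda>n. (nx ^^ n) h)"
  have hsR: "hs n \<in> R" for n
    by (induction n) (auto simp: hs_def nxR, simp add: R_def mfps_ideal.span_zero)
  have hs_Suc: "hs (Suc n) = hs n - tm (hs n) * dv (hs n)" for n
    by (simp add: hs_def nx_def)
  have mono: "strict_mono (\<lambda>n. weight (lead_mon (hs n)))"
    unfolding strict_mono_Suc_iff using nx_lt[OF hsR] by (simp add: hs_def)
  \<comment> \<open>The steps contributing to the coefficient at \<open>m\<close> of the quotient of \<open>g\<close>: at most one.\<close>
  define K where "K = (\<lambda>g m. {n. dv (hs n) = g \<and> mu (hs n) = m})"
  have K1: "a = b" if "a \<in> K g m" "b \<in> K g m" for a b g m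
  proof -
    have "lead_mon (hs a) = lead_mon (hs b)"
      using mu[OF hsR[of a]] mu[OF hsR[of b]] that by (auto simp: K_def)
    then show ?thesis using strict_mono_eq[OF mono] by metis
  qed
  have finK: "finite (K g m)" for g m
    by (metis K1 finite.simps infinite_imp_nonempty insert_iff subsetI subset_singletonD
        is_singletonI' is_singleton_def)
  define q where "q = (\<lambda>g. Abs_mfps (\<lambda>m. \<Sum>n\<in>K g m. kap (hs n)))"
  define qn where "qn = (\<lambda>N g. \<Sum>n | n < N \<and> dv (hs n) = g. tm (hs n))"
  have hN: "h - hs N = (\<Sum>g\<in>G. qn N g * g)" for N
  proof (induction N)
    case 0
    then show ?case by (simp add: hs_def qn_def)
  next
    case (Suc N)
    have "qn (Suc N) g = qn N g + (if g = dv (hs N) then tm (hs N) else 0)" for g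
    proof -
      have "{n. n < Suc N \<and> dv (hs n) = g}
          = (if g = dv (hs N) then insert N {n. n < N \<and> dv (hs n) = g} else {n. n < N \<and> dv (hs n) = g})"
        by (auto simp: less_Suc_eq)
      then show ?thesis by (simp add: qn_def)
    qed
    then have "(\<Sum>g\<in>G. qn (Suc N) g * g)
        = (\<Sum>g\<in>G. qn N g * g) + (\<Sum>g\<in>G. if g = dv (hs N) then tm (hs N) * g else 0)"
      by (simp add: ring_distribs sum.distrib if_distrib[of "\<lambda>x. x * _"] cong: if_cong)
    also have "\<dots> = (h - hs N) + tm (hs N) * dv (hs N)"
      using Suc fin dv(1)[OF hsR] by simp
    finally show ?case by (simp add: hs_Suc)
  qed
  \<comment> \<open>What the steps from the \<open>N\<close>-th on contribute lies beyond the leading weight of the \<open>N\<close>-th remainder.\<close>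
  have tail: "weight (lead_mon (hs N)) \<le> weight m" if "g \<in> G" "mcoeff ((q g - qn N g) * g) m \<noteq> 0" for g N m
  proof -
    from that(2) obtain c d where cd: "c + d = m" "mcoeff (q g - qn N g) c \<noteq> 0" "mcoeff g d \<noteq> 0"
      unfolding times_mfps.rep_eq by (auto elim!: sum.not_neutral_contains_not_neutral)
    have "mcoeff (qn N g) c = (\<Sum>n | n < N \<and> dv (hs n) = g. if mu (hs n) = c then kap (hs n) else 0)"
      unfolding qn_def mcoeff_sum by (intro sum.cong) (auto simp: tm_def mcoeff_mmonom)
    also have "\<dots> = (\<Sum>n\<in>{n. n < N \<and> dv (hs n) = g} \<inter> K g c. kap (hs n))"
      by (intro sum.mono_neutral_cong_right) (auto simp: K_def)
    also have "{n. n < N \<and> dv (hs n) = g} \<inter> K g c = K g c - {N..}"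
      by (auto simp: K_def)
    finally have "K g c \<inter> {N..} \<noteq> {}"
      using cd(2) by (auto simp: q_def Diff_triv)
    then obtain n where n: "N \<le> n" "dv (hs n) = g" "mu (hs n) = c" by (auto simp: K_def)
    have "weight (lead_mon (hs N)) \<le> weight (lead_mon (hs n))"
      using strict_mono_mono[OF mono] n(1) by (rule monoD)
    also have "\<dots> = weight c * weight (lead_mon g)"
      using mu[OF hsR[of n]] n by (metis weight_add)
    also have "\<dots> \<le> weight m"
      using lead_mon_le[OF dv0[OF hsR[of n]]] n cd by (auto simp: weight_add)
    finally show ?thesis .
  qed
  have "h - (\<Sum>g\<in>G. q g * g) = 0"
  proof (rule mfps_eqI)
    fix m :: "nat ^ 'v"
    define N where "N = Suc (weight m)"
    have N: "weight m < weight (lead_mon (hs N))"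
      using strict_mono_imp_increasing[OF mono, of N] by (simp add: N_def)
    have "h - (\<Sum>g\<in>G. q g * g) = hs N - (\<Sum>g\<in>G. (q g - qn N g) * g)"
      using hN[of N] by (simp add: algebra_simps sum_subtractf)
    moreover have "mcoeff (hs N) m = 0"
      using lead_mon_le[OF R0[OF hsR[of N]]] N by (metis linorder_not_less)
    moreover have "mcoeff ((q g - qn N g) * g) m = 0" if "g \<in> G" for g
      using tail[OF that] N by (metis linorder_not_less)
    ultimately show "mcoeff (h - (\<Sum>g\<in>G. q g * g)) m = mcoeff 0 m" by simp
  qed
  then have "h = (\<Sum>g\<in>G. q g * g)" by simp
  also have "\<dots> \<in> mfps_ideal.span G"
    by (intro mfps_ideal.span_sum mfps_ideal.span_scale mfps_ideal.span_base)
  finally show False using h by contradiction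
qed

theorem mfps_noetherian:
  fixes I :: "('v::finite, 'a::field) mfps set"
  assumes I: "mfps_ideal.subspace I"
  obtains G where "finite G" "G \<subseteq> I" "I = mfps_ideal.span G"
proof -
  obtain F where F: "finite F" "F \<subseteq> lead_mon ` (I - {0})"
    "\<And>a. a \<in> lead_mon ` (I - {0}) \<Longrightarrow> \<exists>b\<in>F. b \<le> a"
    using Dickson[of "lead_mon ` (I - {0})"] by blast
  obtain G where G: "G \<subseteq> I - {0}" "finite G" "F = lead_mon ` G"
    using finite_subset_image[OF F(1,2)] by blast
  have "h \<in> mfps_ideal.span G" if "h \<in> I" for h
  proof (rule division_in_ideal[OF G(2)])
    fix h' assume h': "h' \<noteq> 0" "h - h' \<in> mfps_ideal.span G"
    have "h - h' \<in> I" using h'(2) mfps_ideal.span_minimal[OF _ I, of G] G(1) by blast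
    then have "h' \<in> I" using mfps_ideal.subspace_diff[OF I \<open>h \<in> I\<close>] by fastforce
    then show "\<exists>g\<in>G. lead_mon g \<le> lead_mon h'" using F(3)[of "lead_mon h'"] G h' by auto
  qed (use G in auto)
  moreover have "mfps_ideal.span G \<subseteq> I"
    using mfps_ideal.span_minimal[OF _ I, of G] G(1) by blast
  ultimately show thesis using that[of G] G by auto
qed

text \<open>Complete integral closedness: if the powers of the fraction \<open>u / v\<close> have a common denominator
  \<open>c\<close>, then comparing leading monomials of \<open>c u\<^sup>n = v\<^sup>n q\<^sub>n\<close> for large \<open>n\<close> shows that \<open>v\<close> has a
  leading monomial dividing that of \<open>u\<close>.  The hypothesis is inherited by \<open>u - r v\<close>, so the
  division of \<open>u\<close> by \<open>v\<close> never stops.\<close>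

theorem mfps_completely_integrally_closed:
  fixes u v c :: "('v::finite, 'a::field) mfps"
  assumes c: "c \<noteq> 0" and v: "v \<noteq> 0" and dvd: "\<And>n. v ^ n dvd c * u ^ n"
  shows "v dvd u"
proof -
  have "u \<in> mfps_ideal.span {v}"
  proof (rule division_in_ideal)
    fix u' assume u': "u' \<noteq> 0" "u - u' \<in> mfps_ideal.span {v}"
    then obtain r where "u - u' = r * v" by (auto simp: mfps_ideal.span_singleton)
    then have u'eq: "u' = u + (- r) * v" by (simp add: algebra_simps)
    have dvd': "v ^ n dvd c * u' ^ n" for n
    proof -
      have "c * u' ^ n = (\<Sum>k\<le>n. of_nat (n choose k) * (- r) ^ (n - k) * (c * u ^ k * v ^ (n - k)))"
        unfolding u'eq binomial_ring sum_distrib_left power_mult_distrib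
        by (intro sum.cong refl) (simp only: mult_ac)
      moreover have "v ^ n dvd c * u ^ k * v ^ (n - k)" if "k \<le> n" for k
        using mult_dvd_mono[OF dvd[of k] dvd_refl[of "v ^ (n - k)"]] that
        by (simp flip: power_add)
      ultimately show ?thesis
        by (simp only:) (rule dvd_sum, simp only: atMost_iff dvd_mult)
    qed
    have "lead_mon v $ i \<le> lead_mon u' $ i" for i
    proof (rule ccontr)
      assume lt: "\<not> lead_mon v $ i \<le> lead_mon u' $ i"
      \<comment> \<open>A power larger than the exponent that the common denominator can compensate.\<close>
      define n where "n = lead_mon c $ i + 1"
      obtain q where q: "c * u' ^ n = v ^ n * q" using dvd'[of n] by (auto simp: dvd_def)
      have "q \<noteq> 0" using q c u'(1) by auto
      then have "lead_mon (c * u' ^ n) = lead_mon (v ^ n) + lead_mon q"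
        unfolding q using v by (simp add: lead_mon_mult)
      then have "lead_mon (c * u' ^ n) $ i \<ge> n * lead_mon v $ i"
        using v by (simp add: lead_mon_power_nth)
      then have "lead_mon c $ i + n * lead_mon u' $ i \<ge> n * lead_mon v $ i"
        using c u'(1) by (simp add: lead_mon_mult lead_mon_power_nth)
      moreover have "n * lead_mon v $ i \<ge> n * (lead_mon u' $ i + 1)"
        using lt by (intro mult_le_mono2) simp
      ultimately show False by (simp add: n_def)
    qed
    then show "\<exists>g\<in>{v}. lead_mon g \<le> lead_mon u'" by (simp add: less_eq_vec_def)
  qed (use v in auto)
  then show ?thesis by (auto simp: mfps_ideal.span_singleton)
qed

section \<open>Prime ideals invariant under derivations\<close>

text \<open>The union of a chain of ideals is finitely generated, hence equal to a member of the chain.\<close>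

lemma ideal_family_has_maximal:
  fixes F :: "('v::finite, 'a::field) mfps set set"
  assumes "F \<noteq> {}" and ideals: "\<And>I. I \<in> F \<Longrightarrow> mfps_ideal.subspace I"
  shows "\<exists>M\<in>F. \<forall>I\<in>F. M \<subseteq> I \<longrightarrow> I = M"
proof (rule subset_Zorn_nonempty[OF assms(1)])
    fix C assume C: "C \<noteq> {}" "subset.chain F C"
    have lin: "A \<subseteq> B \<or> B \<subseteq> A" if "A \<in> C" "B \<in> C" for A B
      using C(2) that unfolding subset.chain_def by blast
    have CF: "C \<subseteq> F" using C(2) unfolding subset.chain_def by blast
    have "mfps_ideal.subspace (\<Union>C)"
    proof (rule mfps_ideal.subspaceI)
      show "0 \<in> \<Union>C" using C(1) CF ideals mfps_ideal.subspace_0 by blast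
      show "x + y \<in> \<Union>C" if xy: "x \<in> \<Union>C" "y \<in> \<Union>C" for x y
      proof -
        obtain A B where AB: "A \<in> C" "x \<in> A" "B \<in> C" "y \<in> B" using xy by blast
        then obtain M where "M \<in> C" "x \<in> M" "y \<in> M" using lin[OF AB(1,3)] by blast
        then show ?thesis using CF ideals mfps_ideal.subspace_add by blast
      qed
      show "c * x \<in> \<Union>C" if "x \<in> \<Union>C" for c x
        using that CF ideals mfps_ideal.subspace_scale by blast
    qed
    then obtain G where G: "finite G" "G \<subseteq> \<Union>C" "\<Union>C = mfps_ideal.span G"
      by (rule mfps_noetherian)
    have "\<exists>M\<in>C. G' \<subseteq> M" if "finite G'" "G' \<subseteq> \<Union>C" for G'
      using that
    proof (induction G' rule: finite_induct)
      case (insert x G')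
      then obtain M N where MN: "M \<in> C" "G' \<subseteq> M" "N \<in> C" "x \<in> N" by auto
      then show ?case using lin[OF MN(1,3)] by blast
    qed (use C(1) in auto)
    from this[OF G(1,2)] obtain M where M: "M \<in> C" "G \<subseteq> M" ..
    have "\<Union>C = M"
      using G(3) mfps_ideal.span_minimal[OF M(2)] M(1) CF ideals by blast
    then show "\<Union>C \<in> F" using M(1) CF by auto
qed

definition derivation :: "('a::comm_ring_1 \<Rightarrow> 'a) \<Rightarrow> bool" where
  "derivation D \<longleftrightarrow> (\<forall>x y. D (x + y) = D x + D y) \<and> (\<forall>x y. D (x * y) = D x * y + x * D y)"

lemma derivation_power:
  assumes "derivation D"
  shows "x * D (x ^ n) = of_nat n * x ^ n * D x"
proof -
  have D1: "D 1 = 0"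
    using assms unfolding derivation_def by (metis add_cancel_right_right mult_1 mult_1_right)
  show ?thesis
  proof (induction n)
    case (Suc n)
    have "x * D (x ^ Suc n) = x * (D x * x ^ n) + x * (x * D (x ^ n))"
      using assms by (simp add: derivation_def algebra_simps)
    then show ?case unfolding Suc by (simp add: algebra_simps)
  qed (simp add: D1)
qed

text \<open>
  Let \<open>R\<close> be the image of the retraction \<open>\<theta>\<close>; like the ring of power series it is Noetherian and
  completely integrally closed.  A nonzero nonunit \<open>\<delta>\<close> of \<open>R\<close> lies in a prime ideal \<open>P\<close> of height
  one, and \<open>P\<close> is invariant under every derivation \<open>D\<close> having a nonzero constant \<open>f\<close> in \<open>P\<close>:
  where \<open>P\<close> is generated by one element \<open>\<pi>\<close>, write \<open>f = \<pi>\<^sup>e h\<close> with \<open>h\<close> not in \<open>P\<close>; then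
  \<open>0 = D f = e \<pi>\<^sup>e\<^sup>-\<^sup>1 h D \<pi> + \<pi>\<^sup>e D h\<close> gives \<open>D \<pi> \<in> P\<close> because the characteristic is zero.

  The proof avoids unique factorization.  \<open>P\<close> is a maximal proper ideal of the form
  \<open>(\<delta>) : r\<close>.  If multiplication by \<open>r / \<delta>\<close> mapped \<open>P\<close> into itself, all powers of \<open>r / \<delta>\<close> would have
  the common denominator \<open>\<delta>\<close>, so \<open>r / \<delta>\<close> would belong to \<open>R\<close>.  Hence \<open>\<pi> r = \<delta> w\<close> for some
  \<open>\<pi> \<in> P\<close> and \<open>w \<notin> P\<close>, and \<open>\<pi>\<close> generates \<open>P\<close> after inverting \<open>w\<close>.  The exponent \<open>e\<close> exists by
  the same principle: otherwise \<open>f\<close> would be a common denominator of the powers of \<open>w / \<pi>\<close>.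

  Membership in the ideals is expressed through \<open>\<theta>\<close>, so that congruences modulo the kernel of
  \<open>\<theta>\<close> become equations in an integral domain.
\<close>

theorem height_one_prime_invariant:
  fixes \<theta> :: "('v::finite, 'a::field_char_0) mfps \<Rightarrow> ('v, 'a) mfps"
  assumes hom: "\<And>x y. \<theta> (x + y) = \<theta> x + \<theta> y" "\<And>x y. \<theta> (x * y) = \<theta> x * \<theta> y" "\<theta> 1 = 1"
    and idem: "\<And>x. \<theta> (\<theta> x) = \<theta> x"
    and \<delta>: "\<theta> \<delta> \<noteq> 0" "\<And>q. \<theta> (\<delta> * q) \<noteq> 1"
  obtains P where "mfps_ideal.subspace P" "{x. \<theta> x = 0} \<subseteq> P" "\<delta> \<in> P" "1 \<notin> P"
    "\<And>D f. derivation D \<Longrightarrow> \<forall>x. \<theta> x = 0 \<longrightarrow> \<theta> (D x) = 0 \<Longrightarrow> f \<in> P \<Longrightarrow> \<theta> f \<noteq> 0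
      \<Longrightarrow> \<theta> (D f) = 0 \<Longrightarrow> D ` P \<subseteq> P"
proof -
  have hom0: "\<theta> 0 = 0" using hom(1)[of 0 0] by (metis add_0 add_left_imp_eq add.right_neutral)
  have hom_minus: "\<theta> (x - y) = \<theta> x - \<theta> y" for x y
    using hom(1)[of "x - y" y] by simp
  have hom_power: "\<theta> (x ^ n) = \<theta> x ^ n" for x n
    by (induction n) (auto simp: hom)
  have hom_of_nat: "\<theta> (of_nat n) = of_nat n" for n
    by (induction n) (auto simp: hom hom0)
  have cic: "\<exists>q. \<theta> u = \<theta> v * \<theta> q"
    if "\<theta> c \<noteq> 0" "\<theta> v \<noteq> 0" "\<And>n. \<exists>q. \<theta> c * \<theta> u ^ n = \<theta> v ^ n * \<theta> q" for c u v
  proof -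
    have "\<theta> v dvd \<theta> u"
      by (rule mfps_completely_integrally_closed[OF that(1,2)]) (metis that(3) dvd_def)
    then obtain q where "\<theta> u = \<theta> v * q" by (auto simp: dvd_def)
    then have "\<theta> u = \<theta> v * \<theta> q" by (metis hom(2) idem)
    then show ?thesis ..
  qed
  define C where "C = (\<lambda>r. {y. \<exists>q. \<theta> y * \<theta> r = \<theta> \<delta> * \<theta> q})"
  have C_ideal: "mfps_ideal.subspace (C r)" for r
  proof (rule mfps_ideal.subspaceI)
    show "0 \<in> C r" unfolding C_def by (auto simp: hom0 intro: exI[of _ 0])
    show "x + y \<in> C r" if "x \<in> C r" "y \<in> C r" for x y
    proof -
      from that obtain p q where "\<theta> x * \<theta> r = \<theta> \<delta> * \<theta> p" "\<theta> y * \<theta> r = \<theta> \<delta> * \<theta> q"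
        by (auto simp: C_def)
      then have "\<theta> (x + y) * \<theta> r = \<theta> \<delta> * \<theta> (p + q)" by (simp add: hom algebra_simps)
      then show ?thesis unfolding C_def by blast
    qed
    show "c * x \<in> C r" if "x \<in> C r" for c x
    proof -
      from that obtain p where p: "\<theta> x * \<theta> r = \<theta> \<delta> * \<theta> p" by (auto simp: C_def)
      have "\<theta> (c * x) * \<theta> r = \<theta> c * (\<theta> x * \<theta> r)" by (simp only: hom mult.assoc)
      also have "\<dots> = \<theta> \<delta> * \<theta> (c * p)" by (simp only: p hom mult.left_commute)
      finally show ?thesis unfolding C_def by blast
    qed
  qed
  have "1 \<notin> C 1"
    using \<delta>(2) by (auto simp: C_def hom)
  then have ne: "{C r | r. 1 \<notin> C r} \<noteq> {}" by blast
  have "\<exists>P\<in>{C r | r. 1 \<notin> C r}. \<forall>I\<in>{C r | r. 1 \<notin> C r}. P \<subseteq> I \<longrightarrow> I = P"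
    by (rule ideal_family_has_maximal[OF ne]) (use C_ideal in auto)
  then obtain P where "P \<in> {C r | r. 1 \<notin> C r}"
    and Pmax': "\<forall>I\<in>{C r | r. 1 \<notin> C r}. P \<subseteq> I \<longrightarrow> I = P" ..
  then obtain r where P: "P = C r" "1 \<notin> P" by auto
  have Pmax: "C s = P" if "1 \<notin> C s" "P \<subseteq> C s" for s
    using that Pmax' by auto
  note PI = C_ideal[of r, folded P(1)]
  have kerP: "x \<in> P" if "\<theta> x = 0" for x
    unfolding P C_def using that hom0 by (auto intro: exI[of _ 0])
  have Pcong: "x \<in> P \<longleftrightarrow> y \<in> P" if "\<theta> x = \<theta> y" for x y
    by (simp add: P C_def that)
  have \<delta>P: "\<delta> \<in> P" unfolding P C_def by blast
  have prime: "x \<in> P \<or> y \<in> P" if xy: "x * y \<in> P" for x y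
  proof (rule ccontr)
    assume n: "\<not> (x \<in> P \<or> y \<in> P)"
    have eq: "z \<in> C (y * r) \<longleftrightarrow> z * y \<in> P" for z
      by (simp only: C_def P(1) hom mem_Collect_eq mult.assoc)
    have "C (y * r) = P"
    proof (rule Pmax)
      show "1 \<notin> C (y * r)" using n by (simp add: eq)
      show "P \<subseteq> C (y * r)"
      proof
        fix z assume "z \<in> P"
        from mfps_ideal.subspace_scale[OF PI this, of y] show "z \<in> C (y * r)"
          unfolding eq by (simp only: mult.commute)
      qed
    qed
    with eq[of x] xy n show False by simp
  qed
  have primen: "x * y \<notin> P" if "x \<notin> P" "y \<notin> P" for x y using prime that by blast
  \<comment> \<open>The local generator \<open>\<pi>\<close> of \<open>P\<close>, with \<open>w / \<pi> = r / \<delta>\<close>.\<close>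
  obtain \<pi> w where \<pi>: "\<pi> \<in> P" "w \<notin> P" "\<theta> \<pi> * \<theta> r = \<theta> \<delta> * \<theta> w"
  proof (rule ccontr)
    assume "\<not> thesis"
    with that have closed: "q \<in> P" if "p \<in> P" "\<theta> p * \<theta> r = \<theta> \<delta> * \<theta> q" for p q
      using \<open>p \<in> P\<close> \<open>\<theta> p * \<theta> r = \<theta> \<delta> * \<theta> q\<close> by blast
    have "\<exists>p\<in>P. \<theta> \<delta> * \<theta> r ^ n = \<theta> \<delta> ^ n * \<theta> p" for n
    proof (induction n)
      case 0
      show ?case using \<delta>P by auto
    next
      case (Suc n)
      then obtain p where p: "p \<in> P" "\<theta> \<delta> * \<theta> r ^ n = \<theta> \<delta> ^ n * \<theta> p" by blast
      then obtain q where q: "\<theta> p * \<theta> r = \<theta> \<delta> * \<theta> q" by (auto simp: P C_def)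
      have "\<theta> \<delta> * \<theta> r ^ Suc n = (\<theta> \<delta> * \<theta> r ^ n) * \<theta> r"
        by (simp only: power_Suc mult_ac)
      also have "\<dots> = \<theta> \<delta> ^ n * (\<theta> p * \<theta> r)"
        by (simp only: p(2) mult.assoc)
      finally have "\<theta> \<delta> * \<theta> r ^ Suc n = \<theta> \<delta> ^ Suc n * \<theta> q"
        unfolding q by (simp only: power_Suc mult_ac)
      then show ?case using closed[OF p(1) q] by blast
    qed
    then have "\<exists>q. \<theta> r = \<theta> \<delta> * \<theta> q" by (intro cic[of \<delta>] \<delta>) blast
    then have "1 \<in> P" by (simp add: P C_def hom)
    with P(2) show False ..
  qed
  have wP: "\<exists>y'. \<theta> w * \<theta> y = \<theta> \<pi> * \<theta> y'" if "y \<in> P" for y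
  proof -
    from that obtain q where q: "\<theta> y * \<theta> r = \<theta> \<delta> * \<theta> q" by (auto simp: P C_def)
    have "\<theta> \<delta> * (\<theta> w * \<theta> y) = (\<theta> \<pi> * \<theta> r) * \<theta> y"
      unfolding \<pi>(3) by (simp only: mult.assoc)
    also have "\<dots> = \<theta> \<pi> * (\<theta> y * \<theta> r)" by (simp only: mult_ac)
    also have "\<dots> = \<theta> \<delta> * (\<theta> \<pi> * \<theta> q)" unfolding q by (simp only: mult_ac)
    finally show ?thesis using \<delta>(1) by (metis mult_cancel_left)
  qed
  have \<pi>0: "\<theta> \<pi> \<noteq> 0"
    using \<pi>(2,3) \<delta>(1) kerP[of w] by auto
  have "D ` P \<subseteq> P"
    if D: "derivation D" and Dker: "\<forall>x. \<theta> x = 0 \<longrightarrow> \<theta> (D x) = 0"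
      and f: "f \<in> P" "\<theta> f \<noteq> 0" "\<theta> (D f) = 0" for D f
  proof -
    have Dadd: "D (x + y) = D x + D y" and Dmult: "D (x * y) = D x * y + x * D y" for x y
      using D by (auto simp: derivation_def)
    have Dminus: "D (x - y) = D x - D y" for x y
      using Dadd[of "x - y" y] by simp
    have Dcong: "\<theta> (D x) = \<theta> (D y)" if "\<theta> x = \<theta> y" for x y
      using Dker[rule_format, of "x - y"] that by (simp add: hom_minus Dminus)
    have "\<exists>e h. h \<notin> P \<and> \<theta> f * \<theta> w ^ e = \<theta> \<pi> ^ e * \<theta> h"
    proof (rule ccontr)
      assume no: "\<not> ?thesis"
      have "\<exists>h. \<theta> f * \<theta> w ^ e = \<theta> \<pi> ^ e * \<theta> h" for e
      proof (induction e)
        case (Suc e)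
        then obtain h where h: "\<theta> f * \<theta> w ^ e = \<theta> \<pi> ^ e * \<theta> h" by blast
        with no have "h \<in> P" by blast
        from wP[OF this] obtain h' where h': "\<theta> w * \<theta> h = \<theta> \<pi> * \<theta> h'" by blast
        have "\<theta> f * \<theta> w ^ Suc e = \<theta> w * (\<theta> f * \<theta> w ^ e)"
          by (simp only: power_Suc mult_ac)
        also have "\<dots> = \<theta> \<pi> ^ e * (\<theta> w * \<theta> h)" unfolding h by (simp only: mult_ac)
        also have "\<dots> = \<theta> \<pi> ^ Suc e * \<theta> h'" unfolding h' by (simp only: power_Suc mult_ac)
        finally show ?case by blast
      qed (auto intro: exI[of _ f])
      then have "\<exists>q. \<theta> w = \<theta> \<pi> * \<theta> q" by (intro cic[OF f(2) \<pi>0]) blast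
      then obtain q where "\<theta> w = \<theta> (q * \<pi>)" by (auto simp: hom mult.commute)
      then have "w \<in> P" using Pcong mfps_ideal.subspace_scale[OF PI \<pi>(1)] by blast
      with \<pi>(2) show False ..
    qed
    then obtain e h where h: "h \<notin> P" "\<theta> f * \<theta> w ^ e = \<theta> \<pi> ^ e * \<theta> h" by blast
    have "e \<noteq> 0" using h f(1) Pcong[of f h] by (cases e) auto
    have "\<theta> (f * w ^ e) = \<theta> (\<pi> ^ e * h)" using h(2) by (simp add: hom hom_power)
    from Dcong[OF this] have "\<theta> f * \<theta> (D (w ^ e)) = \<theta> (D (\<pi> ^ e)) * \<theta> h + \<theta> \<pi> ^ e * \<theta> (D h)"
      by (simp add: Dmult hom hom_power f(3))
    then have "(\<theta> \<pi> * \<theta> w) * (\<theta> f * \<theta> (D (w ^ e)))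
        = (\<theta> \<pi> * \<theta> w) * (\<theta> (D (\<pi> ^ e)) * \<theta> h + \<theta> \<pi> ^ e * \<theta> (D h))"
      by (simp only:)
    then have "\<theta> f * \<theta> \<pi> * \<theta> (w * D (w ^ e))
        = \<theta> w * \<theta> (\<pi> * D (\<pi> ^ e)) * \<theta> h + \<theta> w * \<theta> \<pi> * \<theta> \<pi> ^ e * \<theta> (D h)"
      by (simp only: hom(2) distrib_left mult_ac)
    then have "\<theta> f * \<theta> \<pi> * (of_nat e * \<theta> w ^ e * \<theta> (D w))
        = \<theta> w * (of_nat e * \<theta> \<pi> ^ e * \<theta> (D \<pi>)) * \<theta> h + \<theta> w * \<theta> \<pi> * \<theta> \<pi> ^ e * \<theta> (D h)"
      by (simp only: derivation_power[OF D] hom(2) hom_power hom_of_nat)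
    then have "(\<theta> f * \<theta> w ^ e) * (\<theta> \<pi> * of_nat e * \<theta> (D w))
        = \<theta> \<pi> ^ e * (\<theta> w * of_nat e * \<theta> (D \<pi>) * \<theta> h + \<theta> w * \<theta> \<pi> * \<theta> (D h))"
      by (simp only: distrib_left mult_ac)
    then have "\<theta> \<pi> ^ e * (\<theta> h * (\<theta> \<pi> * of_nat e * \<theta> (D w)))
        = \<theta> \<pi> ^ e * (\<theta> w * of_nat e * \<theta> (D \<pi>) * \<theta> h + \<theta> w * \<theta> \<pi> * \<theta> (D h))"
      unfolding h(2) by (simp only: mult.assoc)
    then have "\<theta> h * (\<theta> \<pi> * of_nat e * \<theta> (D w))
        = \<theta> w * of_nat e * \<theta> (D \<pi>) * \<theta> h + \<theta> w * \<theta> \<pi> * \<theta> (D h)"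
      using \<pi>0 by (metis mult_cancel_left power_not_zero)
    then have "\<theta> w * of_nat e * \<theta> (D \<pi>) * \<theta> h
        = \<theta> h * (\<theta> \<pi> * of_nat e * \<theta> (D w)) - \<theta> w * \<theta> \<pi> * \<theta> (D h)"
      by (simp only: add_diff_cancel_right')
    then have "\<theta> (of_nat e * (w * h * D \<pi>)) = \<theta> ((h * of_nat e * D w - w * D h) * \<pi>)"
      by (simp only: hom hom_minus hom_of_nat left_diff_distrib right_diff_distrib mult_ac)
    then have eP: "of_nat e * (w * h * D \<pi>) \<in> P"
      using Pcong mfps_ideal.subspace_scale[OF PI \<pi>(1)] by blast
    have "w * h * D \<pi> = mfps_scale (inverse (of_nat e)) 1 * (of_nat e * (w * h * D \<pi>))"
      using \<open>e \<noteq> 0\<close> by (simp add: mfps_scale_of_nat flip: mfps_scale_eq_mult)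
    then have "w * h * D \<pi> \<in> P" using mfps_ideal.subspace_scale[OF PI eP] by metis
    then have D\<pi>: "D \<pi> \<in> P" using prime primen[OF \<pi>(2) h(1)] by blast
    show "D ` P \<subseteq> P"
    proof
      fix z assume "z \<in> D ` P"
      then obtain y where y: "z = D y" "y \<in> P" by blast
      from wP[OF y(2)] obtain y' where "\<theta> w * \<theta> y = \<theta> \<pi> * \<theta> y'" by blast
      then have "\<theta> (w * y) = \<theta> (\<pi> * y')" by (simp add: hom)
      from Dcong[OF this] have "\<theta> (w * D y) = \<theta> (y' * D \<pi> + D y' * \<pi> - D w * y)"
        by (simp add: Dmult hom hom_minus algebra_simps)
      moreover have "y' * D \<pi> + D y' * \<pi> - D w * y \<in> P"
        by (intro mfps_ideal.subspace_diff[OF PI] mfps_ideal.subspace_add[OF PI]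
            mfps_ideal.subspace_scale[OF PI] D\<pi> \<pi>(1) y(2))
      ultimately have "w * D y \<in> P" using Pcong by blast
      then show "z \<in> P" using prime \<pi>(2) y(1) by blast
    qed
  qed
  then show thesis
    using that[of P] PI kerP \<delta>P P(2) by blast
qed

section \<open>Solving the defining equations for some of the variables\<close>

lemma mcoeff_var_mult:
  "mcoeff (mfps_var k * f) m = (if m $ k = 0 then 0 else mcoeff f (m - axis k 1))"
proof -
  have "axis k 1 \<le> m \<longleftrightarrow> m $ k \<noteq> 0"
    by (auto simp: less_eq_vec_def axis_def)
  then show ?thesis by (simp add: mfps_var_eq_mmonom mcoeff_mmonom_mult)
qed

definition kill_vars :: "'v::finite set \<Rightarrow> 'v \<Rightarrow> ('v, 'a::comm_ring_1) mfps" where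
  "kill_vars V k = (if k \<in> V then mfps_var k else 0)"

lemma ord_ge_kill_vars: "ord_ge 1 (kill_vars V k)"
  unfolding kill_vars_def by simp

lemma mcoeff_compose_kill_vars:
  fixes f :: "('v::finite, 'a::comm_ring_1) mfps"
  shows "mcoeff (mfps_compose f (kill_vars V)) m = (if \<forall>k. k \<notin> V \<longrightarrow> m $ k = 0 then mcoeff f m else 0)"
proof -
  define supp where "supp = (\<lambda>m :: nat ^ 'v. \<forall>k. k \<notin> V \<longrightarrow> m $ k = 0)"
  define res where "res = (\<lambda>f :: ('v, 'a) mfps. Abs_mfps (\<lambda>m. if supp m then mcoeff f m else 0))"
  define C where "C = (\<lambda>f. mfps_compose f (kill_vars V) - res f)"
  have "C f = 0"
  proof (rule vanishes_if_vanishes_on_monomials[where s = 0 and C = C])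
    show "C (f + g) = C f + C g" for f g
      by (rule mfps_eqI) (simp add: C_def res_def mfps_compose_add)
    show "C (mfps_scale c f) = mfps_scale c (C f)" for c f
      by (rule mfps_eqI) (simp add: C_def res_def mfps_compose_scale algebra_simps)
    show "ord_ge k (C f)" if "ord_ge (k + 0) f" for k f
      unfolding C_def using that
      by (intro ord_ge_diff ord_ge_compose_raw) (auto simp: ord_ge_def res_def)
    show "C (mmonom a) = 0" for a
    proof (cases "supp a")
      case True
      then have "res (mmonom a) = mmonom a"
        by (intro mfps_eqI) (auto simp: res_def mcoeff_mmonom)
      moreover have "(\<Prod>i\<in>UNIV. kill_vars V i ^ (a $ i)) = (mmonom a :: ('v, 'a) mfps)"
        unfolding mmonom_eq_prod by (intro prod.cong) (use True in \<open>auto simp: kill_vars_def supp_def\<close>)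
      ultimately show ?thesis by (simp add: C_def mfps_compose_mmonom[OF ord_ge_kill_vars])
    next
      case False
      then obtain k where k: "k \<notin> V" "a $ k \<noteq> 0" unfolding supp_def by blast
      have "res (mmonom a) = 0"
        using False by (intro mfps_eqI) (auto simp: res_def mcoeff_mmonom)
      moreover have "kill_vars V k ^ (a $ k) = (0 :: ('v, 'a) mfps)"
        using k by (simp add: kill_vars_def zero_power)
      then have "(\<Prod>i\<in>UNIV. kill_vars V i ^ (a $ i)) = (0 :: ('v, 'a) mfps)"
        by (subst prod.remove[of _ k]) auto
      ultimately show ?thesis by (simp add: C_def mfps_compose_mmonom[OF ord_ge_kill_vars])
    qed
  qed
  then have "mfps_compose f (kill_vars V) = res f" by (simp add: C_def)
  then show ?thesis by (simp add: res_def supp_def)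
qed

lemma minus_kill_vars_in_ideal:
  fixes f :: "('v::finite, 'a::comm_ring_1) mfps"
  shows "\<exists>g. f - mfps_compose f (kill_vars V) = (\<Sum>k\<in>-V. mfps_var k * g k)"
proof -
  define sel where "sel = (\<lambda>m :: nat ^ 'v. SOME k. k \<notin> V \<and> m $ k \<noteq> 0)"
  have sel: "sel m \<notin> V" "m $ sel m \<noteq> 0" if "\<exists>k. k \<notin> V \<and> m $ k \<noteq> 0" for m
    using someI_ex[OF that] unfolding sel_def by blast+
  define g where "g = (\<lambda>k. Abs_mfps (\<lambda>m. if sel (m + axis k 1) = k then mcoeff f (m + axis k 1) else 0))"
  have "f - mfps_compose f (kill_vars V) = (\<Sum>k\<in>-V. mfps_var k * g k)"
  proof (rule mfps_eqI)
    fix m :: "nat ^ 'v"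
    have aux: "(if S then 0 else x) = x - (if S then x else 0)" for S and x :: 'a by simp
    have m: "m - axis k 1 + axis k 1 = m" if "m $ k \<noteq> 0" for k
      using that by (auto simp: vec_eq_iff axis_def)
    have "mcoeff (\<Sum>k\<in>-V. mfps_var k * g k) m
        = (\<Sum>k\<in>-V. if k = sel m then (if m $ k = 0 then 0 else mcoeff f m) else 0)"
      unfolding mcoeff_sum mcoeff_var_mult g_def by (intro sum.cong) (auto simp: m m[simplified])
    also have "\<dots> = (if sel m \<in> -V then (if m $ sel m = 0 then 0 else mcoeff f m) else 0)"
      by simp
    also have "\<dots> = (if \<forall>k. k \<notin> V \<longrightarrow> m $ k = 0 then 0 else mcoeff f m)"
      by (cases "\<exists>k. k \<notin> V \<and> m $ k \<noteq> 0") (use sel[of m] in auto)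
    also have "\<dots> = mcoeff f m - mcoeff (mfps_compose f (kill_vars V)) m"
      unfolding mcoeff_compose_kill_vars by (rule aux)
    finally show "mcoeff (f - mfps_compose f (kill_vars V)) m = mcoeff (\<Sum>k\<in>-V. mfps_var k * g k) m"
      by (simp only: minus_mfps.rep_eq)
  qed
  then show ?thesis by blast
qed

lemma mcoeff_eq_0_if_deriv_0:
  fixes f :: "('v::finite, 'a::field_char_0) mfps"
  assumes "mfps_deriv k f = 0" "m $ k \<noteq> 0"
  shows "mcoeff f m = 0"
proof -
  have "m - axis k 1 + axis k 1 = m"
    using assms(2) by (auto simp: vec_eq_iff axis_def)
  moreover have "mcoeff (mfps_deriv k f) (m - axis k 1) = 0" using assms(1) by simp
  ultimately show ?thesis by (simp add: mfps_deriv.rep_eq del: of_nat_Suc)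
qed

text \<open>
  In the coordinates formed by the \<open>\<rho>\<^sub>i\<close> and the variables in \<open>V\<close>, solving the equations \<open>\<rho>\<^sub>i = 0\<close> for
  the variables outside \<open>V\<close> means to set the coordinates \<open>\<rho>\<^sub>i\<close> to zero.  Thus substituting the
  solution \<open>G\<close> is a retraction of the power series ring onto the series in the variables \<open>V\<close>, with
  kernel the ideal of the \<open>\<rho>\<^sub>i\<close>.
\<close>

lemma formal_implicit_function:
  fixes \<rho> :: "nat \<Rightarrow> ('v::finite, 'a::field_char_0) mfps" and V :: "'v set"
  assumes \<rho>: "\<And>i. i < d \<Longrightarrow> mfps_const_coeff (\<rho> i) = 0"
    and \<iota>: "bij_betw \<iota> (- V) {..<d}"
    and inv: "invertible (jacobian_0 (\<lambda>k. if k \<in> V then mfps_var k else \<rho> (\<iota> k)))"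
  obtains G where "\<And>k. ord_ge 1 (G k)" "\<And>k. k \<in> V \<Longrightarrow> G k = mfps_var k"
    "\<And>k. mfps_compose (G k) G = G k"
    "\<And>f. mfps_compose f G = 0 \<longleftrightarrow> f \<in> mfps_ideal.span (\<rho> ` {..<d})"
    "\<And>j k. j \<notin> V \<Longrightarrow> mfps_deriv j (G k) = 0"
    "\<And>f. \<forall>j. j \<notin> V \<longrightarrow> mfps_deriv j f = 0 \<Longrightarrow> mfps_compose f G = f"
proof -
  define \<phi> where "\<phi> = (\<lambda>k. if k \<in> V then mfps_var k else \<rho> (\<iota> k))"
  have \<iota>d: "\<iota> k < d" if "k \<notin> V" for k using \<iota> that by (auto simp: bij_betw_def)
  have \<phi>1: "ord_ge 1 (\<phi> k)" for k
  proof (cases "k \<in> V")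
    case False
    then show ?thesis using \<rho>[OF \<iota>d[OF False]] unfolding ord_ge_1_iff by (simp add: \<phi>_def)
  qed (simp add: \<phi>_def)
  obtain \<psi> where \<psi>: "\<And>k. ord_ge 1 (\<psi> k)" "\<And>k. mfps_compose (\<psi> k) \<phi> = mfps_var k"
    "\<And>k. mfps_compose (\<phi> k) \<psi> = mfps_var k"
    by (rule formal_inverse_function[OF \<phi>1]) (use inv in \<open>auto simp: \<phi>_def\<close>)
  define z :: "'v \<Rightarrow> ('v, 'a) mfps" where "z = kill_vars V"
  have z1: "ord_ge 1 (z k)" for k unfolding z_def by (rule ord_ge_kill_vars)
  define G where "G = (\<lambda>k. mfps_compose (\<psi> k) z)"
  have G1: "ord_ge 1 (G k)" for k unfolding G_def by (intro ord_ge_compose \<psi>)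
  have \<theta>: "mfps_compose f G = mfps_compose (mfps_compose f \<psi>) z" for f
    unfolding G_def by (rule mfps_compose_assoc[OF \<psi>(1) z1, symmetric])
  have GV: "G k = mfps_var k" if "k \<in> V" for k
  proof -
    have "\<psi> k = mfps_var k"
      using \<psi>(3)[of k] that by (simp add: \<phi>_def mfps_compose_var[OF \<psi>(1)])
    then show ?thesis
      using that by (simp add: G_def mfps_compose_var[OF z1]) (simp add: z_def kill_vars_def)
  qed
  have zG: "mfps_compose (z k) G = z k" for k
    using GV mfps_compose_var[of G, OF G1] by (cases "k \<in> V") (auto simp: z_def kill_vars_def)
  have GG: "mfps_compose (G k) G = G k" for k
    by (subst G_def) (simp add: mfps_compose_assoc[OF z1 G1] zG, simp add: G_def)
  have \<rho>G: "mfps_compose (\<rho> i) G = 0" if "i < d" for i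
  proof -
    have "i \<in> \<iota> ` (- V)" using \<iota> that by (simp add: bij_betw_def)
    then obtain k where k: "k \<notin> V" "\<iota> k = i" by auto
    then have "mfps_compose (\<rho> i) \<psi> = mfps_var k" using \<psi>(3)[of k] by (simp add: \<phi>_def)
    then show ?thesis
      using k by (simp add: \<theta> mfps_compose_var[OF z1]) (simp add: z_def kill_vars_def)
  qed
  have ker: "mfps_compose f G = 0 \<longleftrightarrow> f \<in> mfps_ideal.span (\<rho> ` {..<d})" for f
  proof
    assume "f \<in> mfps_ideal.span (\<rho> ` {..<d})"
    then show "mfps_compose f G = 0"
      by (induction rule: mfps_ideal.span_induct_alt)
        (auto simp: mfps_compose_add mfps_compose_mult[OF G1] \<rho>G)
  next
    assume 0: "mfps_compose f G = 0"
    obtain g where "mfps_compose f \<psi> - mfps_compose (mfps_compose f \<psi>) z = (\<Sum>k\<in>-V. mfps_var k * g k)"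
      using minus_kill_vars_in_ideal[of "mfps_compose f \<psi>" V] unfolding z_def by blast
    then have "mfps_compose f \<psi> = (\<Sum>k\<in>-V. mfps_var k * g k)" using 0 by (simp add: \<theta>)
    then have "mfps_compose (mfps_compose f \<psi>) \<phi> = (\<Sum>k\<in>-V. \<phi> k * mfps_compose (g k) \<phi>)"
      by (simp add: mfps_compose_sum mfps_compose_mult[OF \<phi>1] mfps_compose_var[OF \<phi>1])
    moreover have "mfps_compose (mfps_compose f \<psi>) \<phi> = f"
      by (simp add: mfps_compose_assoc[OF \<psi>(1) \<phi>1] \<psi>(2))
    ultimately have "f = (\<Sum>k\<in>-V. mfps_compose (g k) \<phi> * \<rho> (\<iota> k))"
      by (simp add: \<phi>_def mult.commute)
    then show "f \<in> mfps_ideal.span (\<rho> ` {..<d})"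
      using \<iota>d by (metis (no_types, lifting) ComplD image_eqI lessThan_iff mfps_ideal.span_base
          mfps_ideal.span_scale mfps_ideal.span_sum)
  qed
  have dG: "mfps_deriv j (G k) = 0" if "j \<notin> V" for j k
  proof -
    have "mfps_deriv j (z i) = 0" for i
      using that by (auto simp: z_def kill_vars_def mfps_deriv_var)
    then show ?thesis by (simp add: G_def mfps_deriv_compose[OF z1])
  qed
  have fixed: "mfps_compose f G = f" if "\<forall>j. j \<notin> V \<longrightarrow> mfps_deriv j f = 0" for f
  proof -
    have "mfps_compose f z = f"
      unfolding z_def by (rule mfps_eqI)
        (use mcoeff_eq_0_if_deriv_0 that in \<open>auto simp: mcoeff_compose_kill_vars\<close>)
    moreover have "mfps_compose (mfps_compose f z) G = mfps_compose f z"
      using mfps_compose_assoc[of z G f, OF z1 G1] unfolding zG .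
    ultimately show ?thesis by simp
  qed
  show thesis by (rule that[OF G1 GV GG ker dG fixed])
qed

text \<open>Steinitz exchange: independent linear forms become a basis together with the coordinate forms
  of a suitable set of coordinates.\<close>

lemma complementary_coordinates:
  fixes u :: "nat \<Rightarrow> complex ^ 'n::finite"
  assumes "lin_indep_family d u"
  obtains W :: "'n set" where "card (- W) = d"
    "\<And>t. (\<And>i. i < d \<Longrightarrow> (\<Sum>l\<in>UNIV. u i $ l * t l) = 0) \<Longrightarrow> (\<And>l. l \<in> W \<Longrightarrow> t l = 0) \<Longrightarrow> t = (\<lambda>_. 0)"
proof -
  let ?U = "u ` {..<d}" and ?E = "range (\<lambda>l. axis l 1 :: complex ^ 'n)"
  have cardU: "card ?U = d" and indU: "vec.independent ?U"
    using assms by (auto simp: lin_indep_family_def card_image)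
  obtain B where B: "?U \<subseteq> B" "B \<subseteq> ?U \<union> ?E" "vec.independent B" "?U \<union> ?E \<subseteq> vec.span B"
    using vec.maximal_independent_subset_extend[of ?U "?U \<union> ?E"] indU by auto
  have "vec.span ?E = UNIV"
    using vec.span_Basis by (simp add: cart_basis_def full_SetCompr_eq)
  then have spanB: "vec.span B = UNIV"
    using B(4) by (metis le_sup_iff top.extremum_unique vec.span_minimal vec.subspace_span)
  have cardB: "card B = CARD('n)"
    using vec.dim_eq_card[of B UNIV] B(3) spanB by (metis vec.span_UNIV vec_dim_card)
  have finB: "finite B" using B(2) by (rule finite_subset) auto
  define W where "W = {l. axis l 1 \<in> B - ?U}"
  have inj: "inj (\<lambda>l :: 'n. axis l (1 :: complex))" by (auto simp: inj_def axis_eq_axis)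
  have "B - ?U = (\<lambda>l. axis l 1) ` W"
    using B(2) by (auto simp: W_def)
  then have "card (B - ?U) = card W" using inj by (metis card_image inj_on_subset subset_UNIV)
  moreover have "card (B - ?U) = CARD('n) - d"
    using card_Diff_subset[OF _ B(1)] cardU cardB by simp
  moreover have "d \<le> CARD('n)" using card_mono[OF finB B(1)] cardU cardB by simp
  ultimately have "card (- W) = d"
    by (simp add: Compl_eq_Diff_UNIV card_Diff_subset)
  moreover have "t = (\<lambda>_. 0)"
    if t: "\<And>i. i < d \<Longrightarrow> (\<Sum>l\<in>UNIV. u i $ l * t l) = 0" "\<And>l. l \<in> W \<Longrightarrow> t l = 0" for t
  proof -
    have ax: "(\<Sum>l\<in>UNIV. axis k 1 $ l * t l) = t k" for k :: 'n
    proof -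
      have "(\<Sum>l\<in>UNIV. axis k 1 $ l * t l) = (\<Sum>l\<in>UNIV. if l = k then t l else 0)"
        by (intro sum.cong) (auto simp: axis_def)
      then show ?thesis by simp
    qed
    have base: "(\<Sum>l\<in>UNIV. b $ l * t l) = 0" if b: "b \<in> B" for b
    proof (cases "b \<in> ?U")
      case False
      then obtain l where "b = axis l 1" "l \<in> W" using B(2) b by (auto simp: W_def)
      then show ?thesis using t(2) ax by simp
    qed (use t(1) in auto)
    have "(\<Sum>l\<in>UNIV. x $ l * t l) = 0" if "x \<in> vec.span B" for x
      using that
    proof (induction rule: vec.span_induct_alt)
      case (step c b x)
      have "(\<Sum>l\<in>UNIV. (c *s b + x) $ l * t l)
          = c * (\<Sum>l\<in>UNIV. b $ l * t l) + (\<Sum>l\<in>UNIV. x $ l * t l)"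
        by (simp add: sum_distrib_left sum.distrib algebra_simps)
      with step base show ?case by simp
    qed simp
    with ax spanB show ?thesis by (metis UNIV_I ext)
  qed
  ultimately show thesis using that by blast
qed

text \<open>
  The retraction for a generic submanifold.  The pair \<open>e\<close>, \<open>e'\<close> stands for \<open>Inl\<close>, \<open>Inr\<close> in either
  order: only variables of type \<open>e\<close> are eliminated, so the series in the variables of type \<open>e'\<close> are
  untouched.  Tangent vectors are determined by their components in \<open>V\<close>, which are arbitrary.
\<close>

lemma adapted_retraction:
  fixes \<rho> :: "'n::finite defining" and e e' :: "'n \<Rightarrow> 'n + 'n"
  assumes e: "inj e" "inj e'" "range e' = - range e"
    and \<rho>: "\<And>i. i < d \<Longrightarrow> mfps_const_coeff (\<rho> i) = 0"
    and ind: "lin_indep_family d (\<lambda>i. vec_at_0 (\<chi> l. mfps_deriv (e l) (\<rho> i)))"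
  obtains V G where "range e' \<subseteq> V" "\<And>k. ord_ge 1 (G k)"
    "\<And>k. mfps_compose (G k) G = G k"
    "\<And>f. mfps_compose f G = 0 \<longleftrightarrow> f \<in> mfps_ideal.span (\<rho> ` {..<d})"
    "\<And>j k. j \<notin> V \<Longrightarrow> mfps_deriv j (G k) = 0"
    "\<And>f. \<forall>j. j \<notin> V \<longrightarrow> mfps_deriv j f = 0 \<Longrightarrow> mfps_compose f G = f"
    "\<And>v0. v0 \<in> V \<Longrightarrow> \<exists>t\<in>complex_tangent_space d \<rho>. \<forall>v\<in>V. t $ v = (if v = v0 then 1 else 0)"
proof -
  define u where "u = (\<lambda>i. vec_at_0 (\<chi> l. mfps_deriv (e l) (\<rho> i)))"
  obtain W where W: "card (- W) = d"
    "\<And>t. (\<And>i. i < d \<Longrightarrow> (\<Sum>l\<in>UNIV. u i $ l * t l) = 0) \<Longrightarrow> (\<And>l. l \<in> W \<Longrightarrow> t l = 0) \<Longrightarrow> t = (\<lambda>_. 0)"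
    using complementary_coordinates ind unfolding u_def by blast
  define V where "V = range e' \<union> e ` W"
  have mV: "- V = e ` (- W)" using e by (auto simp: V_def inj_def)
  have "card (- V) = d" unfolding mV using W(1) e(1) by (metis card_image inj_on_subset subset_UNIV)
  then obtain \<iota> where \<iota>: "bij_betw \<iota> (- V) {..<d}"
    using finite_same_card_bij[of "- V" "{..<d}"] by auto
  define \<phi> where "\<phi> = (\<lambda>k. if k \<in> V then mfps_var k else \<rho> (\<iota> k))"
  have row_V: "(jacobian_0 \<phi> *v t) $ k = t $ k" if "k \<in> V" for t k
  proof -
    have "(jacobian_0 \<phi> *v t) $ k = (\<Sum>j\<in>UNIV. if j = k then t $ j else 0)"
      unfolding matrix_vector_mult_def jacobian_0_def vec_lambda_beta
      by (intro sum.cong refl) (simp add: \<phi>_def that mfps_deriv_var)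
    then show ?thesis by simp
  qed
  have row_\<rho>: "(jacobian_0 \<phi> *v t) $ k = (\<Sum>j\<in>UNIV. mfps_const_coeff (mfps_deriv j (\<rho> (\<iota> k))) * t $ j)"
    if "k \<notin> V" for t k
    using that by (simp add: matrix_vector_mult_def jacobian_0_def \<phi>_def)
  have rho_rows: "\<exists>k. k \<notin> V \<and> \<iota> k = i" if "i < d" for i
    using \<iota> that unfolding bij_betw_def by (metis ComplD imageE lessThan_iff)
  have "t = 0" if t: "jacobian_0 \<phi> *v t = 0" for t
  proof -
    have tV: "t $ k = 0" if "k \<in> V" for k using row_V[OF that, of t] t by simp
    have "(\<lambda>l. t $ e l) = (\<lambda>_. 0)"
    proof (rule W(2))
      fix i assume "i < d"
      then obtain k where k: "k \<notin> V" "\<iota> k = i" using rho_rows by blast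
      have "(\<Sum>l\<in>UNIV. u i $ l * t $ e l)
          = (\<Sum>j\<in>range e. mfps_const_coeff (mfps_deriv j (\<rho> i)) * t $ j)"
        by (subst sum.reindex[OF e(1)]) (simp add: u_def vec_at_0_def)
      also have "\<dots> = (\<Sum>j\<in>UNIV. mfps_const_coeff (mfps_deriv j (\<rho> i)) * t $ j)"
        using e(3) tV by (intro sum.mono_neutral_left) (auto simp: V_def)
      also have "\<dots> = 0" using row_\<rho>[OF k(1), of t] t k(2) by simp
      finally show "(\<Sum>l\<in>UNIV. u i $ l * t $ e l) = 0" .
    qed (use tV in \<open>auto simp: V_def\<close>)
    then have "t $ e l = 0" for l by (metis)
    then have "t $ k = 0" for k
      using tV e(3) by (cases "k \<in> range e") (auto simp: V_def)
    then show ?thesis by (simp add: vec_eq_iff)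
  qed
  then have inv: "invertible (jacobian_0 \<phi>)"
    by (simp add: invertible_left_inverse matrix_left_invertible_ker)
  have tangent: "\<exists>t\<in>complex_tangent_space d \<rho>. \<forall>v\<in>V. t $ v = (if v = v0 then 1 else 0)"
    if "v0 \<in> V" for v0
  proof -
    obtain B where B: "jacobian_0 \<phi> ** B = mat 1" using inv by (auto simp: invertible_right_inverse)
    define t where "t = B *v axis v0 1"
    have t: "jacobian_0 \<phi> *v t = axis v0 1"
      unfolding t_def by (simp add: matrix_vector_mul_assoc B)
    have "t \<in> complex_tangent_space d \<rho>"
      unfolding complex_tangent_space_def
    proof (intro CollectI allI impI)
      fix i assume "i < d"
      then obtain k where k: "k \<notin> V" "\<iota> k = i" using rho_rows by blast
      then have "k \<noteq> v0" using that by auto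
      then show "(\<Sum>k\<in>UNIV. mfps_const_coeff (mfps_deriv k (\<rho> i)) * t $ k) = 0"
        using row_\<rho>[OF k(1), of t] k(2) unfolding t by (simp add: axis_def)
    qed
    moreover have "t $ v = (if v = v0 then 1 else 0)" if "v \<in> V" for v
      using row_V[OF that, of t] unfolding t by (simp add: axis_def)
    ultimately show ?thesis by blast
  qed
  obtain G where "\<And>k. ord_ge 1 (G k)" "\<And>k. k \<in> V \<Longrightarrow> G k = mfps_var k"
    "\<And>k. mfps_compose (G k) G = G k"
    "\<And>f. mfps_compose f G = 0 \<longleftrightarrow> f \<in> mfps_ideal.span (\<rho> ` {..<d})"
    "\<And>j k. j \<notin> V \<Longrightarrow> mfps_deriv j (G k) = 0"
    "\<And>f. \<forall>j. j \<notin> V \<longrightarrow> mfps_deriv j f = 0 \<Longrightarrow> mfps_compose f G = f"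
    by (rule formal_implicit_function[OF \<rho> \<iota> inv[unfolded \<phi>_def]]) blast+
  with tangent show thesis by (intro that[of V G]) (auto simp: V_def)
qed

section \<open>The Jacobian determinant of a finite map\<close>

lemma mfps_deriv_power_Suc:
  "mfps_deriv k (f ^ Suc n) = of_nat (Suc n) * f ^ n * mfps_deriv k f"
proof (induction n)
  case (Suc n)
  have aux: "D * (f * q) + f * (r * q * D) = (1 + r) * (f * q * D)" for D q r
    by (simp only: distrib_right distrib_left mult_1 mult_1_right mult_ac)
  have "mfps_deriv k (f ^ Suc (Suc n))
      = mfps_deriv k f * f ^ Suc n + f * (of_nat (Suc n) * f ^ n * mfps_deriv k f)"
    by (simp only: power_Suc[of f "Suc n"] mfps_deriv_mult Suc)
  also have "\<dots> = (1 + of_nat (Suc n)) * (f ^ Suc n * mfps_deriv k f)"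
    unfolding power_Suc by (rule aux)
  finally show ?case by (simp only: of_nat_Suc mult.assoc)
qed (simp add: mfps_deriv_mult)

text \<open>Gaussian elimination without divisions, which keeps the solution inside the subring \<open>A\<close>.\<close>

lemma linear_system_solution:
  fixes A :: "'a::idom set" and B :: "'b set" and J :: "'j set" and p :: "'j \<Rightarrow> 'b \<Rightarrow> 'a"
  assumes "finite B" "finite J" "card B < card J"
    and A: "0 \<in> A" "1 \<in> A" "\<And>x y. x \<in> A \<Longrightarrow> y \<in> A \<Longrightarrow> x - y \<in> A" "\<And>x y. x \<in> A \<Longrightarrow> y \<in> A \<Longrightarrow> x * y \<in> A"
    and p: "\<And>j b. j \<in> J \<Longrightarrow> b \<in> B \<Longrightarrow> p j b \<in> A"
  shows "\<exists>c. (\<forall>j\<in>J. c j \<in> A) \<and> (\<exists>j\<in>J. c j \<noteq> 0) \<and> (\<forall>b\<in>B. (\<Sum>j\<in>J. c j * p j b) = 0)"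
  using assms(1,2,3) p
proof (induction B arbitrary: J p rule: finite_induct)
  case empty
  then have "J \<noteq> {}" by auto
  then show ?case using A by (intro exI[of _ "\<lambda>_. 1"]) auto
next
  case (insert b B)
  have A_uminus: "- x \<in> A" if "x \<in> A" for x using A(3)[OF A(1) that] by simp
  have A_add: "x + y \<in> A" if "x \<in> A" "y \<in> A" for x y using A(3)[OF that(1) A_uminus[OF that(2)]] by simp
  have A_sum: "sum f K \<in> A" if "\<And>x. x \<in> K \<Longrightarrow> f x \<in> A" for f :: "'j \<Rightarrow> 'a" and K
    using that by (induction K rule: infinite_finite_induct) (auto intro: A A_add)
  show ?case
  proof (cases "\<forall>j\<in>J. p j b = 0")
    case True
    have "card B < card J" using insert.prems(2) insert.hyps by simp
    from insert.IH[OF insert.prems(1) this, of p] insert.prems(3) True show ?thesis by auto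
  next
    case False
    then obtain j0 where j0: "j0 \<in> J" "p j0 b \<noteq> 0" by blast
    \<comment> \<open>Eliminate the unknown \<open>j0\<close> with the pivot \<open>p j0 b\<close>.\<close>
    define K where "K = J - {j0}"
    define p' where "p' = (\<lambda>j b'. p j0 b * p j b' - p j b * p j0 b')"
    have K: "finite K" "card B < card K"
      using insert.prems(1,2) insert.hyps j0(1) by (auto simp: K_def)
    have p'A: "p' j b' \<in> A" if "j \<in> K" "b' \<in> B" for j b'
      unfolding p'_def using that j0 by (intro A insert.prems) (auto simp: K_def)
    from insert.IH[OF K, of p'] p'A obtain c' where c': "\<And>j. j \<in> K \<Longrightarrow> c' j \<in> A" "\<exists>j\<in>K. c' j \<noteq> 0"
      "\<And>b'. b' \<in> B \<Longrightarrow> (\<Sum>j\<in>K. c' j * p' j b') = 0" by blast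
    define c where "c = (\<lambda>j. if j = j0 then - (\<Sum>j\<in>K. c' j * p j b) else p j0 b * c' j)"
    have sum_c: "(\<Sum>j\<in>J. c j * p j b') = (\<Sum>j\<in>K. c' j * p' j b')" for b'
    proof -
      have "(\<Sum>j\<in>J. c j * p j b') = c j0 * p j0 b' + (\<Sum>j\<in>K. c j * p j b')"
        unfolding K_def using insert.prems(1) j0(1) by (rule sum.remove)
      also have "(\<Sum>j\<in>K. c j * p j b') = (\<Sum>j\<in>K. p j0 b * c' j * p j b')"
        by (intro sum.cong) (auto simp: c_def K_def)
      also have "c j0 * p j0 b' = (\<Sum>j\<in>K. - (c' j * p j b * p j0 b'))"
        by (simp add: c_def sum_distrib_right sum_negf)
      finally show ?thesis
        by (simp add: p'_def algebra_simps flip: sum.distrib)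
    qed
    have "c j \<in> A" if "j \<in> J" for j
    proof (cases "j = j0")
      case True
      then show ?thesis unfolding c_def using insert.prems(3) c'(1)
        by (auto intro!: A_uminus A_sum A simp: K_def)
    next
      case False
      then show ?thesis unfolding c_def using that insert.prems(3) c'(1) j0
        by (auto intro!: A simp: K_def)
    qed
    moreover have "\<exists>j\<in>J. c j \<noteq> 0" using c'(2) j0 by (auto simp: c_def K_def)
    moreover have "(\<Sum>j\<in>J. c j * p j b') = 0" if "b' \<in> insert b B" for b'
    proof (cases "b' = b")
      case True
      have "p' j b = 0" for j by (simp add: p'_def mult.commute)
      then show ?thesis unfolding sum_c True by simp
    next
      case False
      then show ?thesis unfolding sum_c using that c'(3) by auto
    qed
    ultimately show ?thesis by blast
  qed
qed

lemma span_range_ideal: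
  fixes h :: "'i::finite \<Rightarrow> ('v::finite, 'a::comm_ring_1) mfps"
  assumes "x \<in> mfps_ideal.span (range h)"
  shows "\<exists>q. x = (\<Sum>l\<in>UNIV. h l * q l)"
  using assms
proof (induction rule: mfps_ideal.span_induct_alt)
  case base
  show ?case by (intro exI[of _ "\<lambda>_. 0"]) simp
next
  case (step c x y)
  then obtain q l where q: "y = (\<Sum>l\<in>UNIV. h l * q l)" "x = h l" by blast
  have "(\<Sum>i\<in>UNIV. h i * (q i + (if i = l then c else 0)))
      = (\<Sum>i\<in>UNIV. h i * q i) + (\<Sum>i\<in>UNIV. if i = l then h i * c else 0)"
    by (simp add: algebra_simps sum.distrib if_distrib[of "(*) _"] cong: if_cong)
  then have "c * x + y = (\<Sum>i\<in>UNIV. h i * (q i + (if i = l then c else 0)))"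
    by (simp add: q mult.commute)
  then show ?case by (intro exI[of _ "\<lambda>i. q i + (if i = l then c else 0)"])
qed

text \<open>Expanding the coefficients of the \<open>H\<^sub>l\<close> again and again and summing up, one sees that a finite set
  spanning the quotient by the ideal \<open>(H)\<close> generates the ring over the series in \<open>H\<close>.\<close>

lemma finite_module_over_pullback:
  fixes H :: "'n::finite fmap"
  assumes H: "formal_map H" and fin: "finite_map H"
  obtains B and \<phi> where "finite B" "\<And>f. f = (\<Sum>b\<in>B. mfps_compose (\<phi> b f) (\<lambda>l. H $ l) * b)"
proof -
  have H1: "ord_ge 1 (H $ l)" for l
    using H unfolding formal_map_def ord_ge_1_iff by blast
  obtain B where B: "finite B" "\<And>f. \<exists>b\<in>mfps_vs.span B. f - b \<in> mfps_ideal.span (range (\<lambda>j. H $ j))"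
    using fin unfolding finite_map_def by blast
  have "\<exists>a F. f = (\<Sum>b\<in>B. mfps_scale (a b) b) + (\<Sum>l\<in>UNIV. H $ l * F l)" for f
  proof -
    obtain b where b: "b \<in> mfps_vs.span B" "f - b \<in> mfps_ideal.span (range (\<lambda>j. H $ j))"
      using B(2) by blast
    obtain a where "b = (\<Sum>v\<in>B. mfps_scale (a v) v)"
      using b(1) B(1) by (auto simp: mfps_vs.span_finite)
    moreover obtain F where "f - b = (\<Sum>l\<in>UNIV. H $ l * F l)" using span_range_ideal[OF b(2)] by blast
    ultimately have "f = (\<Sum>b\<in>B. mfps_scale (a b) b) + (\<Sum>l\<in>UNIV. H $ l * F l)"
      by (simp add: algebra_simps)
    then show ?thesis by blast
  qed
  then have "\<forall>f. \<exists>a F. f = (\<Sum>b\<in>B. mfps_scale (a b) b) + (\<Sum>l\<in>UNIV. H $ l * F l)"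
    by (rule allI)
  then obtain a F where "\<forall>f. f = (\<Sum>b\<in>B. mfps_scale (a f b) b) + (\<Sum>l\<in>UNIV. H $ l * F f l)"
    unfolding choice_iff by (elim exE)
  then have aF: "f = (\<Sum>b\<in>B. mfps_scale (a f b) b) + (\<Sum>l\<in>UNIV. H $ l * F f l)" for f
    by (rule spec)
  \<comment> \<open>The coefficient series for \<open>f\<close> in terms of those for the \<open>F f l\<close>, as a fixed point equation.\<close>
  define T where "T = (\<lambda>(\<psi> :: ('n, complex) mfps \<times> ('n, complex) mfps \<Rightarrow> ('n, complex) mfps) (b, f).
    mfps_scale (a f b) 1 + (\<Sum>l\<in>UNIV. mfps_var l * \<psi> (b, F f l)))"
  have "\<exists>\<psi>. T \<psi> = \<psi>"
  proof (rule contraction_fixed_point)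
    fix k and \<psi> \<psi>' :: "('n, complex) mfps \<times> ('n, complex) mfps \<Rightarrow> ('n, complex) mfps"
      and i :: "('n, complex) mfps \<times> ('n, complex) mfps"
    assume c: "\<And>i. ord_ge k (\<psi> i - \<psi>' i)"
    obtain b f where i: "i = (b, f)" by (cases i)
    have "T \<psi> i - T \<psi>' i = (\<Sum>l\<in>UNIV. mfps_var l * (\<psi> (b, F f l) - \<psi>' (b, F f l)))"
      by (simp add: T_def i algebra_simps sum_subtractf)
    also have "ord_ge (1 + k) \<dots>" by (intro ord_ge_sum ord_ge_mult ord_ge_var c)
    finally show "ord_ge (Suc k) (T \<psi> i - T \<psi>' i)" by simp
  qed
  then obtain \<psi> where "T \<psi> = \<psi>" ..
  then have fp: "\<psi> (b, f) = T \<psi> (b, f)" for b f by simp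
  have \<psi>: "\<psi> (b, f) = mfps_scale (a f b) 1 + (\<Sum>l\<in>UNIV. mfps_var l * \<psi> (b, F f l))" for b f
    by (rule trans[OF fp]) (simp add: T_def)
  define P where "P = (\<lambda>b f. mfps_compose (\<psi> (b, f)) (\<lambda>l. H $ l))"
  have P: "P b f = mfps_scale (a f b) 1 + (\<Sum>l\<in>UNIV. H $ l * P b (F f l))" for b f
    unfolding P_def by (subst \<psi>) (simp add: mfps_compose_add mfps_compose_scale mfps_compose_sum
        mfps_compose_mult[OF H1] mfps_compose_var[of "\<lambda>l. H $ l", OF H1])
  \<comment> \<open>The error \<open>R f\<close> satisfies \<open>R f = \<Sum> H\<^sub>l R (F f l)\<close>, so it vanishes to every order.\<close>
  define R where "R = (\<lambda>f. f - (\<Sum>b\<in>B. P b f * b))"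
  have R: "R f = (\<Sum>l\<in>UNIV. H $ l * R (F f l))" for f
  proof -
    have "P b f * b = mfps_scale (a f b) b + (\<Sum>l\<in>UNIV. H $ l * (P b (F f l) * b))" for b
      unfolding P[of b f] distrib_right sum_distrib_right mult.assoc
        mfps_scale_mult_left[symmetric] mult_1 ..
    then have "(\<Sum>b\<in>B. P b f * b) = (\<Sum>b\<in>B. mfps_scale (a f b) b + (\<Sum>l\<in>UNIV. H $ l * (P b (F f l) * b)))"
      by (intro sum.cong refl)
    also have "\<dots> = (\<Sum>b\<in>B. mfps_scale (a f b) b) + (\<Sum>l\<in>UNIV. H $ l * (\<Sum>b\<in>B. P b (F f l) * b))"
      unfolding sum.distrib sum_distrib_left by (subst (2) sum.swap) simp
    finally have "R f = f - (\<Sum>b\<in>B. mfps_scale (a f b) b)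
        - (\<Sum>l\<in>UNIV. H $ l * (\<Sum>b\<in>B. P b (F f l) * b))"
      by (simp add: R_def)
    also have "f - (\<Sum>b\<in>B. mfps_scale (a f b) b) = (\<Sum>l\<in>UNIV. H $ l * F f l)"
      using add_diff_cancel_left'[of "\<Sum>b\<in>B. mfps_scale (a f b) b" "\<Sum>l\<in>UNIV. H $ l * F f l"]
      unfolding aF[of f, symmetric] .
    finally show ?thesis by (simp add: R_def right_diff_distrib sum_subtractf)
  qed
  have "ord_ge k (R f)" for k f
  proof (induction k arbitrary: f)
    case (Suc k)
    have "ord_ge (1 + k) (\<Sum>l\<in>UNIV. H $ l * R (F f l))"
      by (intro ord_ge_sum ord_ge_mult H1 Suc)
    then show ?case by (subst R) simp
  qed simp
  then have "R f = 0" for f using ord_ge_all_imp_0 by blast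
  then have "f = (\<Sum>b\<in>B. mfps_compose (\<psi> (b, f)) (\<lambda>l. H $ l) * b)" for f
    by (simp add: R_def P_def)
  then show thesis by (intro that[of B "\<lambda>b f. \<psi> (b, f)"] B(1))
qed

text \<open>Each variable \<open>Z\<^sub>i\<close> is algebraic over the field of fractions of the series in \<open>H\<close>.
  Differentiating a relation \<open>p\<^sub>i(H, Z\<^sub>i) = 0\<close> of minimal degree gives a matrix equation
  \<open>M \<cdot> H' = - diag (\<partial>p\<^sub>i/\<partial>T (H, Z\<^sub>i))\<close>, where by minimality the diagonal entries are nonzero.\<close>

theorem finite_map_jacobian_nonzero:
  fixes H :: "'n::finite fmap"
  assumes H: "formal_map H" and fin: "finite_map H"
  shows "det (\<chi> l k. mfps_deriv k (H $ l)) \<noteq> 0"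
proof -
  have H1: "ord_ge 1 (H $ l)" for l
    using H unfolding formal_map_def ord_ge_1_iff by blast
  define pb where "pb = (\<lambda>f :: ('n, complex) mfps. mfps_compose f (\<lambda>l. H $ l))"
  obtain B \<phi> where B: "finite B" "\<And>f. f = (\<Sum>b\<in>B. mfps_compose (\<phi> b f) (\<lambda>l. H $ l) * b)"
    by (rule finite_module_over_pullback[OF H fin]) (rule that)
  have expand: "f = (\<Sum>b\<in>B. pb (\<phi> b f) * b)" for f
    unfolding pb_def by (rule B(2))
  have pb_closed: "0 \<in> range pb" "1 \<in> range pb"
    "\<And>x y. x \<in> range pb \<Longrightarrow> y \<in> range pb \<Longrightarrow> x - y \<in> range pb"
    "\<And>x y. x \<in> range pb \<Longrightarrow> y \<in> range pb \<Longrightarrow> x * y \<in> range pb"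
    unfolding pb_def
    by (force intro: rev_image_eqI[of 0] rev_image_eqI[of 1]
        simp flip: mfps_compose_diff mfps_compose_mult[OF H1])+
  \<comment> \<open>A relation of degree \<open>N\<close> for \<open>Z\<^sub>i\<close> with coefficients in the series in \<open>H\<close>.\<close>
  define rel where "rel = (\<lambda>i N c. c N \<noteq> 0 \<and> range c \<subseteq> range pb \<and> (\<Sum>j\<le>N. c j * mfps_var i ^ j) = 0)"
  have ex: "\<exists>N c. rel i N c" for i
  proof -
    have "card B < card {..card B}" by simp
    from linear_system_solution[OF B(1) _ this pb_closed, of "\<lambda>j b. pb (\<phi> b (mfps_var i ^ j))"]
    obtain c where c: "\<And>j. j \<le> card B \<Longrightarrow> c j \<in> range pb" "\<exists>j\<le>card B. c j \<noteq> 0"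
      "\<And>b. b \<in> B \<Longrightarrow> (\<Sum>j\<le>card B. c j * pb (\<phi> b (mfps_var i ^ j))) = 0"
      by auto
    have "c j * mfps_var i ^ j = c j * (\<Sum>b\<in>B. pb (\<phi> b (mfps_var i ^ j)) * b)" for j
      using expand[of "mfps_var i ^ j"] by (rule arg_cong)
    then have "(\<Sum>j\<le>card B. c j * mfps_var i ^ j)
        = (\<Sum>j\<le>card B. \<Sum>b\<in>B. (c j * pb (\<phi> b (mfps_var i ^ j))) * b)"
      by (simp only: sum_distrib_left mult.assoc)
    also have "\<dots> = (\<Sum>b\<in>B. (\<Sum>j\<le>card B. c j * pb (\<phi> b (mfps_var i ^ j))) * b)"
      by (subst sum.swap) (simp add: sum_distrib_right)
    also have "\<dots> = 0" using c(3) by simp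
    finally have 0: "(\<Sum>j\<le>card B. c j * mfps_var i ^ j) = 0" .
    define N where "N = Max {j. j \<le> card B \<and> c j \<noteq> 0}"
    have N: "N \<le> card B" "c N \<noteq> 0" "\<And>j. j \<le> card B \<Longrightarrow> N < j \<Longrightarrow> c j = 0"
    proof -
      have f: "finite {j. j \<le> card B \<and> c j \<noteq> 0}" by simp
      have "N \<in> {j. j \<le> card B \<and> c j \<noteq> 0}"
        unfolding N_def using c(2) by (intro Max_in f) auto
      then show "N \<le> card B" "c N \<noteq> 0" by auto
      show "c j = 0" if j: "j \<le> card B" "N < j" for j
      proof (rule ccontr)
        assume "c j \<noteq> 0"
        with j(1) have "j \<le> N" unfolding N_def by (intro Max_ge f) simp
        with j(2) show False by simp
      qed
    qed
    have "(\<Sum>j\<le>N. c j * mfps_var i ^ j) = (\<Sum>j\<le>card B. c j * mfps_var i ^ j)"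
      using N by (intro sum.mono_neutral_left) auto
    with 0 have s: "(\<Sum>j\<le>N. c j * mfps_var i ^ j) = 0" by simp
    define c' where "c' = (\<lambda>j. if j \<le> N then c j else 0)"
    have "(\<Sum>j\<le>N. c' j * mfps_var i ^ j) = (\<Sum>j\<le>N. c j * mfps_var i ^ j)"
      by (intro sum.cong) (auto simp: c'_def)
    moreover have "range c' \<subseteq> range pb" using c(1) N(1) pb_closed(1) by (auto simp: c'_def)
    ultimately have "rel i N c'" using s N(2) unfolding rel_def by (simp add: c'_def)
    then show ?thesis by blast
  qed
  define N where "N = (\<lambda>i. LEAST N. \<exists>c. rel i N c)"
  have "\<exists>c. rel i (N i) c" for i unfolding N_def using ex[of i] by (rule LeastI_ex)
  then obtain c where c: "\<And>i. rel i (N i) (c i)" by metis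
  have minimal: "\<not> rel i M c'" if "M < N i" for i M c'
    using that not_less_Least unfolding N_def by blast
  \<comment> \<open>The derivative of the minimal relation for \<open>Z\<^sub>i\<close> with respect to its unknown, at \<open>Z\<^sub>i\<close>.\<close>
  define E where "E = (\<lambda>i. \<Sum>j<N i. of_nat (Suc j) * c i (Suc j) * mfps_var i ^ j)"
  have Npos: "N i \<noteq> 0" for i
  proof
    assume "N i = 0"
    with c[of i] show False unfolding rel_def by simp blast
  qed
  have E0: "E i \<noteq> 0" for i
  proof
    assume "E i = 0"
    define M where "M = N i - 1"
    have M: "N i = Suc M" using Npos[of i] by (simp add: M_def)
    define c' where "c' = (\<lambda>j. of_nat (Suc j) * c i (Suc j))"
    have "of_nat k * x \<in> range pb" if "x \<in> range pb" for k :: nat and x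
    proof -
      have "of_nat k * pb f = pb (of_nat k * f)" for f
        by (simp add: pb_def mfps_scale_of_nat mfps_compose_scale)
      then show ?thesis using that by auto
    qed
    then have "range c' \<subseteq> range pb" using c[of i] unfolding rel_def c'_def by blast
    moreover have "c' M \<noteq> 0"
    proof -
      have "c i (Suc M) \<noteq> 0" using c[of i] by (simp add: rel_def M)
      then obtain m where m: "mcoeff (c i (Suc M)) m \<noteq> 0" by (metis mfps_eqI zero_mfps.rep_eq)
      have "mcoeff (c' M) m = of_nat (Suc M) * mcoeff (c i (Suc M)) m"
        by (simp only: c'_def mfps_scale_of_nat mfps_scale.rep_eq)
      with m have "mcoeff (c' M) m \<noteq> 0" by (simp del: of_nat_Suc)
      then show ?thesis by auto
    qed
    moreover have "(\<Sum>j\<le>M. c' j * mfps_var i ^ j) = 0"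
      using \<open>E i = 0\<close> by (simp add: E_def c'_def M lessThan_Suc_atMost)
    ultimately have "rel i M c'" by (simp add: rel_def)
    then show False using minimal[of M i c'] M by simp
  qed
  have "\<exists>f. c i j = pb f" for i j using c[of i] unfolding rel_def by blast
  then obtain f where f: "\<And>i j. c i j = pb (f i j)" by metis
  define M where "M = (\<chi> i l. \<Sum>j\<le>N i. pb (mfps_deriv l (f i j)) * mfps_var i ^ j)"
  have "(M ** (\<chi> l k. mfps_deriv k (H $ l))) $ i $ k = (if i = k then - E i else 0)" for i k
  proof -
    have "0 = mfps_deriv k (\<Sum>j\<le>N i. c i j * mfps_var i ^ j)"
      using c[of i] by (simp add: rel_def)
    also have "\<dots> = (\<Sum>j\<le>N i. mfps_deriv k (c i j) * mfps_var i ^ j)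
        + (\<Sum>j\<le>N i. c i j * mfps_deriv k (mfps_var i ^ j))"
      by (simp add: mfps_deriv_mult sum.distrib)
    also have "(\<Sum>j\<le>N i. mfps_deriv k (c i j) * mfps_var i ^ j)
        = (\<Sum>l\<in>UNIV. (\<Sum>j\<le>N i. pb (mfps_deriv l (f i j)) * mfps_var i ^ j) * mfps_deriv k (H $ l))"
      unfolding f unfolding pb_def mfps_deriv_compose[of "\<lambda>l. H $ l", OF H1] sum_distrib_right
      by (subst sum.swap) (simp only: mult_ac)
    also have "(\<Sum>j\<le>N i. c i j * mfps_deriv k (mfps_var i ^ j))
        = (\<Sum>j<N i. c i (Suc j) * mfps_deriv k (mfps_var i ^ Suc j))"
      by (subst lessThan_Suc_atMost[symmetric], subst sum.lessThan_Suc_shift) simp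
    also have "\<dots> = (if i = k then E i else 0)"
    proof (cases "i = k")
      case True
      then have "c i (Suc j) * mfps_deriv k (mfps_var i ^ Suc j)
          = of_nat (Suc j) * c i (Suc j) * mfps_var i ^ j" for j
        unfolding mfps_deriv_power_Suc by (simp add: mfps_deriv_var del: of_nat_Suc)
      with True show ?thesis by (simp only: E_def if_True simp_thms)
    next
      case False
      then have "c i (Suc j) * mfps_deriv k (mfps_var i ^ Suc j) = 0" for j
        unfolding mfps_deriv_power_Suc by (simp add: mfps_deriv_var del: of_nat_Suc)
      with False show ?thesis by (simp only: if_False simp_thms sum.neutral_const)
    qed
    finally have "0 = (M ** (\<chi> l k. mfps_deriv k (H $ l))) $ i $ k + (if i = k then E i else 0)"
      by (simp only: M_def matrix_matrix_mult_def vec_lambda_beta)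
    then show ?thesis by (cases "i = k") (simp_all add: eq_neg_iff_add_eq_0)
  qed
  then have "det (M ** (\<chi> l k. mfps_deriv k (H $ l))) = (\<Prod>i\<in>UNIV. - E i)"
    by (subst det_diagonal) auto
  also have "\<dots> \<noteq> 0" using E0 by simp
  finally show ?thesis by (auto simp: det_mul)
qed

section \<open>Determinants over power series rings\<close>

lemma det_cong_ideal:
  fixes A B :: "('v::finite, 'a::comm_ring_1) mfps ^ 'n::finite ^ 'n"
  assumes I: "mfps_ideal.subspace I" and AB: "\<And>i j. A $ i $ j - B $ i $ j \<in> I"
  shows "det A - det B \<in> I"
proof -
  have prod: "(\<Prod>x\<in>S. A $ x $ p x) - (\<Prod>x\<in>S. B $ x $ p x) \<in> I" for S and p :: "'n \<Rightarrow> 'n"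
  proof (induction S rule: infinite_finite_induct)
    case (insert x S)
    let ?a = "\<Prod>x\<in>S. A $ x $ p x" and ?b = "\<Prod>x\<in>S. B $ x $ p x"
    have eq: "a * u - b * w = u * (a - b) + b * (u - w)" for a b u w :: "('v, 'a) mfps"
      by (simp only: left_diff_distrib right_diff_distrib mult.commute) simp
    have "A $ x $ p x * ?a - B $ x $ p x * ?b \<in> I"
      unfolding eq by (intro mfps_ideal.subspace_add[OF I] mfps_ideal.subspace_scale[OF I] AB insert.IH)
    then show ?case using insert.hyps by simp
  qed (use mfps_ideal.subspace_0[OF I] in auto)
  have "det A - det B = (\<Sum>p | p permutes UNIV.
      of_int (sign p) * ((\<Prod>x\<in>UNIV. A $ x $ p x) - (\<Prod>x\<in>UNIV. B $ x $ p x)))"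
    by (simp only: det_def right_diff_distrib sum_subtractf)
  also have "\<dots> \<in> I"
    by (intro mfps_ideal.subspace_sum[OF I] mfps_ideal.subspace_scale[OF I] prod)
  finally show ?thesis .
qed

lemma det_hom:
  fixes h :: "'a::comm_ring_1 \<Rightarrow> 'b::comm_ring_1" and A :: "'a ^ 'n::finite ^ 'n"
  assumes add: "\<And>x y. h (x + y) = h x + h y" and mult: "\<And>x y. h (x * y) = h x * h y" and one: "h 1 = 1"
  shows "h (det A) = det (\<chi> i j. h (A $ i $ j))"
proof -
  have zero: "h 0 = 0" using add[of 0 0] by (metis add_0 add_left_imp_eq add.right_neutral)
  have m1: "h (- 1) = - 1" using add[of 1 "- 1"] by (simp add: zero one eq_neg_iff_add_eq_0 add.commute)
  have sgn: "h (of_int (sign p)) = of_int (sign p)" for p :: "'n \<Rightarrow> 'n"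
    by (cases p rule: sign_cases) (simp_all add: one m1)
  have prod: "h (prod f S) = (\<Prod>x\<in>S. h (f x))" for f :: "'n \<Rightarrow> 'a" and S
    by (induction S rule: infinite_finite_induct) (auto simp: one mult)
  have sum: "h (sum f S) = (\<Sum>x\<in>S. h (f x))" for f :: "('n \<Rightarrow> 'n) \<Rightarrow> 'a" and S
    by (induction S rule: infinite_finite_induct) (auto simp: zero add)
  show ?thesis unfolding det_def sum mult sgn prod by simp
qed

text \<open>Cramer's rule, modulo an ideal.\<close>

lemma det_mult_component_in_ideal:
  fixes A :: "('v::finite, 'a::comm_ring_1) mfps ^ 'n::finite ^ 'n"
  assumes I: "mfps_ideal.subspace I" and Ax: "\<And>r. (A *v x) $ r \<in> I"
  shows "det A * x $ k \<in> I"
proof -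
  define T where "T = transpose A"
  define M where "M = (\<lambda>v. \<chi> i. if i = k then v else row i T)"
  have "det (M (\<Sum>j\<in>UNIV. x $ j *s row j T)) = (\<Sum>j\<in>UNIV. det (M (x $ j *s row j T)))"
    unfolding M_def by (rule det_linear_row_sum) simp
  also have "\<dots> = (\<Sum>j\<in>UNIV. x $ j * det (M (row j T)))"
    unfolding M_def by (simp add: det_row_mul)
  also have "\<dots> = (\<Sum>j\<in>UNIV. if j = k then x $ k * det T else 0)"
  proof (intro sum.cong refl)
    fix j
    show "x $ j * det (M (row j T)) = (if j = k then x $ k * det T else 0)"
    proof (cases "j = k")
      case True
      have "M (row k T) = T" by (simp add: M_def vec_eq_iff row_def)
      with True show ?thesis by simp
    next
      case False
      have "det (M (row j T)) = 0"
        by (rule det_identical_rows[OF False]) (use False in \<open>simp add: M_def row_def vec_eq_iff\<close>)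
      with False show ?thesis by simp
    qed
  qed
  also have "\<dots> = det A * x $ k" by (simp add: T_def det_transpose mult.commute)
  finally have eq: "det A * x $ k = det (M (\<Sum>j\<in>UNIV. x $ j *s row j T))" by (rule sym)
  have comb: "(\<Sum>j\<in>UNIV. x $ j *s row j T) $ r = (A *v x) $ r" for r
    by (simp add: matrix_vector_mult_def T_def row_def transpose_def mult.commute)
  have "det (M (\<Sum>j\<in>UNIV. x $ j *s row j T)) - det (M 0) \<in> I"
  proof (rule det_cong_ideal[OF I])
    fix i j
    show "M (\<Sum>j\<in>UNIV. x $ j *s row j T) $ i $ j - M 0 $ i $ j \<in> I"
      using Ax[of j] mfps_ideal.subspace_0[OF I] by (cases "i = k") (simp_all add: M_def comb[simplified])
  qed
  moreover have "det (M 0) = 0" unfolding M_def by (rule det_row_0)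
  ultimately show ?thesis by (simp add: eq)
qed

section \<open>Vector fields\<close>

lemma derivation_vf_apply: "derivation (vf_apply X)"
proof -
  have "X $ k * mfps_deriv k (f * g) = X $ k * mfps_deriv k f * g + f * (X $ k * mfps_deriv k g)"
    for k f g by (simp only: mfps_deriv_mult distrib_left mult_ac)
  then show ?thesis
    unfolding derivation_def vf_apply_def
    by (simp only: mfps_deriv_add distrib_left sum.distrib sum_distrib_left sum_distrib_right simp_thms)
qed

lemmas vf_apply_add = derivation_vf_apply[unfolded derivation_def, THEN conjunct1, rule_format]
  and vf_apply_mult = derivation_vf_apply[unfolded derivation_def, THEN conjunct2, rule_format]

lemma vf_apply_0: "vf_apply X 0 = 0"
  by (simp add: vf_apply_def)

lemma vf_apply_scale: "vf_apply X (mfps_scale c f) = mfps_scale c (vf_apply X f)"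
  by (simp add: vf_apply_def mfps_scale_sum mfps_scale_mult_right)

lemma vf_apply_sum: "vf_apply X (sum f A) = (\<Sum>x\<in>A. vf_apply X (f x))"
  by (induction A rule: infinite_finite_induct) (auto simp: vf_apply_add vf_apply_0)

lemma vf_apply_preserves_ideal:
  assumes "\<And>s. s \<in> S \<Longrightarrow> vf_apply X s \<in> mfps_ideal.span S" and "f \<in> mfps_ideal.span S"
  shows "vf_apply X f \<in> mfps_ideal.span S"
  using assms(2)
proof (induction rule: mfps_ideal.span_induct_alt)
  case (step c x y)
  have "vf_apply X (c * x + y) = vf_apply X c * x + (c * vf_apply X x + vf_apply X y)"
    by (simp add: vf_apply_add vf_apply_mult)
  also have "\<dots> \<in> mfps_ideal.span S"
    by (intro mfps_ideal.span_add mfps_ideal.span_scale step.IH assms(1) mfps_ideal.span_base step.hyps)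
  finally show ?case .
qed (simp add: vf_apply_0 mfps_ideal.span_zero)

lemma vf_tangent_preserves_ideal:
  assumes "vf_tangent d \<rho> X" "f \<in> mfps_ideal.span (\<rho> ` {..<d})"
  shows "vf_apply X f \<in> mfps_ideal.span (\<rho> ` {..<d})"
  by (rule vf_apply_preserves_ideal) (use assms in \<open>auto simp: vf_tangent_def\<close>)

lemma vf_apply_bracket:
  "vf_apply (vf_bracket X Y) f = vf_apply X (vf_apply Y f) - vf_apply Y (vf_apply X f)"
proof -
  have snd_order: "vf_apply X (vf_apply Y f)
      = (\<Sum>k\<in>UNIV. vf_apply X (Y $ k) * mfps_deriv k f)
        + (\<Sum>k\<in>UNIV. \<Sum>j\<in>UNIV. Y $ k * (X $ j * mfps_deriv j (mfps_deriv k f)))" for X Y :: "'a vfield"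
  proof -
    have "vf_apply X (vf_apply Y f) = (\<Sum>k\<in>UNIV. vf_apply X (Y $ k * mfps_deriv k f))"
      unfolding vf_apply_def[of Y] by (rule vf_apply_sum)
    also have "\<dots> = (\<Sum>k\<in>UNIV. vf_apply X (Y $ k) * mfps_deriv k f)
        + (\<Sum>k\<in>UNIV. Y $ k * vf_apply X (mfps_deriv k f))"
      by (simp only: vf_apply_mult sum.distrib)
    finally show ?thesis unfolding vf_apply_def[of X "mfps_deriv _ f"] sum_distrib_left .
  qed
  have swap: "(\<Sum>k\<in>UNIV. \<Sum>j\<in>UNIV. Y $ k * (X $ j * mfps_deriv j (mfps_deriv k f)))
      = (\<Sum>k\<in>UNIV. \<Sum>j\<in>UNIV. X $ k * (Y $ j * mfps_deriv j (mfps_deriv k f)))"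
    by (subst sum.swap) (simp only: mfps_deriv_commute mult.left_commute)
  have "vf_apply (vf_bracket X Y) f = (\<Sum>k\<in>UNIV. vf_apply X (Y $ k) * mfps_deriv k f)
      - (\<Sum>k\<in>UNIV. vf_apply Y (X $ k) * mfps_deriv k f)"
    by (subst vf_apply_def)
      (simp only: vf_bracket_def vec_lambda_beta left_diff_distrib sum_subtractf)
  then show ?thesis unfolding snd_order swap by simp
qed

lemma lie_alg_preserves_ideal:
  assumes P: "mfps_ideal.subspace P"
    and gen: "\<And>X. vf_10 X \<or> vf_01 X \<Longrightarrow> vf_tangent d \<rho> X \<Longrightarrow> vf_apply X ` P \<subseteq> P"
    and "X \<in> lie_alg d \<rho>"
  shows "f \<in> P \<Longrightarrow> vf_apply X f \<in> P"
  using assms(3)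
proof (induction arbitrary: f rule: lie_alg.induct)
  case (gen_10 X)
  then show ?case using gen[of X] by auto
next
  case (gen_01 X)
  then show ?case using gen[of X] by auto
next
  case (add X Y)
  have "vf_apply (X + Y) f = vf_apply X f + vf_apply Y f"
    by (simp add: vf_apply_def distrib_right sum.distrib)
  then show ?case using add by (simp add: mfps_ideal.subspace_add[OF P])
next
  case (scale X c)
  have "vf_apply (vf_scale c X) f = mfps_scale c 1 * vf_apply X f"
    by (simp add: vf_apply_def vf_scale_def mfps_scale_sum flip: mfps_scale_mult_left)
  then show ?case using scale by (simp add: mfps_ideal.subspace_scale[OF P])
next
  case (bracket X Y)
  then show ?case by (simp add: vf_apply_bracket mfps_ideal.subspace_diff[OF P])
qed

lemma mcoeff_mult_lowest:
  assumes "ord_ge (mdeg a) h"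
  shows "mcoeff (g * h) a = mfps_const_coeff g * mcoeff h a"
proof -
  have "mcoeff (g * h) a = (\<Sum>p | fst p + snd p = a. mcoeff g (fst p) * mcoeff h (snd p))"
    by (simp add: times_mfps.rep_eq case_prod_unfold)
  also have "\<dots> = (\<Sum>p\<in>{(0, a)}. mcoeff g (fst p) * mcoeff h (snd p))"
  proof (rule sum.mono_neutral_right)
    show "finite {p. fst p + snd p = a}"
      using finite_multi_index_splits[of a] by (simp add: case_prod_unfold)
    show "\<forall>p\<in>{p. fst p + snd p = a} - {(0, a)}. mcoeff g (fst p) * mcoeff h (snd p) = 0"
    proof
      fix p assume p: "p \<in> {p. fst p + snd p = a} - {(0, a)}"
      then have "fst p \<noteq> 0" by (cases p) auto
      then have "0 < mdeg (fst p)" by (metis mdeg_eq_0_iff neq0_conv)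
      moreover have "mdeg (fst p) + mdeg (snd p) = mdeg a" using p mdeg_add by fastforce
      ultimately have "mcoeff h (snd p) = 0" using assms by (intro ord_geD) auto
      then show "mcoeff g (fst p) * mcoeff h (snd p) = 0" by simp
    qed
  qed auto
  finally show ?thesis by (simp add: mfps_const_coeff_def)
qed

text \<open>
  By finite type, the values at the origin of the vector fields in the Lie algebra can be prescribed.
  Hence some such field differentiates an element of minimal order, written in the free variables
  \<open>V\<close>, to one of smaller order, and a proper invariant ideal cannot be larger than the ideal of \<open>\<rho>\<close>.
\<close>

lemma finite_type_invariant_ideal:
  fixes \<rho> :: "'n::finite defining"
  assumes ft: "finite_type d \<rho>"
    and G: "\<And>k. ord_ge 1 (G k)" "\<And>k. mfps_compose (G k) G = G k"
      "\<And>f. mfps_compose f G = 0 \<longleftrightarrow> f \<in> mfps_ideal.span (\<rho> ` {..<d})"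
      "\<And>j k. j \<notin> V \<Longrightarrow> mfps_deriv j (G k) = 0"
      "\<And>f. \<forall>j. j \<notin> V \<longrightarrow> mfps_deriv j f = 0 \<Longrightarrow> mfps_compose f G = f"
      "\<And>v0. v0 \<in> V \<Longrightarrow> \<exists>t\<in>complex_tangent_space d \<rho>. \<forall>v\<in>V. t $ v = (if v = v0 then 1 else 0)"
    and P: "mfps_ideal.subspace P" "mfps_ideal.span (\<rho> ` {..<d}) \<subseteq> P" "1 \<notin> P"
    and inv: "\<And>X f. X \<in> lie_alg d \<rho> \<Longrightarrow> f \<in> P \<Longrightarrow> vf_apply X f \<in> P"
    and p: "p \<in> P"
  shows "mfps_compose p G = 0"
proof (rule ccontr)
  assume p0: "mfps_compose p G \<noteq> 0"
  define \<theta> where "\<theta> = (\<lambda>f. mfps_compose f G)"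
  have \<theta>\<theta>: "\<theta> (\<theta> f) = \<theta> f" for f
    unfolding \<theta>_def by (subst mfps_compose_assoc[OF G(1) G(1)]) (simp only: G(2))
  have \<theta>P: "\<theta> f \<in> P" if "f \<in> P" for f
  proof -
    have "\<theta> (f - \<theta> f) = 0" using \<theta>\<theta>[of f] by (simp add: \<theta>_def mfps_compose_diff)
    then have "f - \<theta> f \<in> P" using G(3) P(2) unfolding \<theta>_def by auto
    from mfps_ideal.subspace_diff[OF P(1) that this] show ?thesis by simp
  qed
  have \<theta>_deriv: "mfps_deriv j (\<theta> f) = 0" if "j \<notin> V" for j f
    unfolding \<theta>_def by (simp add: mfps_deriv_compose[OF G(1)] G(4)[OF that])
  \<comment> \<open>The degrees of monomials in elements of \<open>P\<close> that depend on the variables in \<open>V\<close> only.\<close>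
  define D where "D = {k. \<exists>q m. q \<in> P \<and> \<theta> q = q \<and> mcoeff q m \<noteq> 0 \<and> mdeg m = k}"
  have "D \<noteq> {}"
  proof -
    obtain m where "mcoeff (\<theta> p) m \<noteq> 0"
      using p0 unfolding \<theta>_def by (metis mfps_eqI zero_mfps.rep_eq)
    then have "mdeg m \<in> D" using \<theta>P[OF p] \<theta>\<theta>[of p] unfolding D_def by blast
    then show ?thesis by blast
  qed
  then obtain k0 where k0: "k0 \<in> D" "\<And>k. k \<in> D \<Longrightarrow> k0 \<le> k"
    using exists_least_iff[of "\<lambda>k. k \<in> D"] by (metis ex_in_conv linorder_not_less)
  from k0(1) obtain q m where q: "q \<in> P" "\<theta> q = q" "mcoeff q m \<noteq> 0" "mdeg m = k0"
    unfolding D_def by blast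
  have ordq: "ord_ge k0 q"
    unfolding ord_ge_def
  proof (intro allI impI)
    fix m' :: "nat ^ ('n + 'n)"
    assume lt: "mdeg m' < k0"
    show "mcoeff q m' = 0"
    proof (rule ccontr)
      assume "mcoeff q m' \<noteq> 0"
      with q have "mdeg m' \<in> D" unfolding D_def by blast
      from k0(2)[OF this] lt show False by simp
    qed
  qed
  have "k0 \<noteq> 0"
  proof
    assume "k0 = 0"
    with q(3,4) have "mfps_const_coeff q \<noteq> 0" by (simp add: mfps_const_coeff_def)
    from mfps_unit[OF this] obtain g where "q * g = 1" ..
    then have "1 \<in> P" using mfps_ideal.subspace_scale[OF P(1) q(1), of g] by (simp add: mult.commute)
    with P(3) show False ..
  qed
  then obtain v0 where v0: "m $ v0 \<noteq> 0"
    using q(4) by (metis mdeg_eq_0_iff vec_eq_iff zero_index)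
  have qV: "mfps_deriv j q = 0" if "j \<notin> V" for j using \<theta>_deriv[OF that, of q] q(2) by simp
  have v0V: "v0 \<in> V"
  proof (rule ccontr)
    assume "v0 \<notin> V"
    from mcoeff_eq_0_if_deriv_0[OF qV[OF this] v0] q(3) show False by simp
  qed
  obtain t where t: "t \<in> complex_tangent_space d \<rho>" "\<forall>v\<in>V. t $ v = (if v = v0 then 1 else 0)"
    using G(6)[OF v0V] by (elim bexE)
  then obtain X where X: "X \<in> lie_alg d \<rho>" "vec_at_0 X = t"
    using ft unfolding finite_type_def by (metis imageE)
  have X0: "mfps_const_coeff (X $ k) = t $ k" for k using X(2) by (auto simp: vec_at_0_def)
  have m: "m - axis v0 1 + axis v0 1 = m" using v0 by (auto simp: vec_eq_iff axis_def)
  define a where "a = m - axis v0 1"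
  have deg: "k0 = mdeg a + 1" using q(4) m unfolding a_def by (metis mdeg_add mdeg_axis)
  have "\<theta> (vf_apply X q) = (\<Sum>k\<in>UNIV. \<theta> (X $ k) * mfps_deriv k q)"
  proof -
    have "\<theta> (mfps_deriv k q) = mfps_deriv k q" for k
      unfolding \<theta>_def
    proof (rule G(5), intro allI impI)
      fix j assume "j \<notin> V"
      show "mfps_deriv j (mfps_deriv k q) = 0"
        by (subst mfps_deriv_commute) (simp add: qV[OF \<open>j \<notin> V\<close>])
    qed
    then show ?thesis
      by (simp add: vf_apply_def \<theta>_def mfps_compose_sum mfps_compose_mult[OF G(1)])
  qed
  then have "mcoeff (\<theta> (vf_apply X q)) a = (\<Sum>k\<in>UNIV. mcoeff (\<theta> (X $ k) * mfps_deriv k q) a)"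
    by simp
  also have "\<dots> = (\<Sum>k\<in>UNIV. t $ k * mcoeff (mfps_deriv k q) a)"
  proof (intro sum.cong refl)
    fix k
    have "ord_ge (mdeg a) (mfps_deriv k q)" using ordq unfolding deg by (rule ord_ge_deriv)
    from mcoeff_mult_lowest[OF this]
    show "mcoeff (\<theta> (X $ k) * mfps_deriv k q) a = t $ k * mcoeff (mfps_deriv k q) a"
      by (simp add: \<theta>_def X0)
  qed
  also have "\<dots> = (\<Sum>k\<in>UNIV. if k = v0 then mcoeff (mfps_deriv v0 q) a else 0)"
  proof (intro sum.cong refl)
    fix k
    show "t $ k * mcoeff (mfps_deriv k q) a = (if k = v0 then mcoeff (mfps_deriv v0 q) a else 0)"
      using t(2) qV v0V by (cases "k \<in> V") auto
  qed
  also have "\<dots> = of_nat (Suc (a $ v0)) * mcoeff q m"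
    by (simp add: mfps_deriv.rep_eq a_def m[simplified])
  finally have "mcoeff (\<theta> (vf_apply X q)) a \<noteq> 0" using q(3) by (simp del: of_nat_Suc)
  moreover have "\<theta> (vf_apply X q) \<in> P" by (intro \<theta>P inv X q)
  ultimately have "mdeg a \<in> D" using \<theta>\<theta>[of "vf_apply X q"] unfolding D_def by blast
  from k0(2)[OF this] deg show False by simp
qed

section \<open>Linear independence of gradients\<close>

lemma lin_indep_family_iff:
  "lin_indep_family d u \<longleftrightarrow> (\<forall>a. (\<Sum>i<d. a i *s u i) = 0 \<longrightarrow> (\<forall>i<d. a i = 0))"
proof
  assume u: "lin_indep_family d u"
  then have inj: "inj_on u {..<d}" and ind: "vec.independent (u ` {..<d})"
    by (auto simp: lin_indep_family_def)
  show "\<forall>a. (\<Sum>i<d. a i *s u i) = 0 \<longrightarrow> (\<forall>i<d. a i = 0)"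
  proof (intro allI impI)
    fix a i assume a: "(\<Sum>i<d. a i *s u i) = 0" and i: "i < d"
    have inv: "the_inv_into {..<d} u (u j) = j" if "j < d" for j
      using inj that by (simp add: the_inv_into_f_f)
    have "(\<Sum>v\<in>u ` {..<d}. a (the_inv_into {..<d} u v) *s v) = (\<Sum>i<d. a i *s u i)"
      by (subst sum.reindex[OF inj]) (simp add: inv)
    with a have 0: "(\<Sum>v\<in>u ` {..<d}. a (the_inv_into {..<d} u v) *s v) = 0" by simp
    have "a (the_inv_into {..<d} u (u i)) = 0"
      by (rule vec.independentD[OF ind _ order_refl 0]) (use i in auto)
    then show "a i = 0" by (simp add: inv[OF i])
  qed
next
  assume *: "\<forall>a. (\<Sum>i<d. a i *s u i) = 0 \<longrightarrow> (\<forall>i<d. a i = 0)"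
  have inj: "inj_on u {..<d}"
  proof (rule inj_onI, rule ccontr)
    fix i j assume ij: "i \<in> {..<d}" "j \<in> {..<d}" "u i = u j" "i \<noteq> j"
    define a :: "nat \<Rightarrow> complex" where "a = (\<lambda>k. if k = i then 1 else if k = j then - 1 else 0)"
    have "(\<Sum>k<d. a k *s u k) = (\<Sum>k\<in>{i, j}. a k *s u k)"
      using ij by (intro sum.mono_neutral_right) (auto simp: a_def)
    also have "\<dots> = 0" using ij by (simp add: a_def vec_eq_iff)
    finally have "a i = 0" using * ij(1) by simp
    then show False by (simp add: a_def)
  qed
  have "vec.independent (u ` {..<d})"
  proof (rule vec.independent_if_scalars_zero)
    fix f x assume f: "(\<Sum>x\<in>u ` {..<d}. f x *s x) = 0" and x: "x \<in> u ` {..<d}"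
    have "(\<Sum>i<d. f (u i) *s u i) = 0" using f by (subst (asm) sum.reindex[OF inj]) simp
    then have "\<forall>i<d. f (u i) = 0" by (rule *[THEN spec[of _ "\<lambda>i. f (u i)"], THEN mp])
    with x show "f x = 0" by auto
  qed simp
  with inj show "lin_indep_family d u" by (simp add: lin_indep_family_def)
qed

lemma lin_indep_family_cnj:
  fixes u :: "nat \<Rightarrow> complex ^ 'n::finite"
  assumes "lin_indep_family d u"
  shows "lin_indep_family d (\<lambda>i. \<chi> l. cnj (u i $ l))"
  unfolding lin_indep_family_iff
proof (intro allI impI)
  fix a i assume a: "(\<Sum>i<d. a i *s (\<chi> l. cnj (u i $ l))) = 0" and i: "i < d"
  have "(\<Sum>i<d. cnj (a i) *s u i) = 0"
  proof (rule vec_eq_iff[THEN iffD2], rule allI)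
    fix l
    have "(\<Sum>i<d. a i * cnj (u i $ l)) = 0"
      using arg_cong[OF a, of "\<lambda>v. v $ l"] by simp
    then have "cnj (\<Sum>i<d. a i * cnj (u i $ l)) = 0" by simp
    then show "(\<Sum>i<d. cnj (a i) *s u i) $ l = 0 $ l" by simp
  qed
  then have "cnj (a i) = 0"
    using assms[unfolded lin_indep_family_iff, rule_format, of "\<lambda>i. cnj (a i)", OF _ i] by simp
  then show "a i = 0" by simp
qed

lemma mfps_cnj_simps: "mfps_cnj (f + g) = mfps_cnj f + mfps_cnj g"
  "mfps_cnj (f * g) = mfps_cnj f * mfps_cnj g" "mfps_cnj 1 = 1"
  "mfps_deriv i (mfps_cnj f) = mfps_cnj (mfps_deriv i f)"
  "mfps_const_coeff (mfps_cnj f) = cnj (mfps_const_coeff f)"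
  "mfps_cnj f = 0 \<Longrightarrow> f = 0"
proof -
  assume 0: "mfps_cnj f = 0"
  show "f = 0"
  proof (rule mfps_eqI)
    fix m
    have "cnj (mcoeff f m) = 0" using arg_cong[OF 0, of "\<lambda>f. mcoeff f m"] by (simp add: mfps_cnj.rep_eq)
    then show "mcoeff f m = mcoeff 0 m" by simp
  qed
qed (auto intro!: mfps_eqI simp: mfps_cnj.rep_eq times_mfps.rep_eq one_mfps.rep_eq
    mfps_deriv.rep_eq mfps_const_coeff_def case_prod_unfold)

text \<open>By the reality condition, the gradients with respect to the two groups of variables are
  conjugate to each other at the origin.\<close>

lemma generic_gradients:
  fixes \<rho> :: "'n::finite defining"
  assumes "formal_generic d \<rho>"
  shows "lin_indep_family d (\<lambda>i. vec_at_0 (\<chi> l. mfps_deriv (Inl l) (\<rho> i)))"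
    and "lin_indep_family d (\<lambda>i. vec_at_0 (\<chi> l. mfps_deriv (Inr l) (\<rho> i)))"
proof -
  have real: "\<rho> i = mfps_compose (mfps_cnj (\<rho> i)) swap_vars" if "i < d" for i
    using assms that by (simp add: formal_generic_def)
  show Inl: "lin_indep_family d (\<lambda>i. vec_at_0 (\<chi> l. mfps_deriv (Inl l) (\<rho> i)))"
    using assms by (simp add: formal_generic_def Z_gradient_def)
  have swap1: "ord_ge 1 (swap_vars k)" for k :: "'n + 'n"
    unfolding swap_vars_def by simp
  have grad: "mfps_const_coeff (mfps_deriv (Inr l) (\<rho> i)) = cnj (mfps_const_coeff (mfps_deriv (Inl l) (\<rho> i)))"
    if "i < d" for i l
  proof -
    have "mfps_deriv (Inr l) (\<rho> i) = (\<Sum>k\<in>UNIV. mfps_compose (mfps_deriv k (mfps_cnj (\<rho> i))) swap_vars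
        * mfps_deriv (Inr l) (swap_vars k))"
      by (subst real[OF that]) (rule mfps_deriv_compose[OF swap1])
    also have "\<dots> = (\<Sum>k\<in>(UNIV :: ('n + 'n) set). if k = Inl l then mfps_compose (mfps_deriv (Inl l) (mfps_cnj (\<rho> i))) swap_vars else 0)"
    proof (rule sum.cong[OF refl])
      fix k :: "'n + 'n"
      show "mfps_compose (mfps_deriv k (mfps_cnj (\<rho> i))) swap_vars * mfps_deriv (Inr l) (swap_vars k)
          = (if k = Inl l then mfps_compose (mfps_deriv (Inl l) (mfps_cnj (\<rho> i))) swap_vars else 0)"
        by (cases k) (auto simp: swap_vars_def mfps_deriv_var)
    qed
    also have "\<dots> = mfps_compose (mfps_cnj (mfps_deriv (Inl l) (\<rho> i))) swap_vars"
      by (simp add: mfps_cnj_simps)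
    finally show ?thesis by (simp add: mfps_cnj_simps)
  qed
  have "lin_indep_family d (\<lambda>i. vec_at_0 (\<chi> l. mfps_deriv (Inr l) (\<rho> i)))
      \<longleftrightarrow> lin_indep_family d (\<lambda>i. \<chi> l. cnj (vec_at_0 (\<chi> l. mfps_deriv (Inl l) (\<rho> i)) $ l))"
    unfolding lin_indep_family_iff by (simp add: vec_at_0_def grad)
  with lin_indep_family_cnj[OF Inl]
  show "lin_indep_family d (\<lambda>i. vec_at_0 (\<chi> l. mfps_deriv (Inr l) (\<rho> i)))" by simp
qed

lemma lin_indep_family_extend:
  fixes u :: "nat \<Rightarrow> complex ^ 'n::finite"
  assumes u: "lin_indep_family d u" and ix: "bij_betw ix UNIV {..<CARD('n)}"
  obtains U :: "complex ^ 'n ^ 'n" where "det U \<noteq> 0" "\<And>r. ix r < d \<Longrightarrow> U $ r = u (ix r)"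
    "d \<le> CARD('n)"
proof -
  obtain W :: "'n set" where W: "card (- W) = d"
    "\<And>t. (\<And>i. i < d \<Longrightarrow> (\<Sum>l\<in>UNIV. u i $ l * t l) = 0) \<Longrightarrow> (\<And>l. l \<in> W \<Longrightarrow> t l = 0) \<Longrightarrow> t = (\<lambda>_. 0)"
    using complementary_coordinates[OF u] by blast
  have dN: "d \<le> CARD('n)" using W(1) card_mono[of UNIV "- W"] by simp
  have bij: "bij_betw ix {r. ix r < d} {..<d}"
    unfolding bij_betw_def
  proof
    show "inj_on ix {r. ix r < d}" using ix by (auto simp: bij_betw_def intro: inj_on_subset)
    have "range ix = {..<CARD('n)}" using ix by (simp add: bij_betw_def)
    then have "i \<in> range ix" if "i < d" for i using dN that by simp
    then show "ix ` {r. ix r < d} = {..<d}" by auto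
  qed
  have "card {r. \<not> ix r < d} = CARD('n) - d"
    using bij_betw_same_card[OF bij] card_Diff_subset[of "{r. ix r < d}" UNIV]
    by (simp add: set_diff_eq)
  moreover have "card W = CARD('n) - d"
    using W(1) card_Diff_subset[of "- W" UNIV] by (simp add: Diff_eq)
  ultimately obtain \<beta> where \<beta>: "bij_betw \<beta> {r. \<not> ix r < d} W"
    using finite_same_card_bij[of "{r. \<not> ix r < d}" W] by auto
  define U where "U = (\<chi> r. if ix r < d then u (ix r) else axis (\<beta> r) 1)"
  have "t = 0" if t: "U *v t = 0" for t
  proof -
    have row: "(\<Sum>l\<in>UNIV. U $ r $ l * t $ l) = 0" for r
      using arg_cong[OF t, of "\<lambda>v. v $ r"] by (simp add: matrix_vector_mult_def)
    have "(\<lambda>l. t $ l) = (\<lambda>_. 0)"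
    proof (rule W(2))
      fix i assume "i < d"
      then have "i \<in> ix ` {r. ix r < d}" using bij by (simp add: bij_betw_def)
      then obtain r where "ix r = i" by blast
      with row[of r] \<open>i < d\<close> show "(\<Sum>l\<in>UNIV. u i $ l * t $ l) = 0" by (simp add: U_def)
    next
      fix l assume "l \<in> W"
      then have "l \<in> \<beta> ` {r. \<not> ix r < d}" using \<beta> by (simp add: bij_betw_def)
      then obtain r where r: "\<not> ix r < d" "\<beta> r = l" by blast
      have "(\<Sum>k\<in>UNIV. U $ r $ k * t $ k) = (\<Sum>k\<in>UNIV. if k = l then t $ k else 0)"
        using r by (intro sum.cong) (auto simp: U_def axis_def)
      with row[of r] show "t $ l = 0" by simp
    qed
    then show ?thesis by (simp add: vec_eq_iff fun_eq_iff)
  qed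
  then have "invertible U"
    by (simp add: invertible_left_inverse matrix_left_invertible_ker)
  then have "det U \<noteq> 0" by (simp add: invertible_det_nz)
  then show thesis by (rule that[of U]) (simp_all add: U_def dN)
qed

section \<open>Transversality\<close>

text \<open>The \<open>d \<times> d\<close> matrix \<open>c\<close>, padded by an identity block; \<open>ix\<close> numbers the index type.\<close>

definition padded :: "('n::finite \<Rightarrow> nat) \<Rightarrow> nat \<Rightarrow> (nat \<Rightarrow> nat \<Rightarrow> 'a::comm_ring_1) \<Rightarrow> 'a ^ 'n ^ 'n" where
  "padded ix d c = (\<chi> r s. if ix r < d \<and> ix s < d then c (ix r) (ix s) else if r = s then 1 else 0)"

lemma padded_mult:
  fixes y :: "'n::finite \<Rightarrow> 'a::comm_ring_1"
  assumes ix: "bij_betw ix UNIV {..<CARD('n)}" and d: "d \<le> CARD('n)"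
    and y: "\<And>s. ix s < d \<Longrightarrow> y s = g (ix s)"
  shows "(\<Sum>s\<in>UNIV. padded ix d c $ r $ s * y s) = (if ix r < d then \<Sum>j<d. c (ix r) j * g j else y r)"
proof (cases "ix r < d")
  case True
  have bij: "bij_betw ix {s. ix s < d} {..<d}"
    unfolding bij_betw_def
  proof
    show "inj_on ix {r. ix r < d}" using ix by (auto simp: bij_betw_def intro: inj_on_subset)
    have "range ix = {..<CARD('n)}" using ix by (simp add: bij_betw_def)
    then have "i \<in> range ix" if "i < d" for i using d that by simp
    then show "ix ` {r. ix r < d} = {..<d}" by auto
  qed
  have "(\<Sum>s\<in>UNIV. padded ix d c $ r $ s * y s) = (\<Sum>s | ix s < d. padded ix d c $ r $ s * y s)"
    using True by (intro sum.mono_neutral_right) (auto simp: padded_def)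
  also have "\<dots> = (\<Sum>s | ix s < d. c (ix r) (ix s) * g (ix s))"
    using True y by (intro sum.cong) (auto simp: padded_def)
  also have "\<dots> = (\<Sum>j<d. c (ix r) j * g j)"
    by (rule sum.reindex_bij_betw[OF bij, of "\<lambda>j. c (ix r) j * g j"])
  finally show ?thesis using True by simp
next
  case False
  then have "(\<Sum>s\<in>UNIV. padded ix d c $ r $ s * y s) = (\<Sum>s\<in>UNIV. if s = r then y s else 0)"
    by (intro sum.cong) (auto simp: padded_def)
  with False show ?thesis by simp
qed

lemma deriv_compose_side:
  fixes F :: "'n::finite + 'n \<Rightarrow> ('n + 'n, complex) mfps" and e e' :: "'n \<Rightarrow> 'n + 'n"
  assumes e: "inj e" "range e' = - range e"
    and F: "\<And>k. ord_ge 1 (F k)" "\<And>k l. mfps_deriv (e k) (F (e' l)) = 0"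
  shows "mfps_deriv (e k) (mfps_compose f F)
    = (\<Sum>l\<in>UNIV. mfps_compose (mfps_deriv (e l) f) F * mfps_deriv (e k) (F (e l)))"
proof -
  have "mfps_deriv (e k) (mfps_compose f F)
      = (\<Sum>j\<in>UNIV. mfps_compose (mfps_deriv j f) F * mfps_deriv (e k) (F j))"
    by (rule mfps_deriv_compose[OF F(1)])
  also have "\<dots> = (\<Sum>j\<in>range e. mfps_compose (mfps_deriv j f) F * mfps_deriv (e k) (F j))"
  proof (rule sum.mono_neutral_right)
    show "\<forall>j\<in>UNIV - range e. mfps_compose (mfps_deriv j f) F * mfps_deriv (e k) (F j) = 0"
    proof
      fix j assume "j \<in> UNIV - range e"
      then have "j \<in> range e'" using e(2) by simp
      then show "mfps_compose (mfps_deriv j f) F * mfps_deriv (e k) (F j) = 0" using F(2) by auto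
    qed
  qed auto
  also have "\<dots> = (\<Sum>l\<in>UNIV. mfps_compose (mfps_deriv (e l) f) F * mfps_deriv (e k) (F (e l)))"
    by (subst sum.reindex[OF e(1)]) simp
  finally show ?thesis .
qed

lemma deriv_sum_mod_ideal:
  fixes \<rho> :: "nat \<Rightarrow> ('v::finite, 'a::comm_ring_1) mfps"
  shows "mfps_deriv k (\<Sum>j<d. c j * \<rho> j) - (\<Sum>j<d. c j * mfps_deriv k (\<rho> j))
    \<in> mfps_ideal.span (\<rho> ` {..<d})"
proof -
  have "mfps_deriv k (\<Sum>j<d. c j * \<rho> j) - (\<Sum>j<d. c j * mfps_deriv k (\<rho> j))
      = (\<Sum>j<d. mfps_deriv k (c j) * \<rho> j)"
    by (simp add: mfps_deriv_mult sum.distrib)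
  also have "\<dots> \<in> mfps_ideal.span (\<rho> ` {..<d})"
    by (intro mfps_ideal.span_sum mfps_ideal.span_scale mfps_ideal.span_base) simp
  finally show ?thesis .
qed

text \<open>
  Differentiate \<open>\<rho>' \<circ> F = c \<rho>\<close> in the variables of type \<open>e\<close> and complete the gradients of \<open>\<rho>'\<close> to an
  invertible matrix \<open>W\<close>: modulo the ideal of \<open>\<rho>\<close>, the product of \<open>W\<close> with the Jacobian matrix is \<open>c\<close>,
  padded, times some matrix.  Thus \<open>det c\<close> divides the Jacobian determinant on the submanifold.
\<close>

lemma det_divides_jacobian:
  fixes \<rho> \<rho>' :: "'n::finite defining" and F :: "'n + 'n \<Rightarrow> ('n + 'n, complex) mfps"
    and e e' :: "'n \<Rightarrow> 'n + 'n" and ix :: "'n \<Rightarrow> nat"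
  assumes e: "inj e" "range e' = - range e"
    and F: "\<And>k. ord_ge 1 (F k)" "\<And>k l. mfps_deriv (e k) (F (e' l)) = 0"
    and sends: "\<And>i. i < d \<Longrightarrow> mfps_compose (\<rho>' i) F = (\<Sum>j<d. c i j * \<rho> j)"
    and ind: "lin_indep_family d (\<lambda>i. vec_at_0 (\<chi> l. mfps_deriv (e l) (\<rho>' i)))"
    and ix: "bij_betw ix UNIV {..<CARD('n)}"
  shows "\<exists>q. det (\<chi> l k. mfps_deriv (e k) (F (e l))) - q * det (padded ix d c)
    \<in> mfps_ideal.span (\<rho> ` {..<d})"
proof -
  let ?R = "mfps_ideal.span (\<rho> ` {..<d})"
  note RI = mfps_ideal.subspace_span[of "\<rho> ` {..<d}"]
  define u where "u = (\<lambda>i. vec_at_0 (\<chi> l. mfps_deriv (e l) (\<rho>' i)))"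
  obtain U :: "complex ^ 'n ^ 'n" where U: "det U \<noteq> 0" "\<And>r. ix r < d \<Longrightarrow> U $ r = u (ix r)" "d \<le> CARD('n)"
    by (rule lin_indep_family_extend[OF ind[folded u_def] ix]) (rule that)
  define Dm where "Dm = (\<chi> l k. mfps_deriv (e k) (F (e l)))"
  define W where "W = (\<chi> r l. if ix r < d then mfps_compose (mfps_deriv (e l) (\<rho>' (ix r))) F
      else mfps_scale (U $ r $ l) 1)"
  have "mfps_const_coeff (det W) = det U"
  proof -
    have "mfps_const_coeff (W $ r $ l) = U $ r $ l" for r l
      by (cases "ix r < d") (simp_all add: W_def U(2) u_def vec_at_0_def)
    then have "(\<chi> r l. mfps_const_coeff (W $ r $ l)) = U" by (simp add: vec_eq_iff)
    with det_hom[of mfps_const_coeff W] show ?thesis by simp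
  qed
  with U(1) have "mfps_const_coeff (det W) \<noteq> 0" by simp
  from mfps_unit[OF this] obtain w where w: "det W * w = 1" ..
  \<comment> \<open>Modulo \<open>\<rho>\<close>, the matrix \<open>W ** Dm\<close> is \<open>padded ix d c ** Y\<close>.\<close>
  define Y where "Y = (\<chi> r k. if ix r < d then mfps_deriv (e k) (\<rho> (ix r)) else (W ** Dm) $ r $ k)"
  have "det (W ** Dm) - det (padded ix d c ** Y) \<in> ?R"
  proof (rule det_cong_ideal[OF RI])
    fix r k
    have pY: "(padded ix d c ** Y) $ r $ k
        = (if ix r < d then \<Sum>j<d. c (ix r) j * mfps_deriv (e k) (\<rho> j) else Y $ r $ k)"
      unfolding matrix_matrix_mult_def vec_lambda_beta
      by (rule padded_mult[OF ix U(3)]) (simp add: Y_def)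
    show "(W ** Dm) $ r $ k - (padded ix d c ** Y) $ r $ k \<in> ?R"
    proof (cases "ix r < d")
      case True
      have "(W ** Dm) $ r $ k = (\<Sum>l\<in>UNIV. mfps_compose (mfps_deriv (e l) (\<rho>' (ix r))) F
          * mfps_deriv (e k) (F (e l)))"
        using True by (simp add: matrix_matrix_mult_def W_def Dm_def)
      also have "\<dots> = mfps_deriv (e k) (\<Sum>j<d. c (ix r) j * \<rho> j)"
        unfolding sends[OF True, symmetric] by (rule deriv_compose_side[where e = e and e' = e' and F = F, OF e F, symmetric])
      finally show ?thesis using True pY deriv_sum_mod_ideal by simp
    next
      case False
      then have "(W ** Dm) $ r $ k - (padded ix d c ** Y) $ r $ k = 0"
        unfolding pY by (simp add: Y_def)
      then show ?thesis by (simp add: mfps_ideal.span_zero)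
    qed
  qed
  then have "w * (det W * det Dm - det (padded ix d c) * det Y) \<in> ?R"
    unfolding det_mul by (rule mfps_ideal.span_scale)
  moreover have "w * (det W * det Dm - det (padded ix d c) * det Y)
      = (det W * w) * det Dm - (w * det Y) * det (padded ix d c)"
    by (simp only: right_diff_distrib mult_ac)
  ultimately have "det Dm - (w * det Y) * det (padded ix d c) \<in> ?R"
    unfolding w by simp
  then show ?thesis unfolding Dm_def by blast
qed

lemma jacobian_one_side:
  fixes K :: "'n::finite \<Rightarrow> ('n, complex) mfps" and e e' :: "'n \<Rightarrow> 'n + 'n"
  assumes e: "inj e" "range e' = - range e"
  defines "E \<equiv> \<lambda>i. mfps_var (e i) :: ('n + 'n, complex) mfps"
  shows "mfps_deriv (e k) (mfps_compose f E) = mfps_compose (mfps_deriv k f) E"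
    and "mfps_deriv (e' k) (mfps_compose f E) = 0"
    and "det (\<chi> l k. mfps_deriv (e k) (mfps_compose (K l) E))
      = mfps_compose (det (\<chi> l k. mfps_deriv k (K l))) E"
    and "mfps_compose f E = 0 \<Longrightarrow> f = 0"
proof -
  have E1: "ord_ge 1 (E i)" for i unfolding E_def by simp
  show side: "mfps_deriv (e k) (mfps_compose f E) = mfps_compose (mfps_deriv k f) E" for f k
  proof -
    have "mfps_deriv (e k) (mfps_compose f E)
        = (\<Sum>i\<in>UNIV. if i = k then mfps_compose (mfps_deriv i f) E else 0)"
      unfolding mfps_deriv_compose[OF E1]
      by (intro sum.cong refl) (use e(1) in \<open>auto simp: E_def mfps_deriv_var inj_eq\<close>)
    then show ?thesis by simp
  qed
  have "e' k \<noteq> e i" for i k using e(2) by auto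
  then show "mfps_deriv (e' k) (mfps_compose f E) = 0"
    unfolding mfps_deriv_compose[OF E1] by (simp add: E_def mfps_deriv_var)
  have "mfps_compose (det (\<chi> l k. mfps_deriv k (K l))) E
      = det (\<chi> l k. mfps_compose ((\<chi> l k. mfps_deriv k (K l)) $ l $ k) E)"
    by (rule det_hom) (simp_all add: mfps_compose_add mfps_compose_mult[OF E1])
  then show "det (\<chi> l k. mfps_deriv (e k) (mfps_compose (K l) E))
      = mfps_compose (det (\<chi> l k. mfps_deriv k (K l))) E"
    by (simp add: side)
  assume f0: "mfps_compose f E = 0"
  define r where "r = (\<lambda>k. if k \<in> range e then mfps_var (inv e k) else 0 :: ('n, complex) mfps)"
  have r1: "ord_ge 1 (r k)" for k unfolding r_def by simp
  have "mfps_compose (E i) r = mfps_var i" for i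
    unfolding E_def mfps_compose_var[of r, OF r1] using e(1) by (simp add: r_def)
  then have "mfps_compose (mfps_compose f E) r = f"
    by (simp add: mfps_compose_assoc[of E r, OF E1 r1])
  with f0 show "f = 0" by simp
qed

lemma complexified_Inl: "complexified H (Inl l) = mfps_compose (H $ l) (\<lambda>i. mfps_var (Inl i))"
  and complexified_Inr: "complexified H (Inr l) = mfps_compose (mfps_cnj (H $ l)) (\<lambda>i. mfps_var (Inr i))"
  by (simp_all add: complexified_def)

lemma sum_sides:
  "inj (Inl :: 'n \<Rightarrow> 'n + 'n)" "range (Inr :: 'n \<Rightarrow> 'n + 'n) = - range Inl"
  "inj (Inr :: 'n \<Rightarrow> 'n + 'n)" "range (Inl :: 'n \<Rightarrow> 'n + 'n) = - range Inr"
proof -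
  show "range (Inr :: 'n \<Rightarrow> 'n + 'n) = - range Inl" "range (Inl :: 'n \<Rightarrow> 'n + 'n) = - range Inr"
    by (auto simp: image_iff) (metis sum.exhaust)+
qed auto

text \<open>
  The Jacobian determinant of \<open>H\<close> depends on \<open>Z\<close> only, so it is constant along \<open>(0,1)\<close> fields, and
  its conjugate is constant along \<open>(1,0)\<close> fields.  Both are divisible by \<open>det c\<close> on the submanifold.  If \<open>det c\<close> vanished at the origin, a prime of height one
  containing it would be invariant under the whole Lie algebra, contradicting finite type.
\<close>

theorem finite_map_transversal:
  fixes \<rho> \<rho>' :: "'n::finite defining" and H :: "'n fmap" and ix :: "'n \<Rightarrow> nat"
  assumes \<rho>: "formal_generic d \<rho>" and ft: "finite_type d \<rho>" and \<rho>': "formal_generic d \<rho>'"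
    and H: "formal_map H" "finite_map H"
    and sends: "\<And>i. i < d \<Longrightarrow> mfps_compose (\<rho>' i) (complexified H) = (\<Sum>j<d. c i j * \<rho> j)"
    and ix: "bij_betw ix UNIV {..<CARD('n)}"
  shows "mfps_const_coeff (det (padded ix d c)) \<noteq> 0"
proof
  assume \<delta>0: "mfps_const_coeff (det (padded ix d c)) = 0"
  let ?R = "mfps_ideal.span (\<rho> ` {..<d})"
  define \<delta> where "\<delta> = det (padded ix d c)"
  define F where "F = complexified H"
  have H1: "ord_ge 1 (H $ l)" for l using H(1) unfolding formal_map_def ord_ge_1_iff by blast
  have H1': "ord_ge 1 (mfps_cnj (H $ l))" for l
    using H(1) unfolding formal_map_def ord_ge_1_iff mfps_cnj_simps by simp
  have F1: "ord_ge 1 (F k)" for k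
    unfolding F_def by (cases k) (simp_all only: complexified_Inl complexified_Inr ord_ge_compose H1 H1')
  have cross: "mfps_deriv (Inl k) (F (Inr l)) = 0" "mfps_deriv (Inr k) (F (Inl l)) = 0" for k l
    unfolding F_def complexified_Inl complexified_Inr
    by (rule jacobian_one_side(2)[OF sum_sides(3,4)], rule jacobian_one_side(2)[OF sum_sides(1,2)])
  have \<rho>c: "mfps_const_coeff (\<rho> i) = 0" if "i < d" for i using \<rho> that by (simp add: formal_generic_def)
  define J where "J = det (\<chi> l k. mfps_deriv k (H $ l))"
  have J0: "J \<noteq> 0" unfolding J_def by (rule finite_map_jacobian_nonzero[OF H])
  have cnjJ: "det (\<chi> l k. mfps_deriv k (mfps_cnj (H $ l))) = mfps_cnj J"
    using det_hom[of mfps_cnj "\<chi> l k. mfps_deriv k (H $ l)"]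
    by (simp add: J_def mfps_cnj_simps)
  define JZ where "JZ = mfps_compose J (\<lambda>i. mfps_var (Inl i) :: ('n + 'n, complex) mfps)"
  define J\<zeta> where "J\<zeta> = mfps_compose (mfps_cnj J) (\<lambda>i. mfps_var (Inr i) :: ('n + 'n, complex) mfps)"
  have JZ0: "JZ \<noteq> 0" and J\<zeta>0: "J\<zeta> \<noteq> 0"
    using jacobian_one_side(4)[OF sum_sides(1,2), of J] jacobian_one_side(4)[OF sum_sides(3,4), of "mfps_cnj J"]
      J0 mfps_cnj_simps(6)[of J] by (auto simp: JZ_def J\<zeta>_def)
  have dJZ: "mfps_deriv (Inr k) JZ = 0" and dJ\<zeta>: "mfps_deriv (Inl k) J\<zeta> = 0" for k
    unfolding JZ_def J\<zeta>_def
    by (rule jacobian_one_side(2)[OF sum_sides(1,2)], rule jacobian_one_side(2)[OF sum_sides(3,4)])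
  obtain q1 where q1: "JZ - q1 * \<delta> \<in> ?R"
  proof -
    have "det (\<chi> l k. mfps_deriv (Inl k) (F (Inl l))) = JZ"
      unfolding F_def complexified_Inl jacobian_one_side(3)[OF sum_sides(1,2)] JZ_def J_def ..
    with det_divides_jacobian[OF sum_sides(1,2) F1 cross(1) sends[folded F_def] generic_gradients(1)[OF \<rho>'] ix]
    show thesis using that by (auto simp: \<delta>_def)
  qed
  obtain q2 where q2: "J\<zeta> - q2 * \<delta> \<in> ?R"
  proof -
    have "det (\<chi> l k. mfps_deriv (Inr k) (F (Inr l))) = J\<zeta>"
      unfolding F_def complexified_Inr jacobian_one_side(3)[OF sum_sides(3,4)] J\<zeta>_def cnjJ ..
    with det_divides_jacobian[OF sum_sides(3,4) F1 cross(2) sends[folded F_def] generic_gradients(2)[OF \<rho>'] ix]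
    show thesis using that by (auto simp: \<delta>_def)
  qed
  \<comment> \<open>Two retractions: the first eliminates variables \<open>Z\<close> and the second variables \<open>\<zeta>\<close>, so they fix
    \<open>J\<zeta>\<close> and \<open>JZ\<close>, respectively.  They have the same kernel.\<close>
  obtain V G where V: "range Inr \<subseteq> V" and G: "\<And>k. ord_ge 1 (G k)" "\<And>k. mfps_compose (G k) G = G k"
    "\<And>f. mfps_compose f G = 0 \<longleftrightarrow> f \<in> ?R" "\<And>j k. j \<notin> V \<Longrightarrow> mfps_deriv j (G k) = 0"
    "\<And>f. \<forall>j. j \<notin> V \<longrightarrow> mfps_deriv j f = 0 \<Longrightarrow> mfps_compose f G = f"
    "\<And>v0. v0 \<in> V \<Longrightarrow> \<exists>t\<in>complex_tangent_space d \<rho>. \<forall>v\<in>V. t $ v = (if v = v0 then 1 else 0)"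
    by (rule adapted_retraction[OF sum_sides(1,3,2) \<rho>c generic_gradients(1)[OF \<rho>]], assumption) (rule that)
  obtain V' G' where V': "range Inl \<subseteq> V'"
    and G'3: "\<And>f. mfps_compose f G' = 0 \<longleftrightarrow> f \<in> ?R"
    and G'5: "\<And>f. \<forall>j. j \<notin> V' \<longrightarrow> mfps_deriv j f = 0 \<Longrightarrow> mfps_compose f G' = f"
    by (rule adapted_retraction[OF sum_sides(3,1,4) \<rho>c generic_gradients(2)[OF \<rho>]], assumption) (rule that)
  define \<theta> where "\<theta> = (\<lambda>f. mfps_compose f G)"
  have \<theta>_add: "\<theta> (x + y) = \<theta> x + \<theta> y" and \<theta>_mult: "\<theta> (x * y) = \<theta> x * \<theta> y" and \<theta>_1: "\<theta> 1 = 1"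
    and \<theta>_diff: "\<theta> (x - y) = \<theta> x - \<theta> y" for x y
    by (simp_all add: \<theta>_def mfps_compose_add mfps_compose_mult[OF G(1)] mfps_compose_diff)
  have \<theta>_idem: "\<theta> (\<theta> x) = \<theta> x" for x
    unfolding \<theta>_def by (subst mfps_compose_assoc[OF G(1) G(1)]) (simp only: G(2))
  have ker: "\<theta> x = 0 \<longleftrightarrow> x \<in> ?R" for x unfolding \<theta>_def by (rule G(3))
  have "\<theta> J\<zeta> = J\<zeta>"
    unfolding \<theta>_def
  proof (rule G(5), intro allI impI)
    fix j assume "j \<notin> V"
    then have "j \<in> range Inl" using V unfolding sum_sides(4) by blast
    then show "mfps_deriv j J\<zeta> = 0" using dJ\<zeta> by auto
  qed
  then have \<theta>J\<zeta>: "\<theta> J\<zeta> \<noteq> 0" using J\<zeta>0 by simp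
  have "mfps_compose JZ G' = JZ"
  proof (rule G'5, intro allI impI)
    fix j assume "j \<notin> V'"
    then have "j \<in> range Inr" using V' unfolding sum_sides(2) by blast
    then show "mfps_deriv j JZ = 0" using dJZ by auto
  qed
  then have "JZ \<notin> ?R" using JZ0 G'3[of JZ] by simp
  then have \<theta>JZ: "\<theta> JZ \<noteq> 0" by (simp add: ker)
  have "\<theta> J\<zeta> = \<theta> q2 * \<theta> \<delta>" using q2 unfolding ker[symmetric] \<theta>_diff \<theta>_mult by simp
  with \<theta>J\<zeta> have \<theta>\<delta>: "\<theta> \<delta> \<noteq> 0" by auto
  have nonunit: "\<theta> (\<delta> * q) \<noteq> 1" for q
  proof
    assume "\<theta> (\<delta> * q) = 1"
    from arg_cong[OF this, of mfps_const_coeff] \<delta>0 show False by (simp add: \<theta>_def \<delta>_def)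
  qed
  obtain P where P: "mfps_ideal.subspace P" "{x. \<theta> x = 0} \<subseteq> P" "\<delta> \<in> P" "1 \<notin> P"
    and Pinv: "\<And>D f. derivation D \<Longrightarrow> \<forall>x. \<theta> x = 0 \<longrightarrow> \<theta> (D x) = 0 \<Longrightarrow> f \<in> P \<Longrightarrow> \<theta> f \<noteq> 0
      \<Longrightarrow> \<theta> (D f) = 0 \<Longrightarrow> D ` P \<subseteq> P"
    by (rule height_one_prime_invariant[OF \<theta>_add \<theta>_mult \<theta>_1 \<theta>_idem \<theta>\<delta> nonunit]) (rule that)
  have RP: "?R \<subseteq> P" using P(2) ker by auto
  have inP: "f \<in> P" if "f - q * \<delta> \<in> ?R" for f q
  proof -
    have "f - q * \<delta> \<in> P" using that RP by blast
    from mfps_ideal.subspace_add[OF P(1) this mfps_ideal.subspace_scale[OF P(1) P(3), of q]]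
    show ?thesis by simp
  qed
  have gen: "vf_apply X ` P \<subseteq> P" if X: "vf_10 X \<or> vf_01 X" "vf_tangent d \<rho> X" for X
  proof -
    have kerX: "\<forall>x. \<theta> x = 0 \<longrightarrow> \<theta> (vf_apply X x) = 0"
      using vf_tangent_preserves_ideal[OF X(2)] by (simp add: ker)
    have \<theta>0: "\<theta> 0 = 0" by (simp add: \<theta>_def)
    from X(1) show ?thesis
    proof
      assume "vf_10 X"
      then have "X $ k * mfps_deriv k J\<zeta> = 0" for k
        using dJ\<zeta> by (cases k) (simp_all add: vf_10_def)
      then have "vf_apply X J\<zeta> = 0" unfolding vf_apply_def by (intro sum.neutral) auto
      with \<theta>0 show ?thesis
        by (intro Pinv[OF derivation_vf_apply kerX inP[OF q2] \<theta>J\<zeta>]) simp_all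
    next
      assume "vf_01 X"
      then have "X $ k * mfps_deriv k JZ = 0" for k
        using dJZ by (cases k) (simp_all add: vf_01_def)
      then have "vf_apply X JZ = 0" unfolding vf_apply_def by (intro sum.neutral) auto
      with \<theta>0 show ?thesis
        by (intro Pinv[OF derivation_vf_apply kerX inP[OF q1] \<theta>JZ]) simp_all
    qed
  qed
  have "mfps_compose JZ G = 0"
    by (rule finite_type_invariant_ideal[OF ft G P(1) RP P(4) lie_alg_preserves_ideal[OF P(1) gen] inP[OF q1]])
  with \<theta>JZ show False by (simp add: \<theta>_def)
qed

section \<open>Invertibility\<close>

lemma vf_power_0: "vf_power L \<alpha> n 0 = 0"
proof (induction n)
  case (Suc n)
  have "(vf_apply (L n) ^^ k) 0 = 0" for k by (induction k) (auto simp: vf_apply_0)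
  with Suc show ?case by simp
qed simp

lemma vf_power_linear: "vf_power L \<alpha> n (mfps_scale a f + g) = mfps_scale a (vf_power L \<alpha> n f) + vf_power L \<alpha> n g"
proof (induction n arbitrary: f g)
  case (Suc n)
  have "(vf_apply (L n) ^^ k) (mfps_scale a f + g)
      = mfps_scale a ((vf_apply (L n) ^^ k) f) + (vf_apply (L n) ^^ k) g" for k
    by (induction k) (auto simp: vf_apply_add vf_apply_scale)
  with Suc show ?case by simp
qed simp

lemma vf_power_sum:
  "vf_power L \<alpha> n (\<Sum>x\<in>A. mfps_scale (a x) (f x)) = (\<Sum>x\<in>A. mfps_scale (a x) (vf_power L \<alpha> n (f x)))"
  by (induction A rule: infinite_finite_induct) (auto simp: vf_power_0 vf_power_linear)

lemma vf_power_in: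
  assumes "\<And>i f. i < n \<Longrightarrow> f \<in> Q \<Longrightarrow> vf_apply (L i) f \<in> Q" "f \<in> Q"
  shows "vf_power L \<alpha> n f \<in> Q"
  using assms
proof (induction n arbitrary: f)
  case (Suc n)
  have "(vf_apply (L n) ^^ k) f \<in> Q" for k
    by (induction k) (use Suc.prems in auto)
  with Suc show ?case by simp
qed simp

text \<open>
  Let \<open>v\<close> be in the kernel of \<open>H'(0)\<close>.  As \<open>c\<close> is invertible, Cramer's rule applied to the derivative of
  \<open>\<rho>' \<circ> (H, H\<^sup>*) = c \<rho>\<close> in the direction \<open>v\<close> puts the derivatives of the \<open>\<rho>\<^sub>j\<close> in the direction \<open>v\<close> into
  the ideal generated by \<open>\<rho>\<close> and the components of \<open>H'(Z) v\<close>.  This ideal is invariant under the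
  \<open>(0,1)\<close> fields, which kill the series in \<open>Z\<close>, and its elements vanish at the origin.  So \<open>v\<close> is
  annihilated by all the vectors in the definition of finite nondegeneracy.
\<close>

lemma jacobian_injective_if_transversal:
  fixes \<rho> \<rho>' :: "'n::finite defining" and H :: "'n fmap" and ix :: "'n \<Rightarrow> nat"
  assumes \<rho>: "\<And>i. i < d \<Longrightarrow> mfps_const_coeff (\<rho> i) = 0" and nd: "finitely_nondegenerate d \<rho>"
    and H: "formal_map H"
    and sends: "\<And>i. i < d \<Longrightarrow> mfps_compose (\<rho>' i) (complexified H) = (\<Sum>j<d. c i j * \<rho> j)"
    and ix: "bij_betw ix UNIV {..<CARD('n)}" and d: "d \<le> CARD('n)"
    and \<delta>: "mfps_const_coeff (det (padded ix d c)) \<noteq> 0"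
    and v: "jacobian_0 (\<lambda>l. H $ l) *v v = 0"
  shows "v = 0"
proof -
  define F where "F = complexified H"
  have H1: "ord_ge 1 (H $ l)" for l using H unfolding formal_map_def ord_ge_1_iff by blast
  have H1': "ord_ge 1 (mfps_cnj (H $ l))" for l
    using H unfolding formal_map_def ord_ge_1_iff mfps_cnj_simps by simp
  have F1: "ord_ge 1 (F k)" for k
    unfolding F_def by (cases k) (simp_all only: complexified_Inl complexified_Inr ord_ge_compose H1 H1')
  have cross: "mfps_deriv (Inl k) (F (Inr l)) = 0" for k l
    unfolding F_def complexified_Inr by (rule jacobian_one_side(2)[OF sum_sides(3,4)])
  define h where "h = (\<lambda>l. \<Sum>k\<in>UNIV. mfps_scale (v $ k) (mfps_deriv (Inl k) (F (Inl l))))"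
  have dF: "mfps_deriv (Inl k) (F (Inl l)) = mfps_compose (mfps_deriv k (H $ l)) (\<lambda>i. mfps_var (Inl i))" for k l
    unfolding F_def complexified_Inl by (rule jacobian_one_side(1)[OF sum_sides(1,2)])
  have h_const: "mfps_const_coeff (h l) = 0" for l
    using arg_cong[OF v, of "\<lambda>w. w $ l"]
    by (simp add: h_def dF jacobian_0_def matrix_vector_mult_def mult.commute)
  have dh: "mfps_deriv (Inr k) (h l) = 0" for k l
    unfolding h_def dF mfps_deriv_sum mfps_deriv_scale jacobian_one_side(2)[OF sum_sides(1,2)] by simp
  define Q where "Q = mfps_ideal.span (range h \<union> \<rho> ` {..<d})"
  have QI: "mfps_ideal.subspace Q" unfolding Q_def by (rule mfps_ideal.subspace_span)
  have hQ: "h l \<in> Q" for l unfolding Q_def by (intro mfps_ideal.span_base) auto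
  have RQ: "mfps_ideal.span (\<rho> ` {..<d}) \<subseteq> Q" unfolding Q_def by (intro mfps_ideal.span_mono) auto
  have Q0: "mfps_const_coeff f = 0" if "f \<in> Q" for f
    using that unfolding Q_def
  proof (induction rule: mfps_ideal.span_induct_alt)
    case (step a x y)
    then have "mfps_const_coeff x = 0" using h_const \<rho> by auto
    with step show ?case by simp
  qed simp
  obtain L where L: "CR_basis d \<rho> L" and span: "vec.span {vec_at_0 (\<chi> l. vf_power L \<alpha> (CARD('n) - d)
      (Z_gradient (\<rho> j) $ l)) | j \<alpha>. j < d} = UNIV"
    using nd unfolding finitely_nondegenerate_def by (elim exE conjE)
  have LQ: "vf_apply (L i) f \<in> Q" if i: "i < CARD('n) - d" and f: "f \<in> Q" for i f
  proof -
    have Li: "vf_01 (L i)" "vf_tangent d \<rho> (L i)" using L i by (auto simp: CR_basis_def)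
    show ?thesis
      unfolding Q_def
    proof (rule vf_apply_preserves_ideal)
      fix s assume "s \<in> range h \<union> \<rho> ` {..<d}"
      then show "vf_apply (L i) s \<in> mfps_ideal.span (range h \<union> \<rho> ` {..<d})"
      proof
        assume "s \<in> range h"
        then obtain l where s: "s = h l" by blast
        have "L i $ k * mfps_deriv k s = 0" for k
          using Li(1) dh by (cases k) (simp_all add: vf_01_def s)
        then have "vf_apply (L i) s = 0" unfolding vf_apply_def by (intro sum.neutral) auto
        then show ?thesis by (simp add: mfps_ideal.span_zero)
      next
        assume "s \<in> \<rho> ` {..<d}"
        then have "vf_apply (L i) s \<in> mfps_ideal.span (\<rho> ` {..<d})"
          by (intro vf_tangent_preserves_ideal[OF Li(2)] mfps_ideal.span_base)
        then show ?thesis using RQ unfolding Q_def by blast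
      qed
    qed (use f in \<open>simp add: Q_def\<close>)
  qed
  define q where "q = (\<lambda>j. \<Sum>k\<in>UNIV. mfps_scale (v $ k) (mfps_deriv (Inl k) (\<rho> j)))"
  have scaleQ: "mfps_scale a f \<in> Q" if "f \<in> Q" for a f
    by (subst mfps_scale_eq_mult) (rule mfps_ideal.subspace_scale[OF QI that])
  have cq: "(\<Sum>j<d. c i j * q j) \<in> Q" if i: "i < d" for i
  proof -
    let ?E = "\<lambda>k. mfps_deriv (Inl k) (\<Sum>j<d. c i j * \<rho> j)"
    have E: "?E k = (\<Sum>l\<in>UNIV. mfps_compose (mfps_deriv (Inl l) (\<rho>' i)) F * mfps_deriv (Inl k) (F (Inl l)))" for k
      unfolding sends[OF i, symmetric] F_def[symmetric] by (rule deriv_compose_side[where e = Inl and e' = Inr and F = F, OF sum_sides(1,2) F1 cross])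
    have "(\<Sum>k\<in>UNIV. mfps_scale (v $ k) (?E k))
        = (\<Sum>l\<in>UNIV. mfps_compose (mfps_deriv (Inl l) (\<rho>' i)) F * h l)"
      unfolding E h_def mfps_scale_sum sum_distrib_left mfps_scale_mult_right by (rule sum.swap)
    also have "\<dots> \<in> Q"
      by (intro mfps_ideal.subspace_sum[OF QI] mfps_ideal.subspace_scale[OF QI] hQ)
    finally have 1: "(\<Sum>k\<in>UNIV. mfps_scale (v $ k) (?E k)) \<in> Q" .
    have 2: "(\<Sum>k\<in>UNIV. mfps_scale (v $ k) (?E k - (\<Sum>j<d. c i j * mfps_deriv (Inl k) (\<rho> j)))) \<in> Q"
      using deriv_sum_mod_ideal RQ by (intro mfps_ideal.subspace_sum[OF QI] scaleQ) blast
    have "(\<Sum>k\<in>UNIV. mfps_scale (v $ k) (?E k - (\<Sum>j<d. c i j * mfps_deriv (Inl k) (\<rho> j))))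
        = (\<Sum>k\<in>UNIV. mfps_scale (v $ k) (?E k)) - (\<Sum>j<d. c i j * q j)"
    proof -
      have "(\<Sum>j<d. c i j * q j) = (\<Sum>k\<in>UNIV. mfps_scale (v $ k) (\<Sum>j<d. c i j * mfps_deriv (Inl k) (\<rho> j)))"
        unfolding q_def mfps_scale_sum sum_distrib_left mfps_scale_mult_right by (rule sum.swap)
      then show ?thesis by (simp only: mfps_vs.scale_right_diff_distrib sum_subtractf)
    qed
    with mfps_ideal.subspace_diff[OF QI 1 2] show ?thesis by simp
  qed
  have qQ: "q j \<in> Q" if j: "j < d" for j
  proof -
    define x where "x = (\<chi> s. if ix s < d then q (ix s) else 0)"
    have "(padded ix d c *v x) $ r \<in> Q" for r
    proof -
      have "(padded ix d c *v x) $ r = (if ix r < d then \<Sum>j<d. c (ix r) j * q j else x $ r)"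
        unfolding matrix_vector_mult_def vec_lambda_beta
        by (rule padded_mult[OF ix d]) (simp add: x_def)
      then show ?thesis using cq mfps_ideal.subspace_0[OF QI] by (simp add: x_def)
    qed
    note cramer = det_mult_component_in_ideal[OF QI this]
    obtain g where g: "det (padded ix d c) * g = 1" using mfps_unit[OF \<delta>] ..
    have "range ix = {..<CARD('n)}" using ix by (simp add: bij_betw_def)
    then have "j \<in> range ix" using j d by simp
    then obtain s where s: "ix s = j" by blast
    have "g * (det (padded ix d c) * x $ s) = (det (padded ix d c) * g) * x $ s"
      by (simp only: mult_ac)
    also have "\<dots> = q j" unfolding g using s j by (simp add: x_def)
    finally show ?thesis
      using mfps_ideal.subspace_scale[OF QI cramer, of g s] by simp
  qed
  have "(\<Sum>l\<in>UNIV. w $ l * v $ l) = 0"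
    if "w \<in> vec.span {vec_at_0 (\<chi> l. vf_power L \<alpha> (CARD('n) - d) (Z_gradient (\<rho> j) $ l)) | j \<alpha>. j < d}" for w
    using that
  proof (induction rule: vec.span_induct_alt)
    case (step a x y)
    then obtain j \<alpha> where j: "j < d"
      and x: "x = vec_at_0 (\<chi> l. vf_power L \<alpha> (CARD('n) - d) (Z_gradient (\<rho> j) $ l))" by blast
    have "vf_power L \<alpha> (CARD('n) - d) (q j) \<in> Q"
      by (rule vf_power_in[OF LQ qQ[OF j]])
    then have "mfps_const_coeff (vf_power L \<alpha> (CARD('n) - d) (q j)) = 0" by (rule Q0)
    then have "(\<Sum>l\<in>UNIV. x $ l * v $ l) = 0"
      unfolding q_def vf_power_sum by (simp add: x vec_at_0_def Z_gradient_def mult.commute)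
    moreover have "(\<Sum>l\<in>UNIV. (a *s x + y) $ l * v $ l)
        = a * (\<Sum>l\<in>UNIV. x $ l * v $ l) + (\<Sum>l\<in>UNIV. y $ l * v $ l)"
      by (simp add: distrib_right sum.distrib sum_distrib_left mult.assoc)
    ultimately show ?case using step.IH by simp
  qed simp
  then have all: "(\<Sum>l\<in>UNIV. w $ l * v $ l) = 0" for w unfolding span by simp
  have "v $ k = 0" for k
  proof -
    have "(\<Sum>l\<in>UNIV. axis k 1 $ l * v $ l) = (\<Sum>l\<in>UNIV. if l = k then v $ l else 0)"
      by (intro sum.cong) (auto simp: axis_def)
    with all[of "axis k 1"] show ?thesis by simp
  qed
  then show ?thesis by (simp add: vec_eq_iff)
qed

theorem theorem6p5:
  fixes \<rho> \<rho>' :: "'n::finite defining"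
    and H :: "'n fmap"
    and d :: nat
  assumes "formal_generic d \<rho>"
    and "finitely_nondegenerate d \<rho>"
    and "finite_type d \<rho>"
    and "formal_generic d \<rho>'"
    and "formal_map H"
    and "finite_map H"
    and "sends_into d H \<rho> \<rho>'"
  shows "formally_invertible H"
proof -
  obtain c where c: "mfps_compose (\<rho>' i) (complexified H) = (\<Sum>j<d. c i j * \<rho> j)" if "i < d" for i
    using assms(7) unfolding sends_into_def by blast
  obtain ix :: "'n \<Rightarrow> nat" where ix: "bij_betw ix UNIV {..<CARD('n)}"
    using finite_same_card_bij[of "UNIV :: 'n set" "{..<CARD('n)}"] by auto
  have d: "d \<le> CARD('n)"
    by (rule lin_indep_family_extend[OF generic_gradients(1)[OF assms(1)] ix])
  have \<rho>: "mfps_const_coeff (\<rho> i) = 0" if "i < d" for i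
    using assms(1) that by (simp add: formal_generic_def)
  have H1: "ord_ge 1 (H $ l)" for l
    using assms(5) unfolding formal_map_def ord_ge_1_iff by blast
  have "v = 0" if "jacobian_0 (\<lambda>l. H $ l) *v v = 0" for v
    by (rule jacobian_injective_if_transversal[OF \<rho> assms(2,5) c ix d
        finite_map_transversal[OF assms(1,3,4,5,6) c ix] that])
  then have inv: "invertible (jacobian_0 (\<lambda>l. H $ l))"
    by (simp add: invertible_left_inverse matrix_left_invertible_ker)
  obtain K where K: "\<And>i. ord_ge 1 (K i)" "\<And>i. mfps_compose (K i) (\<lambda>l. H $ l) = mfps_var i"
    "\<And>i. mfps_compose (H $ i) K = mfps_var i"
    by (rule formal_inverse_function[OF H1 inv]) (rule that)
  have "formal_map (\<chi> i. K i)" using K(1) unfolding formal_map_def ord_ge_1_iff by simp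
  moreover have "map_compose (\<chi> i. K i) H = (\<chi> j. mfps_var j)"
    by (simp add: map_compose_def K(2)[simplified])
  moreover have "map_compose H (\<chi> i. K i) = (\<chi> j. mfps_var j)"
    using K(3) by (simp add: map_compose_def)
  ultimately show ?thesis unfolding formally_invertible_def by blast
qed

end
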